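(* Let $b\in\mathbb{R}$ and assume that $j=\frac{n-2-b}{2}\in\mathbb{Z}\setminus\{1,\dots,n-2\}$. Then there is a $C>0$ such that for all $u\in C_0^\infty(\mathbb{R}^n\setminus\{0\};\mathbb{C}^m)$ satisfying $$\int_1^2\int_{S^{n-1}} P_ju(r,\cdot)\,r\,dr\,d\omega=0,$$ the following inequality holds true: $$\int_{\mathbb{R}^n} r^{-b}|(\sigma\cdot\nabla)u|^2\,dx\ \ge\ C\int_{\mathbb{R}^n} r^{-b-2}(1+|\log r|)^{-2}|u|^2\,dx.$$
   Context: Let $n\ge2$, and let $\sigma_1,\dots,\sigma_n$ be Hermitian $m\times m$ matrices satisfying $\sigma_i\sigma_l+\sigma_l\sigma_i=2\delta_{il}I_m$ for $i,l=1,\dots,n$, where $I_m$ is the identity matrix. Write $\sigma\cdot\nabla=\sum_{i=1}^n\sigma_i\partial_{x_i}$, $r=|x|$, $\omega=x/|x|$, and $|u|$ for the Euclidean norm of $u$ in $\mathbb{C}^m$. For $n=2$ the set $\{1,\dots,n-2\}$ is empty. The operator $L:=\sum_{i<l}\sigma_i\sigma_l(x_i\partial_{x_l}-x_l\partial_{x_i})$ involves differentiation only in directions tangential to spheres centered at the origin. Its spectrum, as an operator on $\mathbb{C}^m$-valued functions on $S^{n-1}$, is discrete and equals $S_L=\mathbb{Z}\setminus\{1,\dots,n-2\}$; $E_k$ denotes the (finite-dimensional) eigenspace of $L$ corresponding to the eigenvalue $k\in S_L$. For $k\in S_L$, $P_k$ denotes the orthogonal projector in $L^2(\mathbb{R}^n;\mathbb{C}^m)$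 induced by the orthogonal projection onto $E_k$ in $L^2(S^{n-1};\mathbb{C}^m)$, i.e. $P_ku(r,\cdot)$ is the orthogonal projection of $u(r,\cdot)$ onto $E_k$ for each $r>0$.
   Formalization: The constraint is read without the ω-integration, as ∫_1^2 P_j u(r,·) r dr = 0 in E_j; the printed double integral vanishes for every u when j≠0, making the inequality false (u = r^{-j}φ(ω)χ_R(r), φ in E_j, logarithmic cut-offs χ_R); for j=0 both agree. *)

theory Defs
  imports "HOL-Analysis.Analysis"
begin

(* C^k and C^infinity on an open set S. *)
primrec Ck_on :: "nat \<Rightarrow> ('a::euclidean_space \<Rightarrow> 'b::real_normed_vector) \<Rightarrow> 'a set \<Rightarrow> bool" where
  "Ck_on 0 f S \<longleftrightarrow> continuous_on S f"
| "Ck_on (Suc k) f S \<longleftrightarrow>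
     (\<forall>x\<in>S. f differentiable (at x)) \<and>
     (\<forall>v. Ck_on k (\<lambda>x. frechet_derivative f (at x) v) S)"

definition smooth_on :: "('a::euclidean_space \<Rightarrow> 'b::real_normed_vector) \<Rightarrow> 'a set \<Rightarrow> bool" where
  "smooth_on f S \<longleftrightarrow> (\<forall>k. Ck_on k f S)"

(* Elements of C_0^infinity(R^n - {0}) are represented by their extension by zero to the origin. *)
definition test_functions_punctured :: "('a::euclidean_space \<Rightarrow> 'b::real_normed_vector) set" where
  "test_functions_punctured =
     {u. smooth_on u UNIV \<and> compact (closure {x. u x \<noteq> 0}) \<and> 0 \<notin> closure {x. u x \<noteq> 0}}"

definition hermitian :: "complex ^ 'm ^ 'm \<Rightarrow> bool" where
  "hermitian A \<longleftrightarrow> (\<forall>a b. A $ a $ b = cnj (A $ b $ a))"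

definition partial :: "'n \<Rightarrow> (real ^ 'n::finite \<Rightarrow> complex ^ 'm::finite) \<Rightarrow> real ^ 'n \<Rightarrow> complex ^ 'm" where
  "partial i u x = frechet_derivative u (at x) (axis i 1)"

definition dirac ::
  "('n \<Rightarrow> complex ^ 'm ^ 'm) \<Rightarrow> (real ^ 'n::finite \<Rightarrow> complex ^ 'm::finite) \<Rightarrow> real ^ 'n \<Rightarrow> complex ^ 'm"
  where "dirac \<sigma> u x = (\<Sum>i\<in>UNIV. \<sigma> i *v partial i u x)"

definition L_op ::
  "('n \<Rightarrow> complex ^ 'm ^ 'm) \<Rightarrow> (real ^ 'n::{finite,linorder} \<Rightarrow> complex ^ 'm::finite) \<Rightarrow> real ^ 'n::{finite,linorder} \<Rightarrow> complex ^ 'm"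
  where "L_op \<sigma> f x =
    (\<Sum>i\<in>UNIV. \<Sum>l\<in>{l. i < l}.
       (\<sigma> i ** \<sigma> l) *v (x $ i *\<^sub>R partial l f x - x $ l *\<^sub>R partial i f x))"

(* The surface measure on the unit sphere, as the cone measure A |-> n |{x in B_1 - {0}. x/|x| in A}|;
   this is the normalisation for which dx = r^(n-1) dr d\<omega>. *)
definition sphere_measure :: "'a::euclidean_space measure" where
  "sphere_measure =
     scale_measure (of_nat DIM('a))
       (distr (restrict_space lborel (ball 0 1 - {0})) (restrict_space borel (sphere 0 1))
          (\<lambda>x. x /\<^sub>R norm x))"

(* The inner product of L^2(S^{n-1}; C^m). *)
definition sphere_inner :: "(real ^ 'n \<Rightarrow> complex ^ 'm) \<Rightarrow> (real ^ 'n \<Rightarrow> complex ^ 'm) \<Rightarrow> complex" where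
  "sphere_inner f g = (\<integral>\<omega>. (\<Sum>a\<in>UNIV. f \<omega> $ a * cnj (g \<omega> $ a)) \<partial>sphere_measure)"

(* The eigenspace E_k. A function on the sphere is represented by a function on R^n vanishing off
   the sphere. L is tangential, so it is applied to the extension that is constant along rays
   from the origin. *)
definition eigenspace_L :: "('n \<Rightarrow> complex ^ 'm ^ 'm) \<Rightarrow> int \<Rightarrow>
    (real ^ 'n::{finite,linorder} \<Rightarrow> complex ^ 'm::finite) set" where
  "eigenspace_L \<sigma> k =
     {\<phi>. (\<forall>x. x \<notin> sphere 0 1 \<longrightarrow> \<phi> x = 0) \<and>
         smooth_on (\<lambda>x. \<phi> (x /\<^sub>R norm x)) (- {0}) \<and>
         (\<forall>\<omega>\<in>sphere 0 1. L_op \<sigma> (\<lambda>x. \<phi> (x /\<^sub>R norm x)) \<omega> = of_int k *\<^sub>R \<phi> \<omega>)}"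

definition sphere_projection :: "(real ^ 'n \<Rightarrow> complex ^ 'm) set \<Rightarrow>
    (real ^ 'n \<Rightarrow> complex ^ 'm) \<Rightarrow> real ^ 'n \<Rightarrow> complex ^ 'm" where
  "sphere_projection E f =
     (THE \<phi>. \<phi> \<in> E \<and> (\<forall>\<psi>\<in>E. sphere_inner (\<lambda>\<omega>. f \<omega> - \<phi> \<omega>) \<psi> = 0))"

(* The projector P_k on functions on R^n, acting on each sphere |x| = r > 0 separately. *)
definition P_op :: "('n \<Rightarrow> complex ^ 'm ^ 'm) \<Rightarrow> int \<Rightarrow>
    (real ^ 'n::{finite,linorder} \<Rightarrow> complex ^ 'm::finite) \<Rightarrow> real ^ 'n::{finite,linorder} \<Rightarrow> complex ^ 'm" where
  "P_op \<sigma> k u x =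
     sphere_projection (eigenspace_L \<sigma> k) (\<lambda>\<omega>. u (norm x *\<^sub>R \<omega>)) (x /\<^sub>R norm x)"

(* The condition "integral over 1 < r < 2 of P_k u(r, .) r dr = 0", as an identity in E_k.
   For k = 0 the space E_0 consists of the constants, and this is the same as the vanishing of the
   double integral over r and \<omega>. For k \<noteq> 0 every element of E_k has mean zero over the sphere, so
   the \<omega>-integral of P_k u is zero for every u; the E_k-valued integral is the meaningful condition. *)
definition zero_annulus_mean :: "('n \<Rightarrow> complex ^ 'm ^ 'm) \<Rightarrow> int \<Rightarrow>
    (real ^ 'n::{finite,linorder} \<Rightarrow> complex ^ 'm::finite) \<Rightarrow> bool" where
  "zero_annulus_mean \<sigma> k u \<longleftrightarrow>
     (\<forall>\<omega>\<in>sphere 0 1. (LINT r:{1..2}|lborel. r *\<^sub>R P_op \<sigma> k u (r *\<^sub>R \<omega>)) = 0)"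

end

theory Submission
  imports Defs
begin

text \<open>Let \<open>n\<close> be the dimension, \<open>r\<close> the norm of \<open>x\<close>, \<open>D\<close> the Dirac operator and
\<open>L\<close> the tangential operator. By the Clifford relations \<open>(\<sigma> \<cdot> x) D = r \<partial>_r + L\<close>
(\<open>cmul_dir\<close>), and \<open>\<sigma> \<cdot> x\<close> multiplies norms by \<open>r\<close>. In polar coordinates the
left-hand side of the inequality is therefore the integral of
\<open>r powr (2 * j - 1)\<close> times the squared norm of \<open>(r \<partial>_r + L) u(r, \<cdot>)\<close> on the sphere.
Since \<open>L\<close> is symmetric, the Fourier coefficient \<open>c(r)\<close> of \<open>u(r, \<cdot>)\<close> with respect
to an eigenfunction with eigenvalue \<open>k\<close> contributes \<open>r c' + k c\<close>. With \<open>W = r^j c\<close>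
and \<open>t = ln r\<close> this becomes \<open>dW/dt + (k - j) W\<close>, and two cases occur.

If \<open>k \<noteq> j\<close>, then \<open>\<bar>k - j\<bar> \<ge> 1\<close>, because the eigenvalues are integers. The mixed term
integrates to zero and the square of \<open>W\<close> itself is controlled. If \<open>k = j\<close>, only the derivative
of \<open>W\<close> is left. The mean condition says that \<open>r c(r)\<close> has integral zero over \<open>{1..2}\<close>,
so \<open>c\<close> has a zero there, and the inequality of Hardy starting from this zero gives the weight
\<open>(1 + \<bar>t\<bar>)^-2\<close>. Both cases are contained in \<open>radial_inequality\<close>. The inequalities for
the single modes are added up by means of the inequality of Bessel on the left and the equality of
Parseval on the right (\<open>weighted_energy_inequality\<close>).

The spectral theory comes from one identity: for a homogeneous polynomial \<open>q\<close> of degree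
\<open>N\<close>, \<open>(L - (N + n - 2)) (L + N) q = - r^2 D^2 q\<close> (\<open>L_quadratic\<close>). By induction on the
degree every homogeneous polynomial is a finite sum of eigenfunctions with integer eigenvalues
(\<open>hpoly_eigsum\<close>). As polynomials are dense, finite orthonormal sets of eigenfunctions exhaust
the continuous functions on the sphere in the mean-square sense (\<open>sphere_parseval_density\<close>). The same identity shows that an eigenpolynomial with
eigenvalue \<open>j\<close> and degree larger than \<open>\<bar>j\<bar>\<close> equals, on the sphere, a polynomial of lower
degree. Hence \<open>E_j\<close> is finite-dimensional (\<open>E_finite_orthonormal_basis\<close>), the projection that
defines \<open>P_j\<close> exists, and it is given by Fourier coefficients
(\<open>sphere_projection_eq_sproj\<close>).

The symmetry of \<open>L\<close> rests on the fact that rotation fields integrate to zero over the sphere.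
Throughout, \<open>\<complex>^m\<close> is regarded as a real Euclidean space; as the eigenspaces are complex
subspaces, real and complex orthogonality to them agree.\<close>


section \<open>Polar coordinates for the surface measure\<close>

lemma space_sphere_measure [simp]: "space sphere_measure = sphere 0 1"
  by (simp add: sphere_measure_def space_scale_measure space_restrict_space)

lemma sets_sphere_measure:
  "sets sphere_measure = sets (restrict_space borel (sphere 0 1))"
  by (simp add: sphere_measure_def)

lemma measurable_direction:
  "(\<lambda>x. x /\<^sub>R norm x) \<in> restrict_space lborel (X - {0}) \<rightarrow>\<^sub>M
     (restrict_space borel (sphere 0 1) :: 'a::euclidean_space measure)"
proof (rule measurable_restrict_space2)
  show "(\<lambda>x. x /\<^sub>R norm x) \<in> space (restrict_space lborel (X - {0})) \<rightarrow> sphere 0 1"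
    by (auto simp: space_restrict_space)
  show "(\<lambda>x. x /\<^sub>R norm x) \<in> restrict_space lborel (X - {0}) \<rightarrow>\<^sub>M borel"
    by (rule measurable_restrict_space1) measurable
qed

lemma cone_sets_borel:
  assumes "B \<in> sets (sphere_measure :: 'a::euclidean_space measure)"
  shows "{x::'a. x \<noteq> 0 \<and> x /\<^sub>R norm x \<in> B} \<in> sets borel"
proof -
  have "B \<in> sets borel" "B \<subseteq> sphere 0 1"
    using assms by (auto simp: sets_sphere_measure sets_restrict_space)
  then have "{x::'a. x \<noteq> 0 \<and> x /\<^sub>R norm x \<in> B} = (\<lambda>x. x /\<^sub>R norm x) -` B \<inter> space borel"
    by auto
  also have "\<dots> \<in> sets borel"
    by (rule measurable_sets[OF _ \<open>B \<in> sets borel\<close>]) measurable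
  finally show ?thesis .
qed

lemma emeasure_sphere_measure:
  assumes "B \<in> sets (sphere_measure :: 'a::euclidean_space measure)"
  shows "emeasure sphere_measure B =
    of_nat DIM('a) * emeasure lborel {x::'a. norm x < 1 \<and> x \<noteq> 0 \<and> x /\<^sub>R norm x \<in> B}"
proof -
  let ?M = "restrict_space lborel (ball 0 1 - {0}) :: 'a measure"
  have "emeasure sphere_measure B = of_nat DIM('a) * emeasure ?M ((\<lambda>x. x /\<^sub>R norm x) -` B \<inter> space ?M)"
    unfolding sphere_measure_def
    by (subst emeasure_scale_measure, subst emeasure_distr)
       (use assms measurable_direction in \<open>auto simp: sets_sphere_measure\<close>)
  also have "(\<lambda>x. x /\<^sub>R norm x) -` B \<inter> space ?M = {x::'a. norm x < 1 \<and> x \<noteq> 0 \<and> x /\<^sub>R norm x \<in> B}"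
    by (auto simp: space_restrict_space)
  also have "emeasure ?M \<dots> = emeasure lborel \<dots>"
    by (rule emeasure_restrict_space) auto
  finally show ?thesis .
qed

lemma finite_measure_sphere_measure: "finite_measure (sphere_measure :: 'a::euclidean_space measure)"
proof
  let ?X = "{x::'a. norm x < 1 \<and> x \<noteq> 0 \<and> x /\<^sub>R norm x \<in> sphere 0 1}"
  have "emeasure lborel ?X \<le> emeasure lborel (ball (0::'a) 1)"
    by (rule emeasure_mono) auto
  also have "\<dots> < \<infinity>"
    using emeasure_lborel_ball_finite[of "0::'a" 1] by (simp add: top.not_eq_extremum)
  finally have "emeasure sphere_measure (space (sphere_measure :: 'a measure)) < \<infinity>"
    by (subst emeasure_sphere_measure[OF sets.top])
       (simp add: ennreal_mult_less_top of_nat_less_top)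
  then show "emeasure sphere_measure (space (sphere_measure :: 'a measure)) \<noteq> \<infinity>" by simp
qed

lemma emeasure_lborel_scale:
  assumes X: "X \<in> sets borel" and c: "c > 0"
  shows "emeasure lborel {x::'a::euclidean_space. x /\<^sub>R c \<in> X} = ennreal (c ^ DIM('a)) * emeasure lborel X"
proof -
  have m: "(\<lambda>x::'a. 0 + (1/c) *\<^sub>R x) \<in> lborel \<rightarrow>\<^sub>M borel" by measurable
  have "emeasure lborel X = emeasure (density (distr lborel borel (\<lambda>x::'a. 0 + (1/c) *\<^sub>R x)) (\<lambda>_. ennreal (\<bar>1/c\<bar> ^ DIM('a)))) X"
    using c by (subst lborel_affine[of "1/c" "0::'a"]) auto
  also have "\<dots> = ennreal (\<bar>1/c\<bar> ^ DIM('a)) * emeasure lborel ((\<lambda>x::'a. 0 + (1/c) *\<^sub>R x) -` X)"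
    using X m by (simp add: emeasure_density nn_integral_cmult_indicator emeasure_distr)
  also have "(\<lambda>x::'a. 0 + (1/c) *\<^sub>R x) -` X = {x. x /\<^sub>R c \<in> X}"
    by (auto simp: divide_inverse)
  finally have "ennreal (c ^ DIM('a)) * emeasure lborel X =
      (ennreal (c ^ DIM('a)) * ennreal (\<bar>1/c\<bar> ^ DIM('a))) * emeasure lborel {x::'a. x /\<^sub>R c \<in> X}"
    by (simp add: mult.assoc)
  also have "ennreal (c ^ DIM('a)) * ennreal (\<bar>1/c\<bar> ^ DIM('a)) = 1"
    using c by (simp flip: ennreal_mult power_mult_distrib)
  finally show ?thesis by simp
qed

text \<open>Scaling turns the normalisation of the surface measure, which refers to the unit ball, into the
statement about balls of all radii that characterises polar coordinates on cones.\<close>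

lemma emeasure_cone_sector:
  assumes B: "B \<in> sets (sphere_measure :: 'a::euclidean_space measure)" and R: "R > 0"
  shows "emeasure lborel {x::'a. norm x < R \<and> x \<noteq> 0 \<and> x /\<^sub>R norm x \<in> B} =
    ennreal (R ^ DIM('a) / real DIM('a)) * emeasure sphere_measure B"
proof -
  let ?K = "\<lambda>R. {x::'a. norm x < R \<and> x \<noteq> 0 \<and> x /\<^sub>R norm x \<in> B}"
  have K: "?K 1 \<in> sets borel"
  proof -
    have "?K 1 = ball 0 1 \<inter> {x::'a. x \<noteq> 0 \<and> x /\<^sub>R norm x \<in> B}" by auto
    then show ?thesis using cone_sets_borel[OF B] by auto
  qed
  have "?K R = {x. x /\<^sub>R R \<in> ?K 1}"
    using R by (auto simp: field_simps)
  then have "emeasure lborel (?K R) = ennreal (R ^ DIM('a)) * emeasure lborel (?K 1)"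
    using emeasure_lborel_scale[OF K R] by simp
  also have "R ^ DIM('a) = R ^ DIM('a) / real DIM('a) * real DIM('a)" by simp
  also have "ennreal \<dots> = ennreal (R ^ DIM('a) / real DIM('a)) * of_nat DIM('a)"
    using R by (subst ennreal_mult) (auto simp: ennreal_of_nat_eq_real_of_nat)
  finally show ?thesis
    by (simp add: emeasure_sphere_measure[OF B] mult.assoc)
qed

text \<open>The radial factor of Lebesgue measure in dimension \<open>d\<close>: the measure with density
\<open>r ^ (d - 1)\<close> on the positive half-line.\<close>

definition radial_measure :: "nat \<Rightarrow> real measure" where
  "radial_measure d = density lborel (\<lambda>r. ennreal (r ^ (d - 1)) * indicator {0<..} r)"

lemma sets_radial_measure [simp, measurable_cong]: "sets (radial_measure d) = sets borel"
  and space_radial_measure [simp]: "space (radial_measure d) = UNIV"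
  by (auto simp: radial_measure_def)

lemma emeasure_radial_measure_lessThan:
  assumes "d > 0" "R > 0"
  shows "emeasure (radial_measure d) {..<R} = ennreal (R ^ d / real d)"
proof -
  have "emeasure (radial_measure d) {..<R} =
      (\<integral>\<^sup>+r. ennreal (r ^ (d - 1)) * indicator {0<..} r * indicator {..<R} r \<partial>lborel)"
    unfolding radial_measure_def by (rule emeasure_density) auto
  also have "\<dots> = (\<integral>\<^sup>+r. ennreal (r ^ (d - 1)) * indicator {0..R} r \<partial>lborel)"
  proof (rule nn_integral_cong_AE)
    have "AE r in lborel. r \<noteq> (0::real) \<and> r \<noteq> R"
      using AE_lborel_singleton[of "0::real"] AE_lborel_singleton[of R] by eventually_elim auto
    then show "AE r in lborel. ennreal (r ^ (d - 1)) * indicator {0<..} r * indicator {..<R} r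
        = ennreal (r ^ (d - 1)) * indicator {0..R} r"
      by eventually_elim (auto simp: indicator_def)
  qed
  also have "\<dots> = ennreal (R ^ d / real d - 0 ^ d / real d)"
  proof (subst nn_integral_FTC_Icc[where F="\<lambda>r. r ^ d / real d"])
    show "((\<lambda>r. r ^ d / real d) has_real_derivative r ^ (d - 1)) (at r)" if "r \<in> {0..R}" for r
      using assms
      by (auto intro!: derivative_eq_intros simp: )
  qed (use assms in auto)
  finally show ?thesis using assms by (simp add: zero_power)
qed

text \<open>For a fixed cone over \<open>B\<close> both sides are measures in \<open>A\<close>. They agree on the
half-lines \<open>{..<R}\<close>, an intersection-stable generator on which they are finite, hence everywhere.\<close>

lemma emeasure_radial_times_sphere:
  fixes B :: "'a::euclidean_space set"
  assumes A: "A \<in> sets borel" and B: "B \<in> sets sphere_measure"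
  shows "emeasure (radial_measure DIM('a)) A * emeasure sphere_measure B =
    emeasure lborel {x::'a. x \<noteq> 0 \<and> norm x \<in> A \<and> x /\<^sub>R norm x \<in> B}"
proof -
  let ?C = "{x::'a. x \<noteq> 0 \<and> x /\<^sub>R norm x \<in> B}"
  let ?M1 = "scale_measure (emeasure sphere_measure B) (radial_measure DIM('a))"
  let ?M2 = "distr (restrict_space lborel ?C) borel norm"
  have C: "?C \<in> sets borel" by (rule cone_sets_borel[OF B])
  interpret S: finite_measure "sphere_measure :: 'a measure" by (rule finite_measure_sphere_measure)
  have norm_m: "norm \<in> restrict_space lborel ?C \<rightarrow>\<^sub>M borel"
    by (rule measurable_restrict_space1) measurable
  have M2: "emeasure ?M2 X = emeasure lborel {x::'a. x \<noteq> 0 \<and> norm x \<in> X \<and> x /\<^sub>R norm x \<in> B}"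
    if "X \<in> sets borel" for X
  proof -
    have "emeasure ?M2 X = emeasure (restrict_space lborel ?C) (norm -` X \<inter> space (restrict_space lborel ?C))"
      using that norm_m by (rule emeasure_distr[rotated])
    also have "\<dots> = emeasure lborel (norm -` X \<inter> space (restrict_space lborel ?C))"
      using C by (intro emeasure_restrict_space) (auto simp: space_restrict_space)
    also have "norm -` X \<inter> space (restrict_space lborel ?C) = {x::'a. x \<noteq> 0 \<and> norm x \<in> X \<and> x /\<^sub>R norm x \<in> B}"
      by (auto simp: space_restrict_space)
    finally show ?thesis .
  qed
  have less: "emeasure ?M1 {..<R} = emeasure ?M2 {..<R}" for R
  proof (cases "R > 0")
    case True
    have "{x::'a. x \<noteq> 0 \<and> norm x \<in> {..<R} \<and> x /\<^sub>R norm x \<in> B} = {x. norm x < R \<and> x \<noteq> 0 \<and> x /\<^sub>R norm x \<in> B}"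
      by auto
    then show ?thesis
      using True by (simp add: M2 emeasure_cone_sector[OF B] emeasure_radial_measure_lessThan mult.commute)
  next
    case False
    have e1: "emeasure (radial_measure DIM('a)) {..<R} = 0"
      unfolding radial_measure_def
      using False by (subst emeasure_density) (auto simp: nn_integral_0_iff_AE indicator_def)
    have e2: "{x::'a. x \<noteq> 0 \<and> norm x \<in> {..<R} \<and> x /\<^sub>R norm x \<in> B} = {}"
      using False by (auto simp: not_less intro: order_trans)
    have "emeasure ?M2 {..<R} = 0" using M2[of "{..<R}"] unfolding e2 by simp
    then show ?thesis by (simp only: emeasure_scale_measure e1 mult_zero_right)
  qed
  have "?M1 = ?M2"
  proof (rule measure_eqI_generator_eq[where E="range lessThan" and \<Omega>=UNIV and A="\<lambda>i. {..<real i + 1}"])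
    show "Int_stable (range (lessThan :: real \<Rightarrow> real set))"
    proof (rule Int_stableI)
      fix a b assume "a \<in> range (lessThan :: real \<Rightarrow> real set)" "b \<in> range (lessThan :: real \<Rightarrow> real set)"
      then obtain x y where "a = {..<x}" "b = {..<y}" by auto
      then have "a \<inter> b = {..<min x y}" by auto
      then show "a \<inter> b \<in> range lessThan" by blast
    qed
    show "sets ?M1 = sigma_sets UNIV (range lessThan)"
      by (simp add: borel_Iio)
    show "sets ?M2 = sigma_sets UNIV (range lessThan)"
      by (simp add: borel_Iio)
    show "(\<Union>i. {..<real i + 1}) = (UNIV :: real set)"
    proof -
      have "\<exists>i. x < real i + 1" for x :: real
        using reals_Archimedean2[of x] by (meson less_add_one less_trans)
      then show ?thesis by auto
    qed
    show "emeasure ?M1 {..<real i + 1} \<noteq> \<infinity>" for i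
      by (simp add: emeasure_radial_measure_lessThan S.emeasure_eq_measure ennreal_mult_eq_top_iff)
  qed (use less in auto)
  then have "emeasure ?M1 A = emeasure ?M2 A" by simp
  then show ?thesis using A by (simp add: M2 mult.commute)
qed

lemma polar_coordinates_measure:
  "radial_measure DIM('a) \<Otimes>\<^sub>M sphere_measure =
   distr (restrict_space lborel (- {0::'a::euclidean_space})) (borel \<Otimes>\<^sub>M restrict_space borel (sphere 0 1))
     (\<lambda>x. (norm x, x /\<^sub>R norm x))"
proof (rule pair_measure_eqI)
  let ?R = "restrict_space lborel (- {0::'a})"
  interpret S: finite_measure "sphere_measure :: 'a measure" by (rule finite_measure_sphere_measure)
  show "sigma_finite_measure (sphere_measure :: 'a measure)" by unfold_locales
  show "sigma_finite_measure (radial_measure DIM('a))"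
    unfolding radial_measure_def
    by (subst sigma_finite_measure.sigma_finite_iff_density_finite[OF sigma_finite_lborel])
       (auto simp: indicator_def ennreal_mult_eq_top_iff)
  show "sets (radial_measure DIM('a) \<Otimes>\<^sub>M sphere_measure) =
    sets (distr ?R (borel \<Otimes>\<^sub>M restrict_space borel (sphere 0 1)) (\<lambda>x. (norm x, x /\<^sub>R norm x)))"
    by (simp add: sets_sphere_measure cong: sets_pair_measure_cong)
  have m: "(\<lambda>x. (norm x, x /\<^sub>R norm x)) \<in> ?R \<rightarrow>\<^sub>M borel \<Otimes>\<^sub>M restrict_space borel (sphere 0 1)"
    using measurable_direction[of UNIV]
    by (intro measurable_Pair) (auto intro!: measurable_restrict_space1 simp: Compl_eq_Diff_UNIV)
  fix A and B :: "'a set" assume A: "A \<in> sets (radial_measure DIM('a))" and B: "B \<in> sets sphere_measure"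
  then have AB: "A \<times> B \<in> sets (borel \<Otimes>\<^sub>M restrict_space borel (sphere 0 1))"
    by (auto simp: sets_sphere_measure)
  have "emeasure (distr ?R (borel \<Otimes>\<^sub>M restrict_space borel (sphere 0 1)) (\<lambda>x. (norm x, x /\<^sub>R norm x))) (A \<times> B) =
      emeasure ?R ((\<lambda>x. (norm x, x /\<^sub>R norm x)) -` (A \<times> B) \<inter> space ?R)"
    by (rule emeasure_distr[OF m AB])
  also have "\<dots> = emeasure lborel ((\<lambda>x. (norm x, x /\<^sub>R norm x)) -` (A \<times> B) \<inter> space ?R)"
    by (rule emeasure_restrict_space) (auto simp: space_restrict_space)
  also have "(\<lambda>x. (norm x, x /\<^sub>R norm x)) -` (A \<times> B) \<inter> space ?R =
      {x::'a. x \<noteq> 0 \<and> norm x \<in> A \<and> x /\<^sub>R norm x \<in> B}"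
    by (auto simp: space_restrict_space)
  finally show "emeasure (radial_measure DIM('a)) A * emeasure sphere_measure B =
    emeasure (distr ?R (borel \<Otimes>\<^sub>M restrict_space borel (sphere 0 1)) (\<lambda>x. (norm x, x /\<^sub>R norm x))) (A \<times> B)"
    using A B by (simp add: emeasure_radial_times_sphere)
qed


section \<open>Integration over the space and over the sphere\<close>

text \<open>Differentiation under the integral sign: the mean value theorem bounds the difference quotients by
\<open>w\<close>, so dominated convergence applies.\<close>

lemma leibniz_integral:
  fixes F F' :: "real \<Rightarrow> 'x \<Rightarrow> real"
  assumes t0: "t0 \<in> {a<..<b}"
    and int: "\<And>t. t \<in> {a<..<b} \<Longrightarrow> integrable M (F t)"
    and der: "\<And>t x. t \<in> {a<..<b} \<Longrightarrow> x \<in> space M \<Longrightarrow> ((\<lambda>t. F t x) has_real_derivative F' t x) (at t)"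
    and meas: "F' t0 \<in> borel_measurable M"
    and w: "integrable M w" and bound: "\<And>t x. t \<in> {a<..<b} \<Longrightarrow> x \<in> space M \<Longrightarrow> \<bar>F' t x\<bar> \<le> w x"
  shows "((\<lambda>t. \<integral>x. F t x \<partial>M) has_real_derivative (\<integral>x. F' t0 x \<partial>M)) (at t0)"
proof -
  have "((\<lambda>h. ((\<integral>x. F (t0 + h) x \<partial>M) - (\<integral>x. F t0 x \<partial>M)) / h) \<longlongrightarrow> (\<integral>x. F' t0 x \<partial>M)) (at 0)"
    unfolding tendsto_at_iff_sequentially
  proof (intro allI impI)
    fix X :: "nat \<Rightarrow> real" assume X: "\<forall>i. X i \<in> UNIV - {0}" "X \<longlonglongrightarrow> 0"
    have "open {a - t0<..<b - t0}" by (rule open_greaterThanLessThan)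
    moreover have "0 \<in> {a - t0<..<b - t0}" using t0 by simp
    ultimately have "eventually (\<lambda>i. X i \<in> {a - t0<..<b - t0}) sequentially"
      using X(2) by (rule topological_tendstoD[rotated])
    then obtain N where N: "\<And>i. i \<ge> N \<Longrightarrow> X i \<in> {a - t0<..<b - t0}"
      by (auto simp: eventually_sequentially)
    define Y where "Y i = X (i + N)" for i
    have Y: "t0 + Y i \<in> {a<..<b}" "Y i \<noteq> 0" for i
      using N[of "i + N"] X(1) by (auto simp: Y_def)
    have Y0: "Y \<longlonglongrightarrow> 0" unfolding Y_def using X(2) by (rule LIMSEQ_ignore_initial_segment)
    have "(\<lambda>i. \<integral>x. (F (t0 + Y i) x - F t0 x) / Y i \<partial>M) \<longlonglongrightarrow> (\<integral>x. F' t0 x \<partial>M)"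
    proof (rule integral_dominated_convergence[where w = w])
      show "(\<lambda>x. (F (t0 + Y i) x - F t0 x) / Y i) \<in> borel_measurable M" for i
        using int[OF Y(1)[of i]] int[OF t0] by measurable
      show "AE x in M. (\<lambda>i. (F (t0 + Y i) x - F t0 x) / Y i) \<longlonglongrightarrow> F' t0 x"
      proof (rule AE_I2)
        fix x assume "x \<in> space M"
        then have "((\<lambda>h. (F (t0 + h) x - F t0 x) / h) \<longlongrightarrow> F' t0 x) (at 0)"
          using der[OF t0] by (simp add: DERIV_def)
        then show "(\<lambda>i. (F (t0 + Y i) x - F t0 x) / Y i) \<longlonglongrightarrow> F' t0 x"
          using Y Y0 by (auto simp: tendsto_at_iff_sequentially o_def)
      qed
      show "AE x in M. norm ((F (t0 + Y i) x - F t0 x) / Y i) \<le> w x" for i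
      proof (rule AE_I2)
        fix x assume x: "x \<in> space M"
        have "norm (F (t0 + Y i) x - F t0 x) \<le> w x * norm (t0 + Y i - t0)"
        proof (rule differentiable_bound[where S = "{a<..<b}" and f' = "\<lambda>t h. F' t x * h"])
          show "((\<lambda>t. F t x) has_derivative (\<lambda>h. F' t x * h)) (at t within {a<..<b})" if "t \<in> {a<..<b}" for t
            using der[OF that x] by (simp add: has_field_derivative_def has_derivative_at_withinI)
          show "onorm (\<lambda>h. F' t x * h) \<le> w x" if "t \<in> {a<..<b}" for t
            using bound[OF that x] by (intro onorm_bound) (auto simp: abs_mult intro: mult_right_mono order_trans[OF abs_ge_zero])
        qed (use Y t0 in auto)
        then show "norm ((F (t0 + Y i) x - F t0 x) / Y i) \<le> w x"
          using Y(2)[of i] by (simp add: divide_simps)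
      qed
    qed (use meas w in auto)
    moreover have "(\<integral>x. (F (t0 + Y i) x - F t0 x) / Y i \<partial>M) =
        ((\<integral>x. F (t0 + Y i) x \<partial>M) - (\<integral>x. F t0 x \<partial>M)) / Y i" for i
      using int[OF Y(1)[of i]] int[OF t0] by simp
    ultimately have "(\<lambda>i. ((\<integral>x. F (t0 + X (i + N)) x \<partial>M) - (\<integral>x. F t0 x \<partial>M)) / X (i + N)) \<longlonglongrightarrow> (\<integral>x. F' t0 x \<partial>M)"
      by (simp only: Y_def)
    then show "((\<lambda>h. ((\<integral>x. F (t0 + h) x \<partial>M) - (\<integral>x. F t0 x \<partial>M)) / h) \<circ> X) \<longlonglongrightarrow> (\<integral>x. F' t0 x \<partial>M)"
      unfolding o_def by (rule LIMSEQ_offset)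
  qed
  then show ?thesis by (simp add: DERIV_def)
qed

text \<open>Lebesgue measure is translation invariant, so the integral of \<open>H (x + t v)\<close> does not depend
on \<open>t\<close>; its derivative at \<open>t = 0\<close> is the integral in question.\<close>

lemma integral_directional_derivative_eq_0:
  fixes H :: "'a::euclidean_space \<Rightarrow> real"
  assumes der: "\<And>x. (H has_derivative H' x) (at x)"
    and cont: "continuous_on UNIV (\<lambda>x. H' x v)"
    and supp: "\<And>x. R \<le> norm x \<Longrightarrow> H x = 0"
  shows "(\<integral>x. H' x v \<partial>lborel) = 0"
proof -
  have contH: "continuous_on UNIV H"
    by (intro continuous_at_imp_continuous_on ballI has_derivative_continuous[OF der])
  have supp': "H' x v = 0" if "R < norm x" for x
  proof -
    have "(H has_derivative (\<lambda>_. 0)) (at x)"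
    proof (rule has_derivative_transform_within_open[of "\<lambda>_. 0"])
      show "open {y. R < norm y}" by (intro open_Collect_less continuous_intros)
    qed (use that supp in auto)
    then have "H' x = (\<lambda>_. 0)" by (rule has_derivative_unique[OF der])
    then show ?thesis by simp
  qed
  let ?C = "cball (0::'a) (\<bar>R\<bar> + norm v)"
  obtain K where K: "\<forall>x\<in>?C. \<bar>H' x v\<bar> \<le> K"
  proof -
    have "compact ((\<lambda>x. H' x v) ` ?C)"
      by (rule compact_continuous_image[OF continuous_on_subset[OF cont]]) auto
    then have "bounded ((\<lambda>x. H' x v) ` ?C)" by (rule compact_imp_bounded)
    then show thesis using that unfolding bounded_iff by (auto simp del: mem_cball_0)
  qed
  define K' where "K' = max K 0"
  have bnd: "\<bar>H' (x + t *\<^sub>R v) v\<bar> \<le> K' * indicator (cball 0 (\<bar>R\<bar> + 2 * norm v)) x" if "t \<in> {-1<..<1}" for t x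
  proof (cases "norm (x + t *\<^sub>R v) \<le> \<bar>R\<bar> + norm v")
    case True
    have "norm x \<le> norm (x + t *\<^sub>R v) + norm (t *\<^sub>R v)"
      using norm_triangle_ineq4[of "x + t *\<^sub>R v" "t *\<^sub>R v"] by simp
    also have "norm (t *\<^sub>R v) \<le> norm v" using that by (auto intro: mult_left_le_one_le)
    finally show ?thesis using True K[rule_format, of "x + t *\<^sub>R v"] by (auto simp: K'_def le_max_iff_disj)
  next
    case False
    then have "R < norm (x + t *\<^sub>R v)" by (smt (verit) norm_ge_zero)
    then show ?thesis by (simp add: supp' K'_def indicator_def)
  qed
  have intC: "integrable lborel (\<lambda>x. K' * indicator (cball 0 c) (x::'a) :: real)" for c
    by (intro integrable_mult_right integrable_real_indicator) (use emeasure_lborel_cball_finite[of "0::'a" c] in simp_all)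
  have "((\<lambda>t. \<integral>x. H (x + t *\<^sub>R v) \<partial>lborel) has_real_derivative (\<integral>x. H' (x + 0 *\<^sub>R v) v \<partial>lborel)) (at 0)"
  proof (rule leibniz_integral[where a = "-1" and b = 1 and w = "\<lambda>x. K' * indicator (cball 0 (\<bar>R\<bar> + 2 * norm v)) x"])
    fix t :: real assume t: "t \<in> {-1<..<1}"
    have "compact (H ` cball 0 \<bar>R\<bar>)"
      by (rule compact_continuous_image[OF continuous_on_subset[OF contH]]) auto
    then have "bounded (H ` cball 0 \<bar>R\<bar>)" by (rule compact_imp_bounded)
    then obtain B where B: "\<And>x. x \<in> cball 0 \<bar>R\<bar> \<Longrightarrow> norm (H x) \<le> B"
      unfolding bounded_iff by blast
    have "integrable lborel H"
    proof (rule integrableI_bounded_set)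
      show "H \<in> borel_measurable lborel" using contH by (simp add: borel_measurable_continuous_onI)
      show "AE x in lborel. x \<in> cball 0 \<bar>R\<bar> \<longrightarrow> norm (H x) \<le> B" using B by blast
      show "AE x in lborel. x \<notin> cball 0 \<bar>R\<bar> \<longrightarrow> H x = 0" using supp by (auto simp: dist_norm)
    qed (use emeasure_lborel_cball_finite[of "0::'a" "\<bar>R\<bar>"] in simp_all)
    then have "integrable (distr lborel borel (\<lambda>x. t *\<^sub>R v + x)) H"
      by (simp add: lborel_distr_plus)
    then show "integrable lborel (\<lambda>x. H (x + t *\<^sub>R v))"
      by (subst (asm) integrable_distr_eq) (auto simp: borel_measurable_continuous_onI contH add.commute)
    fix x :: 'a
    have "((\<lambda>t. H (x + t *\<^sub>R v)) has_derivative (\<lambda>h. H' (x + t *\<^sub>R v) (h *\<^sub>R v))) (at t)"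
      by (rule has_derivative_compose[OF _ der, of "\<lambda>t. x + t *\<^sub>R v"]) (auto intro!: derivative_eq_intros)
    moreover have "H' (x + t *\<^sub>R v) (h *\<^sub>R v) = H' (x + t *\<^sub>R v) v * h" for h
      using has_derivative_linear[OF der[of "x + t *\<^sub>R v"]] by (simp add: linear_scale)
    ultimately show "((\<lambda>t. H (x + t *\<^sub>R v)) has_real_derivative H' (x + t *\<^sub>R v) v) (at t)"
      by (simp add: has_field_derivative_def)
  next
    show "integrable lborel (\<lambda>x. K' * indicator (cball 0 (\<bar>R\<bar> + 2 * norm v)) (x::'a) :: real)" by (rule intC)
  qed (use cont bnd in \<open>auto simp: borel_measurable_continuous_onI\<close>)
  moreover have "(\<integral>x. H (x + t *\<^sub>R v) \<partial>lborel) = (\<integral>x. H x \<partial>lborel)" for t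
  proof -
    have "(\<integral>x. H x \<partial>lborel) = (\<integral>x. H x \<partial>distr lborel borel (\<lambda>x. t *\<^sub>R v + x))"
      by (simp add: lborel_distr_plus)
    also have "\<dots> = (\<integral>x. H (t *\<^sub>R v + x) \<partial>lborel)"
      by (rule integral_distr) (auto simp: borel_measurable_continuous_onI contH)
    finally show ?thesis by (simp add: add.commute)
  qed
  ultimately have "((\<lambda>t::real. \<integral>x. H x \<partial>lborel) has_real_derivative (\<integral>x. H' x v \<partial>lborel)) (at 0)"
    by simp
  then show ?thesis using DERIV_const DERIV_unique by blast
qed

lemma direction_in_sphere: "x \<noteq> 0 \<Longrightarrow> x /\<^sub>R norm x \<in> sphere 0 1"
  by simp

lemma borel_measurable_sphere:
  "continuous_on (sphere 0 1) f \<Longrightarrow> f \<in> borel_measurable sphere_measure"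
  using borel_measurable_continuous_on_restrict[of "sphere 0 1" f]
  by (simp add: measurable_def sets_sphere_measure space_restrict_space)

lemma integrable_sphere:
  fixes f :: "'a::euclidean_space \<Rightarrow> 'b::{banach, second_countable_topology}"
  assumes "continuous_on (sphere 0 1) f"
  shows "integrable sphere_measure f"
proof -
  interpret finite_measure "sphere_measure :: 'a measure" by (rule finite_measure_sphere_measure)
  have "compact (f ` sphere 0 1)" using assms by (intro compact_continuous_image) auto
  then obtain B where B: "\<And>x. x \<in> sphere 0 1 \<Longrightarrow> norm (f x) \<le> B"
    using compact_imp_bounded[of "f ` sphere 0 1"] unfolding bounded_iff by blast
  then show ?thesis
    by (intro integrable_const_bound[where B = B] AE_I2 borel_measurable_sphere assms) simp
qed

text \<open>The surface measure charges every nonempty relatively open set, because the cone over such a set is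
open. This makes the scalar product on continuous functions positive definite.\<close>

lemma sphere_integral_eq_0_imp:
  fixes f :: "'a::euclidean_space \<Rightarrow> real"
  assumes cont: "continuous_on (sphere 0 1) f" and nn: "\<And>x. x \<in> sphere 0 1 \<Longrightarrow> 0 \<le> f x"
    and zero: "(\<integral>x. f x \<partial>sphere_measure) = 0" and x: "x \<in> sphere 0 1"
  shows "f x = 0"
proof (rule ccontr)
  assume "f x \<noteq> 0"
  have meas: "f \<in> borel_measurable sphere_measure" by (rule borel_measurable_sphere[OF cont])
  have "AE x in sphere_measure. 0 \<le> f x"
    by (rule AE_I2) (use nn in simp)
  then have "AE x in sphere_measure. f x = 0"
    using integral_nonneg_eq_0_iff_AE[OF integrable_sphere[OF cont]] zero by blast
  moreover have "{x \<in> space sphere_measure. f x \<noteq> 0} \<in> sets sphere_measure"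
    using meas by measurable
  ultimately have null: "{x \<in> sphere 0 1. f x \<noteq> 0} \<in> null_sets sphere_measure"
    by (subst AE_iff_null_sets) auto
  define N where "N = {x \<in> sphere 0 1. f x \<noteq> 0}"
  define U where "U = {x::'a. norm x < 1 \<and> x \<noteq> 0 \<and> x /\<^sub>R norm x \<in> N}"
  have "N \<in> null_sets sphere_measure" using null by (simp only: N_def)
  then have "of_nat DIM('a) * emeasure lborel U = 0"
    unfolding U_def by (subst emeasure_sphere_measure[symmetric]) (rule null_setsD2 null_setsD1, assumption)+
  then have U0: "emeasure lborel U = 0" by simp
  have c: "continuous_on (ball 0 1 - {0}) (\<lambda>x. f (x /\<^sub>R norm x))"
  proof (rule continuous_on_compose2[OF cont])
    show "continuous_on (ball 0 1 - {0::'a}) (\<lambda>x. x /\<^sub>R norm x)"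
      by (auto intro!: continuous_intros)
    show "(\<lambda>x. x /\<^sub>R norm x) ` (ball 0 1 - {0::'a}) \<subseteq> sphere 0 1"
      using direction_in_sphere by blast
  qed
  have "U = (ball 0 1 - {0}) \<inter> (\<lambda>x. f (x /\<^sub>R norm x)) -` (- {0})"
    unfolding U_def N_def by auto
  then have oU: "open U"
    using continuous_open_preimage[OF c, of "- {0}"] by auto
  have "(1/2) *\<^sub>R x \<in> U" using x \<open>f x \<noteq> 0\<close> by (auto simp add: U_def N_def)
  then have "\<not> negligible U" using open_not_negligible[OF oU] by blast
  moreover have "U \<in> null_sets lborel"
    by (rule null_setsI[OF U0]) (use borel_open[OF oU] in simp)
  then have "negligible U"
    unfolding negligible_iff_null_sets by (rule null_sets_completionI)
  ultimately show False by contradiction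
qed

lemma continuous_on_sphere_integral:
  fixes F :: "real \<Rightarrow> 'a::euclidean_space \<Rightarrow> real"
  assumes cont: "continuous_on ({a..b} \<times> sphere 0 1) (\<lambda>p. F (fst p) (snd p))"
  shows "continuous_on {a..b} (\<lambda>t. \<integral>\<omega>. F t \<omega> \<partial>sphere_measure)"
proof -
  interpret finite_measure "sphere_measure :: 'a measure" by (rule finite_measure_sphere_measure)
  have "compact ((\<lambda>p. F (fst p) (snd p)) ` ({a..b} \<times> sphere 0 1))"
    by (intro compact_continuous_image cont compact_Times) auto
  then obtain K where K: "\<And>t x. t \<in> {a..b} \<Longrightarrow> x \<in> sphere 0 1 \<Longrightarrow> norm (F t x) \<le> K"
    by (fastforce dest!: compact_imp_bounded simp: bounded_iff)
  have contx: "continuous_on (sphere 0 1) (F t)" if "t \<in> {a..b}" for t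
  proof -
    have "continuous_on (sphere 0 1) (\<lambda>x. F (fst (t, x)) (snd (t, x)))"
      by (rule continuous_on_compose2[OF cont]) (use that in \<open>auto intro!: continuous_intros\<close>)
    then show ?thesis by simp
  qed
  have contt: "continuous_on {a..b} (\<lambda>t. F t x)" if "x \<in> sphere 0 1" for x
  proof -
    have "continuous_on {a..b} (\<lambda>t. F (fst (t, x)) (snd (t, x)))"
      by (rule continuous_on_compose2[OF cont]) (use that in \<open>auto intro!: continuous_intros\<close>)
    then show ?thesis by simp
  qed
  show ?thesis
    unfolding continuous_on_sequentially
  proof (intro allI impI ballI)
    fix X t assume *: "t \<in> {a..b}" "(\<forall>n. X n \<in> {a..b}) \<and> X \<longlonglongrightarrow> t"
    have "(\<lambda>n. \<integral>\<omega>. F (X n) \<omega> \<partial>sphere_measure) \<longlonglongrightarrow> (\<integral>\<omega>. F t \<omega> \<partial>sphere_measure)"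
    proof (rule integral_dominated_convergence[where w = "\<lambda>_. K"])
      show "AE x in sphere_measure. (\<lambda>n. F (X n) x) \<longlonglongrightarrow> F t x"
        using contt * by (auto simp: continuous_on_sequentially o_def)
    qed (use K * contx in \<open>auto simp: borel_measurable_sphere\<close>)
    then show "((\<lambda>t. \<integral>\<omega>. F t \<omega> \<partial>sphere_measure) \<circ> X) \<longlonglongrightarrow> (\<integral>\<omega>. F t \<omega> \<partial>sphere_measure)"
      by (simp add: o_def)
  qed
qed

text \<open>The support condition keeps the integrand away from the origin and from infinity, so that the
radial integral is an ordinary integral of a continuous function over a compact interval.\<close>

lemma polar_coordinates:
  fixes f :: "'a::euclidean_space \<Rightarrow> real"
  assumes cont: "continuous_on (- {0}) f" and a: "0 < a"
    and supp: "\<And>x. f x \<noteq> 0 \<Longrightarrow> norm x \<in> {a..b}"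
  shows "((\<lambda>r. r ^ (DIM('a) - 1) * (\<integral>\<omega>. f (r *\<^sub>R \<omega>) \<partial>sphere_measure)) has_integral (\<integral>x. f x \<partial>lborel)) {a..b}"
proof -
  interpret S: finite_measure "sphere_measure :: 'a measure" by (rule finite_measure_sphere_measure)
  let ?\<rho> = "radial_measure DIM('a)"
  have sf: "sigma_finite_measure ?\<rho>"
    unfolding radial_measure_def
    by (subst sigma_finite_measure.sigma_finite_iff_density_finite[OF sigma_finite_lborel])
       (auto simp: indicator_def ennreal_mult_eq_top_iff)
  interpret P: pair_sigma_finite ?\<rho> "sphere_measure :: 'a measure"
    using sf S.sigma_finite_measure_axioms by (simp add: pair_sigma_finite_def)
  have f0: "f 0 = 0" using supp[of 0] a by auto
  have "(\<lambda>x. indicator (- {0}) x *\<^sub>R f x) \<in> borel_measurable borel"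
    by (rule borel_measurable_continuous_on_indicator[OF _ cont]) auto
  also have "(\<lambda>x. indicator (- {0}) x *\<^sub>R f x) = f" using f0 by (auto simp: indicator_def)
  finally have meas [measurable]: "f \<in> borel_measurable borel" .
  let ?F = "\<lambda>p. f (fst p *\<^sub>R snd p)"
  have sm: "sets (?\<rho> \<Otimes>\<^sub>M (sphere_measure::'a measure)) = sets (borel \<Otimes>\<^sub>M restrict_space borel (sphere 0 1))"
    by (simp add: sets_sphere_measure cong: sets_pair_measure_cong)
  have F': "?F \<in> borel_measurable (borel \<Otimes>\<^sub>M restrict_space borel (sphere 0 1))"
  proof -
    have [measurable]: "snd \<in> borel \<Otimes>\<^sub>M restrict_space borel (sphere 0 1) \<rightarrow>\<^sub>M (borel::'a measure)"
      by (rule measurable_restrict_space2_iff[THEN iffD1, THEN conjunct1, OF measurable_snd])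
    show ?thesis by measurable
  qed
  then have F: "?F \<in> borel_measurable (?\<rho> \<Otimes>\<^sub>M sphere_measure)"
    by (simp cong: measurable_cong_sets[OF sm refl])
  have "(\<integral>x. f x \<partial>lborel) = (\<integral>x. indicator (- {0}) x *\<^sub>R f x \<partial>lborel)"
    by (rule Bochner_Integration.integral_cong) (use f0 in \<open>auto simp: indicator_def\<close>)
  also have "\<dots> = (\<integral>x. f x \<partial>restrict_space lborel (- {0}))"
    by (rule integral_restrict_space[symmetric]) auto
  also have "\<dots> = (\<integral>x. ?F (norm x, x /\<^sub>R norm x) \<partial>restrict_space lborel (- {0}))"
    by (rule Bochner_Integration.integral_cong) (auto simp: space_restrict_space)
  also have "\<dots> = (\<integral>p. ?F p \<partial>distr (restrict_space lborel (- {0::'a})) (borel \<Otimes>\<^sub>M restrict_space borel (sphere 0 1))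
     (\<lambda>x. (norm x, x /\<^sub>R norm x)))"
    using measurable_direction[of UNIV]
    by (intro integral_distr[symmetric] measurable_Pair F')
       (auto intro!: measurable_restrict_space1 simp: Compl_eq_Diff_UNIV)
  also have "\<dots> = (\<integral>p. ?F p \<partial>(?\<rho> \<Otimes>\<^sub>M sphere_measure))"
    by (simp only: polar_coordinates_measure)
  also have "\<dots> = (\<integral>r. (\<integral>\<omega>. ?F (r, \<omega>) \<partial>sphere_measure) \<partial>?\<rho>)"
  proof (rule P.integral_fst'[symmetric])
    have "compact (cball 0 b - ball 0 a :: 'a set)" by (intro compact_diff) auto
    then have "compact (f ` (cball 0 b - ball 0 a))"
      by (intro compact_continuous_image continuous_on_subset[OF cont]) (use a in auto)
    then obtain B where B: "\<And>x. a \<le> norm x \<Longrightarrow> norm x \<le> b \<Longrightarrow> norm (f x) \<le> B"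
      by (fastforce dest!: compact_imp_bounded simp: bounded_iff)
    show "integrable (?\<rho> \<Otimes>\<^sub>M sphere_measure) ?F"
    proof (rule integrableI_bounded_set[OF _ F, where A = "{a..b} \<times> sphere 0 1" and B = B])
      show AS: "{a..b} \<times> sphere 0 1 \<in> sets (?\<rho> \<Otimes>\<^sub>M (sphere_measure::'a measure))"
        using sets.top[of "sphere_measure::'a measure"] by auto
      have "emeasure ?\<rho> {a..b} \<le> emeasure ?\<rho> {..<\<bar>b\<bar> + 1}" by (rule emeasure_mono) auto
      also have "\<dots> < \<infinity>" by (subst emeasure_radial_measure_lessThan) auto
      finally have "emeasure ?\<rho> {a..b} < \<infinity>" .
      then show "emeasure (?\<rho> \<Otimes>\<^sub>M (sphere_measure::'a measure)) ({a..b} \<times> sphere 0 1) < \<infinity>"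
        using sets.top[of "sphere_measure::'a measure"]
        by (subst S.emeasure_pair_measure_Times)
           (auto simp: ennreal_mult_less_top S.emeasure_eq_measure)
      show "AE p in ?\<rho> \<Otimes>\<^sub>M sphere_measure. p \<in> {a..b} \<times> sphere 0 1 \<longrightarrow> norm (f (fst p *\<^sub>R snd p)) \<le> B"
        using a by (intro AE_I2) (auto intro!: B[simplified])
      show "AE p in ?\<rho> \<Otimes>\<^sub>M sphere_measure. p \<notin> {a..b} \<times> sphere 0 1 \<longrightarrow> f (fst p *\<^sub>R snd p) = 0"
      proof -
        have "AE r in ?\<rho>. 0 < r"
          unfolding radial_measure_def by (subst AE_density) (auto simp: indicator_def intro!: AE_I2)
        note pos = this
        have "AE p in ?\<rho> \<Otimes>\<^sub>M (sphere_measure::'a measure). 0 < fst p"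
        proof (rule P.AE_pair_measure)
          show "{p \<in> space (?\<rho> \<Otimes>\<^sub>M (sphere_measure::'a measure)). 0 < fst p} \<in> sets (?\<rho> \<Otimes>\<^sub>M sphere_measure)"
            by measurable
          show "AE r in ?\<rho>. AE \<omega> in (sphere_measure::'a measure). 0 < fst (r, \<omega>)"
            using pos by eventually_elim simp
        qed
        then show ?thesis
          using AE_space[of "?\<rho> \<Otimes>\<^sub>M (sphere_measure::'a measure)"]
        proof eventually_elim
          case (elim p)
          then have "norm (snd p) = 1" by (auto simp: space_pair_measure)
          then show ?case using elim supp[of "fst p *\<^sub>R snd p"] by (cases p) auto
        qed
      qed
    qed
  qed
  also have "\<dots> = (\<integral>r. (r ^ (DIM('a) - 1) * indicator {0<..} r) *\<^sub>R (\<integral>\<omega>. f (r *\<^sub>R \<omega>) \<partial>sphere_measure) \<partial>lborel)"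
  proof -
    have "?\<rho> = density lborel (\<lambda>r. ennreal (r ^ (DIM('a) - 1) * indicator {0<..} r))"
      unfolding radial_measure_def by (intro density_cong) (auto simp: indicator_def)
    moreover have "(\<lambda>r. \<integral>\<omega>. ?F (r, \<omega>) \<partial>sphere_measure) \<in> borel_measurable ?\<rho>"
      using S.borel_measurable_lebesgue_integral[of "\<lambda>r \<omega>. f (r *\<^sub>R \<omega>)" ?\<rho>] F
      by (simp add: case_prod_beta')
    ultimately show ?thesis
      by (simp only:) (subst integral_density, auto simp: radial_measure_def indicator_def intro!: AE_I2)
  qed
  also have "\<dots> = (\<integral>r. indicator {a..b} r *\<^sub>R (r ^ (DIM('a) - 1) * (\<integral>\<omega>. f (r *\<^sub>R \<omega>) \<partial>sphere_measure)) \<partial>lborel)"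
  proof (rule Bochner_Integration.integral_cong, rule refl)
    fix r :: real
    have "(\<integral>\<omega>. f (r *\<^sub>R \<omega>) \<partial>sphere_measure) = (\<integral>\<omega>. 0 \<partial>(sphere_measure :: 'a measure))" if "0 < r" "r \<notin> {a..b}"
      proof (rule Bochner_Integration.integral_cong[OF refl])
      fix \<omega> :: 'a assume "\<omega> \<in> space sphere_measure"
      then show "f (r *\<^sub>R \<omega>) = 0"
        using supp[of "r *\<^sub>R \<omega>"] \<open>0 < r\<close> \<open>r \<notin> {a..b}\<close> by auto
    qed
    then show "(r ^ (DIM('a) - 1) * indicator {0<..} r) *\<^sub>R (\<integral>\<omega>. f (r *\<^sub>R \<omega>) \<partial>sphere_measure) =
      indicator {a..b} r *\<^sub>R (r ^ (DIM('a) - 1) * (\<integral>\<omega>. f (r *\<^sub>R \<omega>) \<partial>sphere_measure))"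
      using a by (auto simp: indicator_def)
  qed
  finally have eq: "(\<integral>x. f x \<partial>lborel) = (LINT r:{a..b}|lborel. r ^ (DIM('a) - 1) * (\<integral>\<omega>. f (r *\<^sub>R \<omega>) \<partial>sphere_measure))"
    by (simp add: set_lebesgue_integral_def)
  have "continuous_on {a..b} (\<lambda>r. r ^ (DIM('a) - 1) * (\<integral>\<omega>. f (r *\<^sub>R \<omega>) \<partial>sphere_measure))"
  proof (intro continuous_on_mult continuous_on_power continuous_on_id continuous_on_sphere_integral)
    show "continuous_on ({a..b} \<times> sphere 0 1) (\<lambda>p. f (fst p *\<^sub>R snd p))"
      by (rule continuous_on_compose2[OF cont]) (use a in \<open>auto intro!: continuous_intros\<close>)
  qed
  then have "set_integrable lborel {a..b} (\<lambda>r. r ^ (DIM('a) - 1) * (\<integral>\<omega>. f (r *\<^sub>R \<omega>) \<partial>sphere_measure))"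
    by (rule borel_integrable_atLeastAtMost')
  note HK = set_borel_integral_eq_integral[OF this]
  show ?thesis
    unfolding eq HK(2) by (rule integrable_integral[OF HK(1)])
qed


section \<open>Functions of class C^k\<close>

lemma frechet_derivative_cong_open:
  assumes "open S" "x \<in> S" "\<And>y. y \<in> S \<Longrightarrow> f y = g y"
  shows "frechet_derivative f (at x) = frechet_derivative g (at x)"
proof -
  have "(f has_derivative f') (at x) \<longleftrightarrow> (g has_derivative f') (at x)" for f'
    using assms has_derivative_transform_within_open[of f f' x UNIV S g]
      has_derivative_transform_within_open[of g f' x UNIV S f] by auto
  then show ?thesis by (simp add: frechet_derivative_def)
qed

lemma Ck_on_cong:
  assumes "open S" "\<And>x. x \<in> S \<Longrightarrow> f x = g x"
  shows "Ck_on k f S \<longleftrightarrow> Ck_on k g S"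
  using assms
proof (induction k arbitrary: f g)
  case 0
  then show ?case by (auto cong: continuous_on_cong)
next
  case (Suc k)
  have "f differentiable at x \<longleftrightarrow> g differentiable at x" if "x \<in> S" for x
    unfolding differentiable_def
    using that Suc.prems has_derivative_transform_within_open[of f _ x UNIV S g]
      has_derivative_transform_within_open[of g _ x UNIV S f] by metis
  moreover have "Ck_on k (\<lambda>x. frechet_derivative f (at x) v) S \<longleftrightarrow> Ck_on k (\<lambda>x. frechet_derivative g (at x) v) S" for v
    using frechet_derivative_cong_open[OF Suc.prems(1) _ Suc.prems(2)]
    by (intro Suc.IH Suc.prems) auto
  ultimately show ?case by simp
qed

lemma Ck_on_SucI:
  assumes "open S" "\<And>x. x \<in> S \<Longrightarrow> (f has_derivative f' x) (at x)"
    and "\<And>v. Ck_on k (\<lambda>x. f' x v) S"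
  shows "Ck_on (Suc k) f S"
proof -
  have "Ck_on k (\<lambda>x. frechet_derivative f (at x) v) S" for v
    using assms(3)[of v] Ck_on_cong[OF assms(1), of "\<lambda>x. frechet_derivative f (at x) v" "\<lambda>x. f' x v"]
      frechet_derivative_at[OF assms(2)] by simp
  then show ?thesis using assms(2) by (auto simp: differentiable_def)
qed

lemma Ck_on_SucD: "Ck_on (Suc k) f S \<Longrightarrow> Ck_on k f S"
proof (induction k arbitrary: f)
  case 0
  then show ?case
    by (auto intro!: continuous_at_imp_continuous_on differentiable_imp_continuous_within)
qed auto

lemma Ck_on_Suc_derivative:
  assumes "Ck_on (Suc k) f S" "x \<in> S"
  shows "(f has_derivative frechet_derivative f (at x)) (at x)"
  using assms frechet_derivative_works by auto

lemma Ck_on_const: "open S \<Longrightarrow> Ck_on k (\<lambda>x. c) S"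
  by (induction k arbitrary: c)
     (use continuous_on_const in \<open>auto intro!: Ck_on_SucI[where f' = "\<lambda>_ _. 0"] simp del: Ck_on.simps(2)\<close>)

lemma Ck_on_add: "open S \<Longrightarrow> Ck_on k f S \<Longrightarrow> Ck_on k g S \<Longrightarrow> Ck_on k (\<lambda>x. f x + g x) S"
proof (induction k arbitrary: f g)
  case (Suc k)
  show ?case
  proof (rule Ck_on_SucI[OF Suc.prems(1)])
    show "((\<lambda>x. f x + g x) has_derivative (\<lambda>v. frechet_derivative f (at x) v + frechet_derivative g (at x) v)) (at x)"
      if "x \<in> S" for x
      by (intro has_derivative_add Ck_on_Suc_derivative[OF Suc.prems(2)] Ck_on_Suc_derivative[OF Suc.prems(3)] that)
    show "Ck_on k (\<lambda>x. frechet_derivative f (at x) v + frechet_derivative g (at x) v) S" for v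
      using Suc by auto
  qed
qed (auto intro: continuous_on_add)

lemma Ck_on_scaleR:
  fixes f :: "'a::euclidean_space \<Rightarrow> real"
  shows "open S \<Longrightarrow> Ck_on k f S \<Longrightarrow> Ck_on k g S \<Longrightarrow> Ck_on k (\<lambda>x. f x *\<^sub>R g x) S"
proof (induction k arbitrary: f g)
  case (Suc k)
  show ?case
  proof (rule Ck_on_SucI[OF Suc.prems(1)])
    show "((\<lambda>x. f x *\<^sub>R g x) has_derivative
        (\<lambda>v. f x *\<^sub>R frechet_derivative g (at x) v + frechet_derivative f (at x) v *\<^sub>R g x)) (at x)"
      if "x \<in> S" for x
      by (intro has_derivative_scaleR Ck_on_Suc_derivative[OF Suc.prems(2)] Ck_on_Suc_derivative[OF Suc.prems(3)] that)
    show "Ck_on k (\<lambda>x. f x *\<^sub>R frechet_derivative g (at x) v + frechet_derivative f (at x) v *\<^sub>R g x) S" for v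
      by (intro Ck_on_add Suc.IH Suc.prems(1) Ck_on_SucD[OF Suc.prems(2)] Ck_on_SucD[OF Suc.prems(3)])
         (use Suc.prems in auto)
  qed
qed (auto intro: continuous_on_scaleR)

lemma Ck_on_bounded_linear:
  assumes "bounded_linear T" "open S"
  shows "Ck_on k f S \<Longrightarrow> Ck_on k (\<lambda>x. T (f x)) S"
proof (induction k arbitrary: f)
  case 0
  then show ?case using assms(1) by (auto intro: bounded_linear.continuous_on)
next
  case (Suc k)
  show ?case
  proof (rule Ck_on_SucI[OF assms(2)])
    show "((\<lambda>x. T (f x)) has_derivative (\<lambda>v. T (frechet_derivative f (at x) v))) (at x)" if "x \<in> S" for x
      by (intro bounded_linear.has_derivative[OF assms(1)] Ck_on_Suc_derivative[OF Suc.prems] that)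
    show "Ck_on k (\<lambda>x. T (frechet_derivative f (at x) v)) S" for v
      using Suc by auto
  qed
qed

lemma Ck_on_linear:
  assumes "bounded_linear T" "open S"
  shows "Ck_on k T S"
proof (cases k)
  case 0
  then show ?thesis using assms by (simp add: linear_continuous_on)
next
  case (Suc k')
  have "Ck_on (Suc k') T S"
    by (rule Ck_on_SucI[where f' = "\<lambda>_. T"])
       (use assms in \<open>auto intro: bounded_linear_imp_has_derivative Ck_on_const\<close>)
  then show ?thesis using Suc by simp
qed

text \<open>The derivative of a negative power of the norm is a linear function times a power with a larger
exponent, so the induction on \<open>k\<close> has to treat all exponents at once.\<close>

lemma Ck_on_inverse_norm_power:
  "Ck_on k (\<lambda>x::'a::euclidean_space. inverse (norm x) ^ p) (- {0})"
proof (induction k arbitrary: p)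
  case 0
  then show ?case by (auto intro!: continuous_intros)
next
  case (Suc k)
  show ?case
  proof (rule Ck_on_SucI)
    show "((\<lambda>x::'a. inverse (norm x) ^ p) has_derivative
        (\<lambda>v. (- real p * (x \<bullet> v)) *\<^sub>R inverse (norm x) ^ (p + 2))) (at x)" if "x \<in> - {0}" for x
    proof -
      have x: "x \<noteq> 0" using that by simp
      have "((\<lambda>x::'a. inverse (norm x)) has_derivative (\<lambda>v. - (inverse (norm x) * (v \<bullet> sgn x) * inverse (norm x)))) (at x)"
        using x by (intro Deriv.has_derivative_inverse has_derivative_norm) auto
      from has_derivative_power[OF this, of p] show ?thesis
        by (rule has_derivative_eq_rhs)
           (cases p; use x in \<open>simp add: fun_eq_iff sgn_div_norm field_simps inner_commute power2_eq_square\<close>)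
    qed
    show "Ck_on k (\<lambda>x::'a. (- real p * (x \<bullet> v)) *\<^sub>R inverse (norm x) ^ (p + 2)) (- {0})" for v
      by (intro Ck_on_scaleR Suc.IH Ck_on_linear bounded_linear_const_mult[OF bounded_linear_inner_left]) auto
  qed auto
qed

lemma continuous_on_frechet_derivative:
  fixes f :: "'a::euclidean_space \<Rightarrow> 'b::real_normed_vector"
  assumes f: "Ck_on (Suc 0) f S" and g: "continuous_on X g" "g ` X \<subseteq> S" and h: "continuous_on X h"
  shows "continuous_on X (\<lambda>p. frechet_derivative f (at (g p)) (h p))"
proof -
  have lin: "linear (frechet_derivative f (at (g p)))" if "p \<in> X" for p
    using Ck_on_Suc_derivative[OF f] g(2) that has_derivative_linear by blast
  have eq: "frechet_derivative f (at (g p)) (h p) =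
      (\<Sum>b\<in>Basis. (h p \<bullet> b) *\<^sub>R frechet_derivative f (at (g p)) b)" if "p \<in> X" for p
    by (subst (1) euclidean_representation[symmetric, of "h p"])
       (simp add: linear_sum[OF lin[OF that]] linear_scale[OF lin[OF that]])
  have c: "continuous_on X (\<lambda>p. frechet_derivative f (at (g p)) b)" for b
    using f by (intro continuous_on_compose2[OF _ g]) auto
  have "continuous_on X (\<lambda>p. \<Sum>b\<in>Basis. (h p \<bullet> b) *\<^sub>R frechet_derivative f (at (g p)) b)"
    by (intro continuous_on_sum continuous_on_scaleR continuous_on_inner h continuous_on_const c)
  then show ?thesis using eq by (simp cong: continuous_on_cong)
qed

section \<open>Rotation fields integrate to zero over the sphere\<close>

lemma has_derivative_direction:
  fixes x :: "'a::euclidean_space"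
  assumes "x \<noteq> 0"
  shows "((\<lambda>x. x /\<^sub>R norm x) has_derivative
    (\<lambda>v. v /\<^sub>R norm x - ((x \<bullet> v) / norm x ^ 3) *\<^sub>R x)) (at x)"
proof -
  have "((\<lambda>x::'a. inverse (norm x)) has_derivative (\<lambda>v. - (inverse (norm x) * (v \<bullet> sgn x) * inverse (norm x)))) (at x)"
    using assms by (intro Deriv.has_derivative_inverse has_derivative_norm) auto
  from has_derivative_scaleR[OF this has_derivative_ident] show ?thesis
    by (rule has_derivative_eq_rhs)
       (use assms in \<open>simp add: fun_eq_iff sgn_div_norm inner_commute power3_eq_cube divide_inverse mult_ac\<close>)
qed

lemma has_real_derivative_max_power2:
  "((\<lambda>y. (max 0 y)\<^sup>2) has_real_derivative 2 * max 0 y) (at (y::real))"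
proof (cases "y = 0")
  case False
  then consider "y > 0" | "y < 0" by linarith
  then show ?thesis
  proof cases
    case 1
    have "((\<lambda>y::real. y\<^sup>2) has_real_derivative 2 * max 0 y) (at y)"
      using 1 by (auto intro!: derivative_eq_intros)
    then show ?thesis
      by (rule has_field_derivative_transform_within_open[of _ _ _ "{0<..}"]) (use 1 in auto)
  next
    case 2
    have "((\<lambda>y::real. 0) has_real_derivative 2 * max 0 y) (at y)"
      using 2 by (auto intro!: derivative_eq_intros)
    then show ?thesis
      by (rule has_field_derivative_transform_within_open[of _ _ _ "{..<0}"]) (use 2 in auto)
  qed
next
  case True
  have "((\<lambda>h::real. (max 0 h)\<^sup>2 / h) \<longlongrightarrow> 0) (at 0)"
  proof (rule Lim_null_comparison[where g = "\<lambda>h. \<bar>h\<bar>"])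
    have "\<bar>(max 0 h)\<^sup>2 / h\<bar> \<le> \<bar>h\<bar>" for h :: real
      by (cases "h > 0") (auto simp: power2_eq_square max_def)
    then show "\<forall>\<^sub>F h in at (0::real). norm ((max 0 h)\<^sup>2 / h) \<le> \<bar>h\<bar>" by simp
    show "((\<lambda>h::real. \<bar>h\<bar>) \<longlongrightarrow> 0) (at 0)" by (intro tendsto_rabs_zero tendsto_ident_at)
  qed
  then show ?thesis using True by (simp add: DERIV_def)
qed

lemma integrable_continuous_compact_support:
  fixes f :: "'a::euclidean_space \<Rightarrow> real"
  assumes cont: "continuous_on UNIV f" and supp: "\<And>x. R < norm x \<Longrightarrow> f x = 0"
  shows "integrable lborel f"
proof -
  have "compact (f ` cball 0 R)"
    by (rule compact_continuous_image[OF continuous_on_subset[OF cont]]) auto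
  then have "bounded (f ` cball 0 R)" by (rule compact_imp_bounded)
  then obtain B where B: "\<And>x. x \<in> cball 0 R \<Longrightarrow> norm (f x) \<le> B"
    unfolding bounded_iff by blast
  show ?thesis
  proof (rule integrableI_bounded_set)
    show "f \<in> borel_measurable lborel" using cont by (simp add: borel_measurable_continuous_onI)
    show "AE x in lborel. x \<in> cball 0 R \<longrightarrow> norm (f x) \<le> B" using B by blast
    show "AE x in lborel. x \<notin> cball 0 R \<longrightarrow> f x = 0" using supp by auto
  qed (use emeasure_lborel_cball_finite[of "0::'a" R] in simp_all)
qed

text \<open>The field \<open>x_i \<partial>_l - x_l \<partial>_i\<close> generates rotations, so its integral over the
sphere vanishes. To see this without rotating the sphere, multiply \<open>g\<close> by a radial cut-off
\<open>\<zeta>\<close>. The field annihilates radial functions and, as \<open>i \<noteq> l\<close>, it is a difference of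
partial derivatives of \<open>x_i H\<close> and \<open>x_l H\<close>, whose integrals over the whole space are zero. In
polar coordinates the integral is a positive multiple of the one over the sphere.\<close>

lemma sphere_integral_rotation_field_homogeneous:
  fixes g :: "real ^ 'n::finite \<Rightarrow> real"
  assumes g: "Ck_on (Suc 0) g (- {0})" and hom: "\<And>x. x \<noteq> 0 \<Longrightarrow> g x = g (x /\<^sub>R norm x)" and il: "i \<noteq> l"
  shows "(\<integral>\<omega>. frechet_derivative g (at \<omega>) (\<omega> $ i *\<^sub>R axis l 1 - \<omega> $ l *\<^sub>R axis i 1) \<partial>sphere_measure) = 0"
proof -
  define g' where "g' = (\<lambda>x. frechet_derivative g (at x))"
  have g': "(g has_derivative g' x) (at x)" if "x \<noteq> 0" for x
    unfolding g'_def using Ck_on_Suc_derivative[OF g] that by simp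
  define A where "A x = x $ i *\<^sub>R axis l 1 - x $ l *\<^sub>R axis i (1::real)" for x :: "real ^ 'n"
  have Ax: "x \<bullet> A x = 0" for x by (simp add: A_def inner_diff_right inner_axis)
  have Ascale: "A (c *\<^sub>R x) = c *\<^sub>R A x" for c x by (simp add: A_def scaleR_diff_right)
  have g'A: "g' x (A x) = g' (x /\<^sub>R norm x) (A (x /\<^sub>R norm x))" if x: "x \<noteq> 0" for x
  proof -
    have "((\<lambda>x. g (x /\<^sub>R norm x)) has_derivative
       (\<lambda>v. g' (x /\<^sub>R norm x) (v /\<^sub>R norm x - ((x \<bullet> v) / norm x ^ 3) *\<^sub>R x))) (at x)"
      using x by (intro has_derivative_compose[OF has_derivative_direction g']) auto
    then have "(g has_derivative
       (\<lambda>v. g' (x /\<^sub>R norm x) (v /\<^sub>R norm x - ((x \<bullet> v) / norm x ^ 3) *\<^sub>R x))) (at x)"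
      by (rule has_derivative_transform_within_open[of _ _ _ _ "- {0}"]) (use x in \<open>simp_all add: hom[symmetric] open_Compl\<close>)
    then have "g' x = (\<lambda>v. g' (x /\<^sub>R norm x) (v /\<^sub>R norm x - ((x \<bullet> v) / norm x ^ 3) *\<^sub>R x))"
      by (rule has_derivative_unique[OF g'[OF x]])
    then show ?thesis by (simp add: Ax Ascale)
  qed
  define q where "q x = (norm x)\<^sup>2" for x :: "real ^ 'n"
  \<comment> \<open>The cut-off is supported in the annulus where the norm lies between 1 and 2; it is a function of the squared norm, which is smooth at the origin.\<close>
  define \<zeta> where "\<zeta> s = (max 0 ((s - 1) * (4 - s)))\<^sup>2" for s :: real
  define \<zeta>' where "\<zeta>' s = 2 * max 0 ((s - 1) * (4 - s)) * (5 - 2 * s)" for s :: real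
  have \<zeta>': "(\<zeta> has_real_derivative \<zeta>' s) (at s)" for s
    unfolding \<zeta>_def \<zeta>'_def
    by (rule DERIV_chain2[OF has_real_derivative_max_power2]) (auto intro!: derivative_eq_intros)
  have \<zeta>0: "\<zeta> s = 0" "\<zeta>' s = 0" if "s \<le> 1 \<or> s \<ge> 4" for s
    using that by (auto simp: \<zeta>_def \<zeta>'_def max_def mult_le_0_iff zero_le_mult_iff)
  have q': "(q has_derivative (\<lambda>v. 2 * (x \<bullet> v))) (at x)" for x
    unfolding q_def power2_norm_eq_inner
    by (auto intro!: derivative_eq_intros ext simp: inner_commute)
  have q1: "q x \<le> 1" if "norm x < 1" for x using that by (simp add: q_def power_le_one)
  have q4: "q x \<ge> 4" if "norm x \<ge> 2" for x
    using power_mono[OF that, of 2] by (simp add: q_def)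
  define H where "H x = \<zeta> (q x) * g x" for x
  define H' where "H' x v = \<zeta> (q x) * g' x v + \<zeta>' (q x) * (2 * (x \<bullet> v)) * g x" for x v
  have H': "(H has_derivative H' x) (at x)" for x
  proof (cases "norm x < 1")
    case True
    have "H' x = (\<lambda>_. 0)"
      using \<zeta>0 q1[OF True] by (simp add: H'_def fun_eq_iff)
    then have "((\<lambda>_. 0) has_derivative H' x) (at x)" by simp
    then show ?thesis
      by (rule has_derivative_transform_within_open[of _ _ _ _ "{x. norm x < 1}"])
         (use True in \<open>auto simp: H_def \<zeta>0 q1 intro: open_Collect_less continuous_intros\<close>)
  next
    case False
    then have "x \<noteq> 0" by auto
    have "((\<lambda>x. \<zeta> (q x)) has_derivative (\<lambda>v. \<zeta>' (q x) * (2 * (x \<bullet> v)))) (at x)"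
      by (rule has_derivative_compose[OF q' \<zeta>'[unfolded has_field_derivative_def]])
    then show ?thesis
      unfolding H_def H'_def[abs_def] by (rule has_derivative_mult[OF _ g'[OF \<open>x \<noteq> 0\<close>]])
  qed
  have contH': "continuous_on UNIV (\<lambda>x. H' x v)" for v
  proof -
    have c1: "continuous_on {x. norm x < 1} (\<lambda>x. H' x v)"
      by (rule continuous_on_cong[THEN iffD2, OF refl _ continuous_on_const[where c = 0]])
         (simp add: H'_def \<zeta>0 q1)
    have "continuous_on (- {0}) (\<lambda>x. g' x v)" using g by (simp add: g'_def)
    moreover have "continuous_on (- {0}) g"
      using Ck_on_SucD[OF g] by simp
    moreover have "continuous_on UNIV \<zeta>" "continuous_on UNIV \<zeta>'"
      unfolding \<zeta>_def \<zeta>'_def by (auto intro!: continuous_intros)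
    ultimately have c2: "continuous_on (- {0}) (\<lambda>x. H' x v)"
      unfolding H'_def q_def
      by (auto intro!: continuous_intros continuous_on_compose2[of UNIV \<zeta>] continuous_on_compose2[of UNIV \<zeta>'])
    have "continuous_on ({x. norm x < 1} \<union> - {0}) (\<lambda>x. H' x v)"
      by (rule continuous_on_open_Un[OF _ _ c1 c2]) (auto intro!: open_Collect_less continuous_intros)
    also have "{x. norm x < 1} \<union> - {0} = (UNIV :: (real ^ 'n) set)" by auto
    finally show ?thesis .
  qed
  have contH: "continuous_on UNIV H"
    by (intro continuous_at_imp_continuous_on ballI has_derivative_continuous[OF H'])
  have suppH: "H x = 0" if "2 \<le> norm x" for x using q4[OF that] by (simp add: H_def \<zeta>0)
  have suppH': "H' x v = 0" if "2 \<le> norm x" for x v using q4[OF that] by (simp add: H'_def \<zeta>0)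
  have part: "(\<integral>x. x $ a * H' x (axis b 1) \<partial>lborel) = 0" if "a \<noteq> b" for a b
  proof -
    have "(\<integral>x. (x $ a * H' x (axis b 1) + axis b 1 $ a * H x) \<partial>lborel) = 0"
    proof (rule integral_directional_derivative_eq_0[where H = "\<lambda>x. x $ a * H x" and R = 2
          and H' = "\<lambda>x v. x $ a * H' x v + v $ a * H x"])
      show "((\<lambda>x. x $ a * H x) has_derivative (\<lambda>v. x $ a * H' x v + v $ a * H x)) (at x)" for x
        by (rule has_derivative_mult[OF _ H']) (intro bounded_linear_imp_has_derivative bounded_linear_vec_nth)
      show "continuous_on UNIV (\<lambda>x. x $ a * H' x (axis b 1) + axis b 1 $ a * H x)"
        by (intro continuous_intros contH contH')
    qed (simp add: suppH)
    then show ?thesis using that by (simp add: axis_def)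
  qed
  have int: "integrable lborel (\<lambda>x. x $ a * H' x (axis b 1))" for a b
    by (rule integrable_continuous_compact_support[where R = 2])
       (auto intro!: continuous_intros contH' simp: suppH')
  have H'Aexp: "H' x (A x) = x $ i * H' x (axis l 1) - x $ l * H' x (axis i 1)" for x
    using has_derivative_linear[OF H'[of x]] by (simp add: A_def linear_diff linear_scale)
  then have zero: "(\<integral>x. H' x (A x) \<partial>lborel) = 0"
    using part[OF il] part[OF il[symmetric]] int by (simp add: H'Aexp)
  have H'A: "H' x (A x) = \<zeta> (q x) * g' x (A x)" for x by (simp add: H'_def Ax)
  let ?I = "\<integral>\<omega>. g' \<omega> (A \<omega>) \<partial>sphere_measure"
  have pol: "((\<lambda>r. r ^ (DIM(real ^ 'n) - 1) * (\<integral>\<omega>. H' (r *\<^sub>R \<omega>) (A (r *\<^sub>R \<omega>)) \<partial>sphere_measure))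
      has_integral (\<integral>x. H' x (A x) \<partial>lborel)) {1..2}"
  proof (rule polar_coordinates)
    have "continuous_on UNIV (\<lambda>x. H' x (A x))"
      unfolding H'Aexp by (intro continuous_intros contH')
    then show "continuous_on (- {0}) (\<lambda>x. H' x (A x))" by (rule continuous_on_subset) auto
    show "norm x \<in> {1..2}" if "H' x (A x) \<noteq> 0" for x
      using that suppH'[of x] \<zeta>0 q1[of x] H'A[of x] by force
  qed simp
  have inner: "(\<integral>\<omega>. H' (r *\<^sub>R \<omega>) (A (r *\<^sub>R \<omega>)) \<partial>sphere_measure) = \<zeta> (r\<^sup>2) * ?I" if "r \<in> {1..2}" for r
  proof -
    have "(\<integral>\<omega>. H' (r *\<^sub>R \<omega>) (A (r *\<^sub>R \<omega>)) \<partial>sphere_measure) = (\<integral>\<omega>. \<zeta> (r\<^sup>2) * g' \<omega> (A \<omega>) \<partial>sphere_measure)"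
    proof (rule Bochner_Integration.integral_cong[OF refl])
      fix \<omega> :: "real ^ 'n" assume "\<omega> \<in> space sphere_measure"
      then have "norm \<omega> = 1" by simp
      moreover then have "\<omega> \<noteq> 0" by force
      ultimately show "H' (r *\<^sub>R \<omega>) (A (r *\<^sub>R \<omega>)) = \<zeta> (r\<^sup>2) * g' \<omega> (A \<omega>)"
        using that g'A[of "r *\<^sub>R \<omega>"] by (auto simp: H'A q_def)
    qed
    then show ?thesis by simp
  qed
  have "((\<lambda>r. r ^ (DIM(real ^ 'n) - 1) * (\<zeta> (r\<^sup>2) * ?I)) has_integral 0) {1..2}"
    by (rule has_integral_eq[OF _ pol[unfolded zero]]) (simp add: inner)
  from has_integral_mult_left[OF this, of ?I] have i0: "((\<lambda>r. (r ^ (DIM(real ^ 'n) - 1) * \<zeta> (r\<^sup>2) * ?I) * ?I) has_integral 0) {1..2}"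
    by (simp add: mult.assoc)
  have "(r ^ (DIM(real ^ 'n) - 1) * \<zeta> (r\<^sup>2) * ?I) * ?I = 0" if "r \<in> {1..2}" for r
  proof (rule has_integral_0_cbox_imp_0[where f = "\<lambda>r. (r ^ (DIM(real ^ 'n) - 1) * \<zeta> (r\<^sup>2) * ?I) * ?I" and a = 1 and b = 2])
    show "continuous_on (cbox 1 2) (\<lambda>r. (r ^ (DIM(real ^ 'n) - 1) * \<zeta> (r\<^sup>2) * ?I) * ?I)"
      unfolding \<zeta>_def by (intro continuous_intros)
    show "0 \<le> (r ^ (DIM(real ^ 'n) - 1) * \<zeta> (r\<^sup>2) * ?I) * ?I" if "r \<in> box 1 2" for r
      using that by (auto simp: \<zeta>_def mult.assoc)
  qed (use i0 that in auto)
  from this[of "3/2"] have "?I = 0" by (auto simp: \<zeta>_def power2_eq_square max_def)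
  then show ?thesis by (simp add: g'_def A_def)
qed


definition rot_field :: "'n \<Rightarrow> 'n \<Rightarrow> real ^ 'n \<Rightarrow> real ^ 'n::finite" where
  "rot_field i l x = x $ i *\<^sub>R axis l 1 - x $ l *\<^sub>R axis i 1"

lemma inner_rot_field [simp]: "x \<bullet> rot_field i l x = 0"
  by (simp add: rot_field_def inner_diff_right inner_axis)

lemma direction_has_derivative_comp:
  fixes f :: "'a::euclidean_space \<Rightarrow> 'b::real_normed_vector"
  assumes f: "Ck_on (Suc 0) f (- {0})" and x: "x \<noteq> 0"
  shows "((\<lambda>x. f (x /\<^sub>R norm x)) has_derivative
    (\<lambda>v. frechet_derivative f (at (x /\<^sub>R norm x)) (v /\<^sub>R norm x - ((x \<bullet> v) / norm x ^ 3) *\<^sub>R x))) (at x)"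
  using x by (intro has_derivative_compose[OF has_derivative_direction Ck_on_Suc_derivative[OF f]]) auto

lemma Ck_on_direction:
  fixes f :: "'a::euclidean_space \<Rightarrow> 'b::real_normed_vector"
  assumes f: "Ck_on (Suc 0) f (- {0})"
  shows "Ck_on (Suc 0) (\<lambda>x. f (x /\<^sub>R norm x)) (- {0})"
proof (rule Ck_on_SucI)
  show "((\<lambda>x. f (x /\<^sub>R norm x)) has_derivative
    (\<lambda>v. frechet_derivative f (at (x /\<^sub>R norm x)) (v /\<^sub>R norm x - ((x \<bullet> v) / norm x ^ 3) *\<^sub>R x))) (at x)"
    if "x \<in> - {0}" for x
    using direction_has_derivative_comp[OF f] that by auto
  show "Ck_on 0 (\<lambda>x. frechet_derivative f (at (x /\<^sub>R norm x)) (v /\<^sub>R norm x - ((x \<bullet> v) / norm x ^ 3) *\<^sub>R x)) (- {0})" for v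
    unfolding Ck_on.simps
    by (rule continuous_on_frechet_derivative[OF f]) (auto intro!: continuous_intros)
qed auto

lemma frechet_derivative_direction:
  fixes f :: "'a::euclidean_space \<Rightarrow> 'b::real_normed_vector"
  assumes f: "Ck_on (Suc 0) f (- {0})" and w: "norm w = 1" and v: "w \<bullet> v = 0"
  shows "frechet_derivative (\<lambda>x. f (x /\<^sub>R norm x)) (at w) v = frechet_derivative f (at w) v"
proof -
  have "w \<noteq> 0" using w by force
  from fun_cong[OF frechet_derivative_at[OF direction_has_derivative_comp[OF f this]], of v] show ?thesis
    by (simp add: w v)
qed

lemma sphere_integral_rotation_field:
  fixes h :: "real ^ 'n::finite \<Rightarrow> real"
  assumes h: "Ck_on (Suc 0) h (- {0})" and il: "i \<noteq> l"
  shows "(\<integral>\<omega>. frechet_derivative h (at \<omega>) (rot_field i l \<omega>) \<partial>sphere_measure) = 0"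
proof -
  have "(\<integral>\<omega>. frechet_derivative h (at \<omega>) (rot_field i l \<omega>) \<partial>sphere_measure) =
      (\<integral>\<omega>. frechet_derivative (\<lambda>x. h (x /\<^sub>R norm x)) (at \<omega>) (rot_field i l \<omega>) \<partial>sphere_measure)"
    by (rule Bochner_Integration.integral_cong) (simp_all add: frechet_derivative_direction[OF h])
  also have "\<dots> = 0"
    unfolding rot_field_def
    by (rule sphere_integral_rotation_field_homogeneous[OF Ck_on_direction[OF h] _ il]) simp
  finally show ?thesis .
qed

text \<open>Splits a double sum into its diagonal and pairs \<open>i < l\<close>, the form in which the
anticommutation relations are used.\<close>

lemma sum_off_diagonal_pairs:
  fixes a :: "'n::{finite,linorder} \<Rightarrow> 'n \<Rightarrow> 'c::comm_monoid_add"
  shows "(\<Sum>i\<in>UNIV. \<Sum>l\<in>UNIV. a i l) = (\<Sum>i\<in>UNIV. a i i) + (\<Sum>i\<in>UNIV. \<Sum>l\<in>{l. i < l}. a i l + a l i)"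
proof -
  have split: "(\<Sum>l\<in>UNIV. a i l) = a i i + (\<Sum>l\<in>{l. i < l}. a i l) + (\<Sum>l\<in>{l. l < i}. a i l)" for i
  proof -
    have U: "(UNIV :: 'n set) = {i} \<union> ({l. i < l} \<union> {l. l < i})" by auto
    show ?thesis
      by (subst U, subst sum.union_disjoint, simp_all, subst sum.union_disjoint) (auto simp: add.assoc)
  qed
  have "(\<Sum>i\<in>UNIV. \<Sum>l\<in>{l. l < i}. a i l) = (\<Sum>l\<in>UNIV. \<Sum>i\<in>{i. l < i}. a i l)"
    using sum.swap_restrict[of UNIV UNIV a "\<lambda>i l. l < i"] by simp
  then show ?thesis by (simp add: split sum.distrib add.assoc)
qed

lemma sum_component_scaleR_linear:
  fixes T :: "real ^ 'n::finite \<Rightarrow> 'b::real_vector"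
  assumes "linear T"
  shows "(\<Sum>i\<in>UNIV. x $ i *\<^sub>R T (axis i 1)) = T x"
proof -
  have "T x = T (\<Sum>i\<in>UNIV. x $ i *\<^sub>R axis i 1)"
    using basis_expansion[of x] by (simp add: scalar_mult_eq_scaleR)
  then show ?thesis by (simp add: linear_sum[OF assms] linear_scale[OF assms])
qed

section \<open>Homogeneous polynomials\<close>

text \<open>Homogeneous polynomials of degree \<open>d\<close> with vector coefficients. The inductive form gives
the coefficient space no basis and makes each closure property a structural induction.\<close>

inductive hpoly :: "nat \<Rightarrow> (real ^ 'n::finite \<Rightarrow> 'b::real_normed_vector) \<Rightarrow> bool" where
  hpoly_const: "hpoly 0 (\<lambda>x. v)"
| hpoly_mult: "hpoly d p \<Longrightarrow> hpoly (Suc d) (\<lambda>x. x $ i *\<^sub>R p x)"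
| hpoly_add: "hpoly d p \<Longrightarrow> hpoly d q \<Longrightarrow> hpoly d (\<lambda>x. p x + q x)"

lemma hpoly_zero: "hpoly d (\<lambda>x. 0)"
proof (induction d)
  case (Suc d)
  from hpoly_mult[OF this] show ?case by simp
qed (rule hpoly_const)

lemma hpoly_linear:
  assumes "linear T"
  shows "hpoly d p \<Longrightarrow> hpoly d (\<lambda>x. T (p x))"
  by (induction rule: hpoly.induct)
     (auto simp: linear_add[OF assms] linear_scale[OF assms] intro: hpoly.intros)

lemma hpoly_scale: "hpoly d p \<Longrightarrow> hpoly d (\<lambda>x. c *\<^sub>R p x)"
  using hpoly_linear[of "\<lambda>v. c *\<^sub>R v"] by (simp add: linear_iff scaleR_add_right)

lemma hpoly_diff: "hpoly d p \<Longrightarrow> hpoly d q \<Longrightarrow> hpoly d (\<lambda>x. p x - q x)"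
  using hpoly_add[of d p "\<lambda>x. - 1 *\<^sub>R q x"] hpoly_scale[of d q "-1"] by simp

lemma hpoly_sum: "finite I \<Longrightarrow> (\<And>i. i \<in> I \<Longrightarrow> hpoly d (p i)) \<Longrightarrow> hpoly d (\<lambda>x. \<Sum>i\<in>I. p i x)"
  by (induction I rule: finite_induct) (auto intro: hpoly_zero hpoly_add)

text \<open>The partial derivatives are produced explicitly so that they are again homogeneous polynomials. In
degree 0 the truncated degree \<open>d - 1\<close> is 0 as well; there the last conjunct records that
the derivatives vanish. The third conjunct is the identity of Euler.\<close>

lemma hpoly_derivative:
  "hpoly d p \<Longrightarrow> \<exists>q. (\<forall>i. hpoly (d - 1) (q i)) \<and>
     (\<forall>x. (p has_derivative (\<lambda>v. \<Sum>i\<in>UNIV. v $ i *\<^sub>R q i x)) (at x)) \<and>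
     (\<forall>x. (\<Sum>i\<in>UNIV. x $ i *\<^sub>R q i x) = real d *\<^sub>R p x) \<and> (d = 0 \<longrightarrow> (\<forall>i x. q i x = 0))"
proof (induction rule: hpoly.induct)
  case (hpoly_const v)
  show ?case
    by (rule exI[of _ "\<lambda>_ _. 0"]) (auto intro: hpoly.hpoly_const)
next
  case (hpoly_mult d p k)
  then obtain q where q: "\<And>i. hpoly (d - 1) (q i)"
    "\<And>x. (p has_derivative (\<lambda>v. \<Sum>i\<in>UNIV. v $ i *\<^sub>R q i x)) (at x)"
    "\<And>x. (\<Sum>i\<in>UNIV. x $ i *\<^sub>R q i x) = real d *\<^sub>R p x" "d = 0 \<Longrightarrow> q i x = 0" for i x
    by blast
  define q' where "q' i x = (if i = k then p x else 0) + x $ k *\<^sub>R q i x" for i x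
  have "hpoly d (q' i)" for i
  proof -
    have "hpoly d (\<lambda>x. x $ k *\<^sub>R q i x)"
    proof (cases d)
      case 0
      then have "(\<lambda>x. x $ k *\<^sub>R q i x) = (\<lambda>x. 0)" using q(4) by simp
      then show ?thesis by (simp only: hpoly_zero)
    next
      case (Suc d')
      then show ?thesis using hpoly.hpoly_mult[OF q(1)[of i], of k] by simp
    qed
    moreover have "hpoly d (\<lambda>x. if i = k then p x else 0)"
      using hpoly_mult.hyps hpoly_zero by (cases "i = k") auto
    ultimately show ?thesis unfolding q'_def[abs_def] by (rule hpoly_add[rotated])
  qed
  moreover have sumq': "(\<Sum>i\<in>UNIV. v $ i *\<^sub>R q' i x) = x $ k *\<^sub>R (\<Sum>i\<in>UNIV. v $ i *\<^sub>R q i x) + v $ k *\<^sub>R p x" for v x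
  proof -
    have "v $ i *\<^sub>R q' i x = (if i = k then v $ k *\<^sub>R p x else 0) + x $ k *\<^sub>R (v $ i *\<^sub>R q i x)" for i
      by (simp add: q'_def scaleR_add_right mult.commute)
    then show ?thesis
      by (simp only: sum.distrib) (simp add: scaleR_sum_right add.commute)
  qed
  moreover have "((\<lambda>x. x $ k *\<^sub>R p x) has_derivative (\<lambda>v. \<Sum>i\<in>UNIV. v $ i *\<^sub>R q' i x)) (at x)" for x
    unfolding sumq'
    by (rule has_derivative_scaleR[OF _ q(2)]) (intro bounded_linear_imp_has_derivative bounded_linear_vec_nth)
  moreover have "(\<Sum>i\<in>UNIV. x $ i *\<^sub>R q' i x) = real (Suc d) *\<^sub>R (x $ k *\<^sub>R p x)" for x
    unfolding sumq' q(3) by (simp add: scaleR_add_left algebra_simps)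
  ultimately show ?case by (intro exI[of _ q']) simp
next
  case (hpoly_add d p1 p2)
  from hpoly_add.IH(1) obtain q1 where q1: "\<And>i. hpoly (d - 1) (q1 i)"
    "\<And>x. (p1 has_derivative (\<lambda>v. \<Sum>i\<in>UNIV. v $ i *\<^sub>R q1 i x)) (at x)"
    "\<And>x. (\<Sum>i\<in>UNIV. x $ i *\<^sub>R q1 i x) = real d *\<^sub>R p1 x" "d = 0 \<longrightarrow> (\<forall>i x. q1 i x = 0)"
    by blast
  from hpoly_add.IH(2) obtain q2 where q2: "\<And>i. hpoly (d - 1) (q2 i)"
    "\<And>x. (p2 has_derivative (\<lambda>v. \<Sum>i\<in>UNIV. v $ i *\<^sub>R q2 i x)) (at x)"
    "\<And>x. (\<Sum>i\<in>UNIV. x $ i *\<^sub>R q2 i x) = real d *\<^sub>R p2 x" "d = 0 \<longrightarrow> (\<forall>i x. q2 i x = 0)"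
    by blast
  have eq: "(\<Sum>i\<in>UNIV. v $ i *\<^sub>R (q1 i x + q2 i x)) = (\<Sum>i\<in>UNIV. v $ i *\<^sub>R q1 i x) + (\<Sum>i\<in>UNIV. v $ i *\<^sub>R q2 i x)" for v x
    by (simp add: scaleR_add_right sum.distrib)
  show ?case
  proof (intro exI[of _ "\<lambda>i x. q1 i x + q2 i x"] conjI allI impI)
    show "hpoly (d - 1) (\<lambda>x. q1 i x + q2 i x)" for i by (rule hpoly.hpoly_add[OF q1(1) q2(1)])
    show "((\<lambda>x. p1 x + p2 x) has_derivative (\<lambda>v. \<Sum>i\<in>UNIV. v $ i *\<^sub>R (q1 i x + q2 i x))) (at x)" for x
      unfolding eq by (rule has_derivative_add[OF q1(2) q2(2)])
    show "(\<Sum>i\<in>UNIV. x $ i *\<^sub>R (q1 i x + q2 i x)) = real d *\<^sub>R (p1 x + p2 x)" for x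
      unfolding eq q1(3) q2(3) by (simp add: scaleR_add_right)
    show "q1 i x + q2 i x = 0" if "d = 0" for i x using that q1(4) q2(4) by simp
  qed
qed

lemma hpoly_partial:
  assumes "hpoly d p"
  shows "hpoly (d - 1) (\<lambda>x. frechet_derivative p (at x) (axis i 1))"
    and "d = 0 \<Longrightarrow> frechet_derivative p (at x) (axis i 1) = 0"
    and "frechet_derivative p (at x) x = real d *\<^sub>R p x"
    and "p differentiable (at x)"
proof -
  obtain q where q: "\<And>i. hpoly (d - 1) (q i)"
    "\<And>x. (p has_derivative (\<lambda>v. \<Sum>i\<in>UNIV. v $ i *\<^sub>R q i x)) (at x)"
    "\<And>x. (\<Sum>i\<in>UNIV. x $ i *\<^sub>R q i x) = real d *\<^sub>R p x" "d = 0 \<Longrightarrow> q i x = 0" for i x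
    using hpoly_derivative[OF assms] by blast
  have fd: "frechet_derivative p (at x) = (\<lambda>v. \<Sum>i\<in>UNIV. v $ i *\<^sub>R q i x)" for x
    using frechet_derivative_at[OF q(2)] by simp
  have ax: "frechet_derivative p (at x) (axis i 1) = q i x" for i x
  proof -
    have "axis i (1::real) $ l *\<^sub>R q l x = (if l = i then q i x else 0)" for l by (simp add: axis_def)
    then show ?thesis by (simp add: fd)
  qed
  show "hpoly (d - 1) (\<lambda>x. frechet_derivative p (at x) (axis i 1))" unfolding ax by (rule q(1))
  show "d = 0 \<Longrightarrow> frechet_derivative p (at x) (axis i 1) = 0" unfolding ax by (rule q(4))
  show "frechet_derivative p (at x) x = real d *\<^sub>R p x" unfolding fd by (rule q(3))
  show "p differentiable (at x)" using q(2) by (auto simp: differentiable_def)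
qed

lemma Ck_on_hpoly: "hpoly d p \<Longrightarrow> open S \<Longrightarrow> Ck_on k p S"
proof (induction rule: hpoly.induct)
  case (hpoly_mult d p i)
  show ?case
    by (rule Ck_on_scaleR[OF hpoly_mult.prems Ck_on_linear[OF bounded_linear_vec_nth hpoly_mult.prems]
          hpoly_mult.IH[OF hpoly_mult.prems]])
qed (auto intro: Ck_on_const Ck_on_add)

lemma Ck_on_hpoly_direction:
  "hpoly d p \<Longrightarrow> Ck_on k (\<lambda>x. p (x /\<^sub>R norm x)) (- {0})"
proof (induction rule: hpoly.induct)
  case (hpoly_mult d p i)
  have "Ck_on k (\<lambda>x::real^'a. x $ i *\<^sub>R inverse (norm x) ^ 1) (- {0})"
    by (intro Ck_on_scaleR Ck_on_linear bounded_linear_vec_nth Ck_on_inverse_norm_power) auto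
  then have "Ck_on k (\<lambda>x::real^'a. (x $ i *\<^sub>R inverse (norm x) ^ 1) *\<^sub>R p (x /\<^sub>R norm x)) (- {0})"
    by (intro Ck_on_scaleR[OF _ _ hpoly_mult.IH]) auto
  moreover have "(\<lambda>x::real^'a. (x $ i *\<^sub>R inverse (norm x) ^ 1) *\<^sub>R p (x /\<^sub>R norm x)) =
      (\<lambda>x. (x /\<^sub>R norm x) $ i *\<^sub>R p (x /\<^sub>R norm x))" by (simp add: mult.commute)
  ultimately show ?case by (simp only:)
qed (auto intro: Ck_on_const Ck_on_add)

section \<open>Clifford modules and the spin-orbit operator\<close>

text \<open>A Clifford module over the reals. Only real scalar products occur in the analysis, so the complex
matrices enter merely as self-adjoint real linear maps.\<close>

locale clifford =
  fixes s :: "'n::{finite,linorder} \<Rightarrow> 'b::euclidean_space \<Rightarrow> 'b"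
  assumes lin: "linear (s i)"
    and adj: "s i v \<bullet> w = v \<bullet> s i w"
    and cliff: "s i (s l v) + s l (s i v) = (if i = l then 2 else 0) *\<^sub>R v"
begin

lemmas s_simps = linear_add[OF lin] linear_diff[OF lin] linear_scale[OF lin] linear_neg[OF lin]
  linear_0[OF lin] linear_sum[OF lin]

lemma s_s_same [simp]: "s i (s i v) = v"
proof -
  have "2 *\<^sub>R s i (s i v) = 2 *\<^sub>R v" using cliff[of i i v] by (simp add: scaleR_2)
  then show ?thesis by simp
qed

lemma s_anticommute: "i < l \<Longrightarrow> s l (s i v) = - s i (s l v)"
  using cliff[of l i v] by (auto simp: eq_neg_iff_add_eq_0 split: if_splits)

lemma s_s_skew: "i < l \<Longrightarrow> s i (s l v) \<bullet> w = - (v \<bullet> s i (s l w))"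
  by (simp only: adj s_anticommute inner_minus_right)

text \<open>The spin-orbit operator. The derivative is taken along the rotation fields, which are tangential.\<close>

definition L :: "(real ^ 'n::{finite,linorder} \<Rightarrow> 'b) \<Rightarrow> real ^ 'n::{finite,linorder} \<Rightarrow> 'b" where
  "L f x = (\<Sum>i\<in>UNIV. \<Sum>l\<in>{l. i < l}. s i (s l (frechet_derivative f (at x) (rot_field i l x))))"

definition dirac_op :: "(real ^ 'n::{finite,linorder} \<Rightarrow> 'b) \<Rightarrow> real ^ 'n::{finite,linorder} \<Rightarrow> 'b" where
  "dirac_op f x = (\<Sum>i\<in>UNIV. s i (frechet_derivative f (at x) (axis i 1)))"

definition cmul :: "real ^ 'n::{finite,linorder} \<Rightarrow> 'b \<Rightarrow> 'b" where
  "cmul x v = (\<Sum>i\<in>UNIV. x $ i *\<^sub>R s i v)"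

text \<open>The polar form of the Dirac operator: multiplying it by \<open>\<sigma> \<cdot> x\<close> gives
\<open>r \<partial>_r + L\<close>. The diagonal terms of the product form the radial derivative and the pairs
\<open>i < l\<close> combine to \<open>L\<close>.\<close>

lemma cmul_dir:
  assumes "f differentiable (at x)"
  shows "cmul x (dirac_op f x) = frechet_derivative f (at x) x + L f x"
proof -
  let ?T = "frechet_derivative f (at x)"
  have T: "linear ?T" using assms by (rule linear_frechet_derivative)
  define a where "a i l = x $ i *\<^sub>R s i (s l (?T (axis l 1)))" for i l
  have "cmul x (dirac_op f x) = (\<Sum>i\<in>UNIV. \<Sum>l\<in>UNIV. a i l)"
    by (simp add: cmul_def dirac_op_def a_def s_simps scaleR_sum_right)
  also have "\<dots> = (\<Sum>i\<in>UNIV. a i i) + (\<Sum>i\<in>UNIV. \<Sum>l\<in>{l. i < l}. a i l + a l i)"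
    by (rule sum_off_diagonal_pairs)
  also have "(\<Sum>i\<in>UNIV. a i i) = ?T x"
    using sum_component_scaleR_linear[OF T] by (simp add: a_def)
  also have "(\<Sum>i\<in>UNIV. \<Sum>l\<in>{l. i < l}. a i l + a l i) = L f x"
    unfolding L_def
  proof (intro sum.cong refl)
    fix i l :: 'n assume "l \<in> {l. i < l}"
    then have "i < l" by auto
    then show "a i l + a l i = s i (s l (?T (rot_field i l x)))"
      by (simp add: a_def rot_field_def linear_diff[OF T] linear_scale[OF T] s_simps s_anticommute)
  qed
  finally show ?thesis .
qed

lemma cmul_linear: "linear (cmul x)"
  by (rule linearI) (simp_all add: cmul_def s_simps scaleR_add_right sum.distrib scaleR_sum_right mult.commute)

lemma cmul_axis: "cmul (axis i 1) v = s i v"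
proof -
  have "axis i (1::real) $ l *\<^sub>R s l v = (if l = i then s i v else 0)" for l by (simp add: axis_def)
  then show ?thesis by (simp add: cmul_def)
qed

lemma cmul_cmul: "cmul x (cmul x v) = (norm x)\<^sup>2 *\<^sub>R v"
proof -
  have "cmul x (cmul x v) = (\<Sum>i\<in>UNIV. \<Sum>l\<in>UNIV. (x $ i * x $ l) *\<^sub>R s i (s l v))"
    by (simp add: cmul_def s_simps scaleR_sum_right)
  also have "\<dots> = (\<Sum>i\<in>UNIV. (x $ i * x $ i) *\<^sub>R v)"
    unfolding sum_off_diagonal_pairs
    by (simp add: s_anticommute mult.commute)
  also have "\<dots> = (norm x)\<^sup>2 *\<^sub>R v"
    by (simp add: power2_norm_eq_inner inner_vec_def scaleR_sum_left)
  finally show ?thesis .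
qed

lemma cmul_adj: "cmul x v \<bullet> w = v \<bullet> cmul x w"
  by (simp add: cmul_def inner_sum_left inner_sum_right adj)

lemma norm_cmul: "norm (cmul x v) = norm x * norm v"
proof -
  have "(norm (cmul x v))\<^sup>2 = (norm x * norm v)\<^sup>2"
    by (simp add: power2_norm_eq_inner[of "cmul x v"] cmul_adj cmul_cmul power_mult_distrib power2_norm_eq_inner[of v])
  then show ?thesis by (simp add: power2_eq_iff_nonneg)
qed

text \<open>For \<open>i < l\<close> the map \<open>\<sigma>_i \<sigma>_l\<close> is skew, and so is the rotation field, by
integration by parts on the sphere. The product is symmetric: the two sides differ by integrals of
rotation fields applied to scalar functions.\<close>

lemma L_symmetric:
  assumes f: "Ck_on (Suc 0) f (- {0})" and g: "Ck_on (Suc 0) g (- {0})"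
  shows "(\<integral>\<omega>. L f \<omega> \<bullet> g \<omega> \<partial>sphere_measure) = (\<integral>\<omega>. f \<omega> \<bullet> L g \<omega> \<partial>sphere_measure)"
proof -
  define h where "h i l x = f x \<bullet> s i (s l (g x))" for i l x
  have ss: "bounded_linear (\<lambda>v. s i (s l v))" for i l
    using lin by (intro bounded_linear_compose[of "s i" "s l"]) (simp_all add: linear_conv_bounded_linear)
  have h': "(h i l has_derivative (\<lambda>v. f x \<bullet> s i (s l (frechet_derivative g (at x) v)) +
      frechet_derivative f (at x) v \<bullet> s i (s l (g x)))) (at x)" if "x \<noteq> 0" for i l x
    unfolding h_def using that
    by (intro has_derivative_inner Ck_on_Suc_derivative[OF f] bounded_linear.has_derivative[OF ss] Ck_on_Suc_derivative[OF g]) auto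
  have cf: "continuous_on (- {0}) f" and cg: "continuous_on (- {0}) g"
    using Ck_on_SucD[OF f] Ck_on_SucD[OF g] by auto
  have ch: "Ck_on (Suc 0) (h i l) (- {0})" for i l
  proof (rule Ck_on_SucI[OF _ h'])
    show "Ck_on 0 (\<lambda>x. f x \<bullet> s i (s l (frechet_derivative g (at x) v)) + frechet_derivative f (at x) v \<bullet> s i (s l (g x))) (- {0})" for v
      using f g by (auto intro!: continuous_intros bounded_linear.continuous_on[OF ss] cf cg)
  qed auto
  have csph: "continuous_on (sphere 0 1) F" if "continuous_on (- {0}) F" for F :: "real ^ 'n::{finite,linorder} \<Rightarrow> 'z::topological_space"
    by (rule continuous_on_subset[OF that]) auto
  have cL: "continuous_on (- {0}) (L F)" if F: "Ck_on (Suc 0) F (- {0})" for F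
    unfolding L_def[abs_def]
    by (intro continuous_on_sum bounded_linear.continuous_on[OF ss] continuous_on_frechet_derivative[OF F])
       (auto simp: rot_field_def intro!: continuous_intros)
  have pt: "L f \<omega> \<bullet> g \<omega> - f \<omega> \<bullet> L g \<omega> =
      - (\<Sum>i\<in>UNIV. \<Sum>l\<in>{l. i < l}. frechet_derivative (h i l) (at \<omega>) (rot_field i l \<omega>))" if "norm \<omega> = 1" for \<omega>
  proof -
    have "\<omega> \<noteq> 0" using that by force
    have "frechet_derivative (h i l) (at \<omega>) v = f \<omega> \<bullet> s i (s l (frechet_derivative g (at \<omega>) v)) +
      frechet_derivative f (at \<omega>) v \<bullet> s i (s l (g \<omega>))" for i l v
      by (rule fun_cong[OF frechet_derivative_at[OF h'[OF \<open>\<omega> \<noteq> 0\<close>], symmetric]])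
    then show ?thesis
      by (simp add: L_def inner_sum_left inner_sum_right s_s_skew sum_negf sum.distrib)
  qed
  have "(\<integral>\<omega>. L f \<omega> \<bullet> g \<omega> \<partial>sphere_measure) - (\<integral>\<omega>. f \<omega> \<bullet> L g \<omega> \<partial>sphere_measure) =
      (\<integral>\<omega>. L f \<omega> \<bullet> g \<omega> - f \<omega> \<bullet> L g \<omega> \<partial>sphere_measure)"
    by (rule Bochner_Integration.integral_diff[symmetric])
       (intro integrable_sphere csph continuous_on_inner cL f g cf cg)+
  also have "\<dots> = (\<integral>\<omega>. - (\<Sum>i\<in>UNIV. \<Sum>l\<in>{l. i < l}. frechet_derivative (h i l) (at \<omega>) (rot_field i l \<omega>)) \<partial>sphere_measure)"
    by (rule Bochner_Integration.integral_cong) (simp_all add: pt)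
  also have "\<dots> = - (\<Sum>i\<in>UNIV. \<Sum>l\<in>{l. i < l}. \<integral>\<omega>. frechet_derivative (h i l) (at \<omega>) (rot_field i l \<omega>) \<partial>sphere_measure)"
  proof -
    have int: "integrable sphere_measure (\<lambda>\<omega>. frechet_derivative (h i l) (at \<omega>) (rot_field i l \<omega>))" for i l
      by (intro integrable_sphere csph continuous_on_frechet_derivative[OF ch])
         (auto simp: rot_field_def intro!: continuous_intros)
    then show ?thesis by (simp add: Bochner_Integration.integral_sum Bochner_Integration.integrable_sum)
  qed
  also have "\<dots> = 0"
    by (simp add: sphere_integral_rotation_field[OF ch] less_imp_neq)
  finally show ?thesis by simp
qed

lemma L_cong_direction:
  assumes f: "Ck_on (Suc 0) f (- {0})" and "norm \<omega> = 1"
  shows "L (\<lambda>x. f (x /\<^sub>R norm x)) \<omega> = L f \<omega>"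
  using assms by (simp add: L_def frechet_derivative_direction)

lemma L_add:
  assumes "f differentiable (at x)" "g differentiable (at x)"
  shows "L (\<lambda>x. f x + g x) x = L f x + L g x"
proof -
  have "((\<lambda>x. f x + g x) has_derivative (\<lambda>v. frechet_derivative f (at x) v + frechet_derivative g (at x) v)) (at x)"
    using assms by (intro has_derivative_add) (simp_all add: frechet_derivative_works)
  note fun_cong[OF frechet_derivative_at[OF this, symmetric]]
  then show ?thesis by (simp add: L_def s_simps sum.distrib)
qed

lemma L_scale:
  assumes "f differentiable (at x)"
  shows "L (\<lambda>x. c *\<^sub>R f x) x = c *\<^sub>R L f x"
proof -
  have "((\<lambda>x. c *\<^sub>R f x) has_derivative (\<lambda>v. c *\<^sub>R frechet_derivative f (at x) v)) (at x)"
    using assms by (intro has_derivative_scaleR_right) (simp add: frechet_derivative_works)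
  note fun_cong[OF frechet_derivative_at[OF this, symmetric]]
  then show ?thesis by (simp add: L_def s_simps scaleR_sum_right)
qed

lemma hpoly_dir: "hpoly d p \<Longrightarrow> hpoly (d - 1) (dirac_op p)"
  unfolding dirac_op_def[abs_def] by (intro hpoly_sum hpoly_linear[OF lin] hpoly_partial) auto

lemma hpoly_dir_0: "hpoly 0 p \<Longrightarrow> dirac_op p x = 0"
  by (simp add: dirac_op_def hpoly_partial(2) s_simps)

lemma hpoly_cmul: "hpoly d p \<Longrightarrow> hpoly (Suc d) (\<lambda>x. cmul x (p x))"
  unfolding cmul_def by (intro hpoly_sum hpoly_mult hpoly_linear[OF lin]) auto

lemma L_hpoly_eq: "hpoly d p \<Longrightarrow> L p x = cmul x (dirac_op p x) - real d *\<^sub>R p x"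
  using cmul_dir[of p x] hpoly_partial(3,4)[of d p x] by simp

lemma hpoly_L: assumes p: "hpoly d p" shows "hpoly d (L p)"
proof -
  have "hpoly d (\<lambda>x. cmul x (dirac_op p x))"
  proof (cases d)
    case 0
    then have "(\<lambda>x. cmul x (dirac_op p x)) = (\<lambda>x. 0)"
      using hpoly_dir_0 p linear_0[OF cmul_linear] by simp
    then show ?thesis by (simp only: hpoly_zero)
  next
    case (Suc d')
    then show ?thesis using hpoly_cmul[OF hpoly_dir[OF p]] by simp
  qed
  then have "hpoly d (\<lambda>x. cmul x (dirac_op p x) - real d *\<^sub>R p x)"
    by (intro hpoly_diff hpoly_scale p)
  moreover have "L p = (\<lambda>x. cmul x (dirac_op p x) - real d *\<^sub>R p x)"
    by (rule ext) (rule L_hpoly_eq[OF p])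
  ultimately show ?thesis by (simp only:)
qed

text \<open>Moving the Dirac operator past \<open>\<sigma> \<cdot> x\<close> costs a sign, the dimension and twice the Euler
operator.\<close>

lemma dir_cmul:
  assumes g: "hpoly d g"
  shows "dirac_op (\<lambda>x. cmul x (g x)) x = real (CARD('n) + 2 * d) *\<^sub>R g x - cmul x (dirac_op g x)"
proof -
  let ?T = "frechet_derivative g (at x)"
  have diff: "g differentiable (at x)" by (rule hpoly_partial(4)[OF g])
  have T: "linear ?T" using diff by (rule linear_frechet_derivative)
  have "((\<lambda>x. cmul x (g x)) has_derivative (\<lambda>v. cmul x (?T v) + cmul v (g x))) (at x)"
  proof -
    have "((\<lambda>x. \<Sum>i\<in>UNIV. x $ i *\<^sub>R s i (g x)) has_derivative
        (\<lambda>v. \<Sum>i\<in>UNIV. x $ i *\<^sub>R s i (?T v) + v $ i *\<^sub>R s i (g x))) (at x)"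
      using lin diff
      by (intro has_derivative_sum has_derivative_scaleR bounded_linear.has_derivative[of "s _"]
           bounded_linear_imp_has_derivative bounded_linear_vec_nth)
         (simp_all add: linear_conv_bounded_linear frechet_derivative_works[symmetric])
    then show ?thesis by (simp add: cmul_def sum.distrib)
  qed
  then have fd: "frechet_derivative (\<lambda>x. cmul x (g x)) (at x) v = cmul x (?T v) + cmul v (g x)" for v
    by (rule fun_cong[OF frechet_derivative_at[symmetric]])
  have "s i (cmul x w) = (2 * x $ i) *\<^sub>R w - cmul x (s i w)" for i w
  proof -
    have "s i (cmul x w) + cmul x (s i w) = (\<Sum>l\<in>UNIV. x $ l *\<^sub>R (s i (s l w) + s l (s i w)))"
      by (simp add: cmul_def s_simps scaleR_add_right sum.distrib)
    also have "\<dots> = (\<Sum>l\<in>UNIV. if l = i then (2 * x $ i) *\<^sub>R w else 0)"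
      unfolding cliff by (rule sum.cong) auto
    also have "\<dots> = (2 * x $ i) *\<^sub>R w" by simp
    finally show ?thesis by (simp add: algebra_simps)
  qed
  then have "dirac_op (\<lambda>x. cmul x (g x)) x = (\<Sum>i\<in>UNIV. (2 * x $ i) *\<^sub>R ?T (axis i 1) - cmul x (s i (?T (axis i 1))) + g x)"
    by (simp add: dirac_op_def fd s_simps cmul_axis)
  also have "\<dots> = 2 *\<^sub>R (\<Sum>i\<in>UNIV. x $ i *\<^sub>R ?T (axis i 1)) - cmul x (dirac_op g x) + real CARD('n) *\<^sub>R g x"
    by (simp add: sum.distrib sum_subtractf dirac_op_def linear_sum[OF cmul_linear] scaleR_sum_right sum_constant_scaleR)
  also have "(\<Sum>i\<in>UNIV. x $ i *\<^sub>R ?T (axis i 1)) = real d *\<^sub>R g x"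
    using sum_component_scaleR_linear[OF T] hpoly_partial(3)[OF g] by simp
  finally show ?thesis by (simp add: algebra_simps)
qed

text \<open>The key algebraic identity, \<open>(L - (N + n - 2)) (L + N) q = - r^2 D^2 q\<close> for homogeneous
\<open>q\<close> of degree \<open>N\<close>. Indeed \<open>(L + N) q = x D q\<close>, and applying the same formula to
\<open>x D q\<close> leaves only the term with two Dirac operators, whose degree is lower by two.\<close>

lemma L_quadratic:
  assumes q: "hpoly N q" and N: "N \<ge> 1"
  shows "L (\<lambda>x. L q x + real N *\<^sub>R q x) x - real (N + CARD('n) - 2) *\<^sub>R (L q x + real N *\<^sub>R q x)
    = - ((norm x)\<^sup>2 *\<^sub>R dirac_op (dirac_op q) x)"
proof -
  let ?P = "\<lambda>x. cmul x (dirac_op q x)"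
  have P: "L q x + real N *\<^sub>R q x = ?P x" for x using L_hpoly_eq[OF q] by simp
  have "hpoly (Suc (N - 1)) ?P" by (rule hpoly_cmul[OF hpoly_dir[OF q]])
  then have "hpoly N ?P" using N by simp
  then have "L ?P x = cmul x (dirac_op ?P x) - real N *\<^sub>R ?P x" by (rule L_hpoly_eq)
  also have "dirac_op ?P x = real (CARD('n) + 2 * (N - 1)) *\<^sub>R dirac_op q x - cmul x (dirac_op (dirac_op q) x)"
    by (rule dir_cmul[OF hpoly_dir[OF q]])
  also have "cmul x \<dots> = real (CARD('n) + 2 * (N - 1)) *\<^sub>R ?P x - (norm x)\<^sup>2 *\<^sub>R dirac_op (dirac_op q) x"
    by (simp only: linear_diff[OF cmul_linear] linear_scale[OF cmul_linear] cmul_cmul)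
  finally have "L ?P x = (real (CARD('n) + 2 * (N - 1)) - real N) *\<^sub>R ?P x - (norm x)\<^sup>2 *\<^sub>R dirac_op (dirac_op q) x"
    by (simp add: algebra_simps)
  also have "real (CARD('n) + 2 * (N - 1)) - real N = real (N + CARD('n) - 2)"
  proof -
    have "1 \<le> CARD('n)" by (simp add: Suc_leI)
    then have "2 \<le> N + CARD('n)" using N by linarith
    then show ?thesis using N by (simp add: of_nat_diff)
  qed
  finally show ?thesis by (simp only: P) simp
qed

end


section \<open>Spaces of polynomials\<close>

lemma hpoly_norm_power:
  fixes f :: "real ^ 'n::finite \<Rightarrow> 'b::real_normed_vector"
  assumes "hpoly N f"
  shows "hpoly (Suc (Suc N)) (\<lambda>x. (norm x)\<^sup>2 *\<^sub>R f x)"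
proof -
  have "hpoly (Suc (Suc N)) (\<lambda>x. \<Sum>i\<in>UNIV. x $ i *\<^sub>R x $ i *\<^sub>R f x)"
    by (intro hpoly_sum hpoly_mult assms) simp
  moreover have "(\<lambda>x. \<Sum>i\<in>UNIV. x $ i *\<^sub>R x $ i *\<^sub>R f x) = (\<lambda>x. (norm x)\<^sup>2 *\<^sub>R f x)"
    by (simp add: power2_norm_eq_inner inner_vec_def scaleR_sum_left)
  ultimately show ?thesis by (simp only:)
qed

text \<open>Homogeneous polynomials of a given degree form a finite-dimensional space. Finite generation is
stated as an induction principle: a property that is closed under linear combinations holds for all
of them if it holds for the generators. This is the form in which it is used, and it avoids
coefficients.\<close>

lemma hpoly_finitely_generated:
  "\<exists>F :: (real ^ 'n::finite \<Rightarrow> 'b::euclidean_space) set. finite F \<and> (\<forall>f\<in>F. hpoly d f) \<and>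
     (\<forall>p P. hpoly d p \<longrightarrow> (\<forall>f\<in>F. P f) \<longrightarrow> (\<forall>f g. P f \<longrightarrow> P g \<longrightarrow> P (\<lambda>x. f x + g x)) \<longrightarrow>
        (\<forall>c f. P f \<longrightarrow> P (\<lambda>x. c *\<^sub>R f x)) \<longrightarrow> P p)"
proof (induction d)
  case 0
  let ?F = "(\<lambda>e (x :: real ^ 'n). e) ` (Basis :: 'b set)"
  have gen: "hpoly d p \<Longrightarrow> d = 0 \<Longrightarrow> P p"
    if F: "\<forall>f\<in>?F. P f" and add: "\<forall>f g. P f \<longrightarrow> P g \<longrightarrow> P (\<lambda>x. f x + g x)"
      and scale: "\<forall>c f. P f \<longrightarrow> P (\<lambda>x. c *\<^sub>R f x)" for d p and P :: "(real ^ 'n \<Rightarrow> 'b) \<Rightarrow> bool"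
  proof (induction rule: hpoly.induct)
    case (hpoly_const v)
    obtain e0 :: 'b where e0: "e0 \<in> Basis" using nonempty_Basis by blast
    have "P (\<lambda>x. 0 *\<^sub>R e0)" using scale F e0 by blast
    then have zero: "P (\<lambda>x. 0)" by simp
    have "P (\<lambda>x. \<Sum>e\<in>A. (v \<bullet> e) *\<^sub>R e)" if "finite A" "A \<subseteq> Basis" for A
      using that
    proof (induction A rule: finite_induct)
      case (insert e A)
      have "P (\<lambda>x. (v \<bullet> e) *\<^sub>R e)" using scale F insert.prems by blast
      moreover have "P (\<lambda>x. \<Sum>e\<in>A. (v \<bullet> e) *\<^sub>R e)" using insert by blast
      ultimately have "P (\<lambda>x. (v \<bullet> e) *\<^sub>R e + (\<Sum>e\<in>A. (v \<bullet> e) *\<^sub>R e))" using add by blast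
      then show ?case using insert.hyps by simp
    qed (use zero in simp)
    from this[of Basis] show ?case by (simp add: euclidean_representation)
  next
    case (hpoly_mult d p i)
    then show ?case by simp
  next
    case (hpoly_add d p q)
    then show ?case using add by blast
  qed
  show ?case
  proof (intro exI[of _ ?F] conjI allI impI ballI)
    show "hpoly 0 f" if "f \<in> ?F" for f using that by (auto intro: hpoly_const)
    show "P p" if "hpoly 0 p" "\<forall>f\<in>?F. P f" "\<forall>f g. P f \<longrightarrow> P g \<longrightarrow> P (\<lambda>x. f x + g x)"
      "\<forall>c f. P f \<longrightarrow> P (\<lambda>x. c *\<^sub>R f x)" for p P
      using gen[OF that(2,3,4,1)] by simp
  qed simp
next
  case (Suc d)
  then obtain F :: "(real ^ 'n \<Rightarrow> 'b) set" where F: "finite F" "\<forall>f\<in>F. hpoly d f"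
    and FP: "\<And>p P. hpoly d p \<Longrightarrow> \<forall>f\<in>F. P f \<Longrightarrow> \<forall>f g. P f \<longrightarrow> P g \<longrightarrow> P (\<lambda>x. f x + g x) \<Longrightarrow>
        \<forall>c f. P f \<longrightarrow> P (\<lambda>x. c *\<^sub>R f x) \<Longrightarrow> P p"
    by blast
  let ?G = "(\<lambda>(i, f) x. x $ i *\<^sub>R f x) ` ((UNIV :: 'n set) \<times> F)"
  have gen: "hpoly d' p \<Longrightarrow> d' = Suc d \<Longrightarrow> P p"
    if G: "\<forall>f\<in>?G. P f" and add: "\<forall>f g. P f \<longrightarrow> P g \<longrightarrow> P (\<lambda>x. f x + g x)"
      and scale: "\<forall>c f. P f \<longrightarrow> P (\<lambda>x. c *\<^sub>R f x)" for d' p and P :: "(real ^ 'n \<Rightarrow> 'b) \<Rightarrow> bool"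
  proof (induction rule: hpoly.induct)
    case (hpoly_const v)
    then show ?case by simp
  next
    case (hpoly_mult d'' p i)
    then have "hpoly d p" by simp
    then show ?case
    proof (rule FP[where P = "\<lambda>f. P (\<lambda>x. x $ i *\<^sub>R f x)"])
      show "\<forall>f\<in>F. P (\<lambda>x. x $ i *\<^sub>R f x)" using G by force
      show "\<forall>f g. P (\<lambda>x. x $ i *\<^sub>R f x) \<longrightarrow> P (\<lambda>x. x $ i *\<^sub>R g x) \<longrightarrow> P (\<lambda>x. x $ i *\<^sub>R (f x + g x))"
        unfolding scaleR_add_right using add by blast
      show "\<forall>c f. P (\<lambda>x. x $ i *\<^sub>R f x) \<longrightarrow> P (\<lambda>x. x $ i *\<^sub>R c *\<^sub>R f x)"
        unfolding scaleR_left_commute[of "_ $ i"] using scale by blast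
    qed
  next
    case (hpoly_add d p q)
    then show ?case using add by blast
  qed
  show ?case
  proof (intro exI[of _ ?G] conjI allI impI ballI)
    show "finite ?G" using F(1) by simp
    show "hpoly (Suc d) f" if "f \<in> ?G" for f using that F(2) by (auto intro: hpoly_mult)
    show "P p" if "hpoly (Suc d) p" "\<forall>f\<in>?G. P f" "\<forall>f g. P f \<longrightarrow> P g \<longrightarrow> P (\<lambda>x. f x + g x)"
      "\<forall>c f. P f \<longrightarrow> P (\<lambda>x. c *\<^sub>R f x)" for p P
      using gen[OF that(2,3,4,1)] by simp
  qed
qed

inductive poly_sum :: "nat \<Rightarrow> (real ^ 'n::finite \<Rightarrow> 'b::real_normed_vector) \<Rightarrow> bool" where
  poly_sum_hpoly: "hpoly d p \<Longrightarrow> d \<le> N \<Longrightarrow> poly_sum N p"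
| poly_sum_add: "poly_sum N p \<Longrightarrow> poly_sum N q \<Longrightarrow> poly_sum N (\<lambda>x. p x + q x)"

lemma poly_sum_mono: "poly_sum N p \<Longrightarrow> N \<le> M \<Longrightarrow> poly_sum M p"
  by (induction rule: poly_sum.induct) (auto intro: poly_sum.intros)

lemma poly_sum_linear: "poly_sum N p \<Longrightarrow> linear T \<Longrightarrow> poly_sum N (\<lambda>x. T (p x))"
  by (induction rule: poly_sum.induct) (auto intro: poly_sum.intros hpoly_linear simp: linear_add)

lemma hpoly_prod:
  fixes p :: "real ^ 'n::finite \<Rightarrow> real" and q :: "real ^ 'n \<Rightarrow> 'b::real_normed_vector"
  shows "hpoly d p \<Longrightarrow> hpoly e q \<Longrightarrow> hpoly (d + e) (\<lambda>x. p x *\<^sub>R q x)"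
proof (induction rule: hpoly.induct)
  case (hpoly_const v)
  then show ?case using hpoly_scale[of e q v] by simp
next
  case (hpoly_mult d p i)
  then show ?case using hpoly.hpoly_mult[of "d + e" "\<lambda>x. p x *\<^sub>R q x" i] by simp
next
  case (hpoly_add d p1 p2)
  then show ?case by (simp add: scaleR_add_left hpoly.hpoly_add)
qed

lemma poly_sum_prod:
  fixes p :: "real ^ 'n::finite \<Rightarrow> real" and q :: "real ^ 'n \<Rightarrow> 'b::real_normed_vector"
  assumes p: "poly_sum N p" and q: "poly_sum M q"
  shows "poly_sum (N + M) (\<lambda>x. p x *\<^sub>R q x)"
  using p
proof (induction rule: poly_sum.induct)
  case (poly_sum_hpoly d p N)
  show ?case using q poly_sum_hpoly
  proof (induction rule: poly_sum.induct)
    case (poly_sum_hpoly e q M)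
    then show ?case by (intro poly_sum.poly_sum_hpoly[of "d + e"] hpoly_prod) auto
  next
    case (poly_sum_add M q1 q2)
    then show ?case by (simp add: scaleR_add_right poly_sum.poly_sum_add)
  qed
next
  case (poly_sum_add N p1 p2)
  then show ?case by (simp add: scaleR_add_left poly_sum.poly_sum_add)
qed

lemma real_polynomial_function_psum:
  fixes p :: "real ^ 'n::finite \<Rightarrow> real"
  shows "real_polynomial_function p \<Longrightarrow> \<exists>N. poly_sum N p"
proof (induction rule: real_polynomial_function.induct)
  case (linear f)
  have "hpoly (Suc 0) (\<lambda>x :: real ^ 'n. \<Sum>i\<in>UNIV. x $ i *\<^sub>R f (axis i 1))"
    by (intro hpoly_sum hpoly_mult hpoly_const) simp
  then have "hpoly (Suc 0) f"
    by (simp only: sum_component_scaleR_linear[OF bounded_linear.linear[OF linear]])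
  then show ?case using poly_sum_hpoly by blast
next
  case (const c)
  then show ?case using poly_sum_hpoly[OF hpoly_const] by blast
next
  case (add f g)
  then obtain N M where "poly_sum N f" "poly_sum M g" by blast
  then have "poly_sum (N + M) f" "poly_sum (N + M) g" by (auto intro: poly_sum_mono)
  then show ?case using poly_sum_add by blast
next
  case (mult f g)
  then obtain N M where "poly_sum N f" "poly_sum M g" by blast
  then show ?case using poly_sum_prod[of N f M g] by auto
qed

lemma polynomial_function_psum:
  fixes p :: "real ^ 'n::finite \<Rightarrow> 'b::euclidean_space"
  assumes "polynomial_function p"
  shows "\<exists>N. poly_sum N p"
proof -
  have 1: "\<exists>N. poly_sum N (\<lambda>x. (p x \<bullet> b) *\<^sub>R b)" for b
  proof -
    have "real_polynomial_function (\<lambda>x. p x \<bullet> b)"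
      using assms bounded_linear_inner_left[of b] unfolding polynomial_function_def o_def by blast
    then obtain N where "poly_sum N (\<lambda>x. p x \<bullet> b)" using real_polynomial_function_psum by blast
    moreover have "linear (\<lambda>r::real. r *\<^sub>R b)" by (intro linearI) (simp_all add: scaleR_add_left)
    ultimately show ?thesis using poly_sum_linear by blast
  qed
  have "\<exists>N. poly_sum N (\<lambda>x. \<Sum>b\<in>A. (p x \<bullet> b) *\<^sub>R b)" if "finite A" for A
    using that
  proof (induction A rule: finite_induct)
    case empty
    then show ?case using poly_sum_hpoly[OF hpoly_const[of "0::'b"]] by auto
  next
    case (insert b A)
    obtain N where N: "poly_sum N (\<lambda>x. \<Sum>b\<in>A. (p x \<bullet> b) *\<^sub>R b)" using insert.IH by blast
    obtain M where M: "poly_sum M (\<lambda>x. (p x \<bullet> b) *\<^sub>R b)" using 1 by blast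
    have "poly_sum (M + N) (\<lambda>x. (p x \<bullet> b) *\<^sub>R b + (\<Sum>b\<in>A. (p x \<bullet> b) *\<^sub>R b))"
      by (rule poly_sum_add[OF poly_sum_mono[OF M] poly_sum_mono[OF N]]) auto
    then show ?case using insert.hyps by auto
  qed
  from this[OF finite_Basis] show ?thesis by (simp add: euclidean_representation)
qed

section \<open>Orthonormal sets on the sphere\<close>

text \<open>The real part of the scalar product on the sphere.\<close>

definition sip :: "(real ^ 'n::finite \<Rightarrow> 'b::euclidean_space) \<Rightarrow> (real ^ 'n \<Rightarrow> 'b) \<Rightarrow> real" where
  "sip f g = (\<integral>\<omega>. f \<omega> \<bullet> g \<omega> \<partial>sphere_measure)"

abbreviation sphere_cont :: "(real ^ 'n::finite \<Rightarrow> 'b::euclidean_space) \<Rightarrow> bool" where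
  "sphere_cont f \<equiv> continuous_on (sphere 0 1) f"

lemma sip_commute: "sip f g = sip g f"
  by (simp add: sip_def inner_commute)

lemma sip_cong:
  "(\<And>\<omega>. norm \<omega> = 1 \<Longrightarrow> f \<omega> = f' \<omega>) \<Longrightarrow> (\<And>\<omega>. norm \<omega> = 1 \<Longrightarrow> g \<omega> = g' \<omega>) \<Longrightarrow> sip f g = sip f' g'"
  unfolding sip_def by (rule Bochner_Integration.integral_cong) simp_all

lemma sip_add_left: "sphere_cont f \<Longrightarrow> sphere_cont g \<Longrightarrow> sphere_cont h \<Longrightarrow>
    sip (\<lambda>x. f x + g x) h = sip f h + sip g h"
  unfolding sip_def inner_add_left
  by (intro Bochner_Integration.integral_add integrable_sphere continuous_on_inner)

lemma sip_diff_left: "sphere_cont f \<Longrightarrow> sphere_cont g \<Longrightarrow> sphere_cont h \<Longrightarrow>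
    sip (\<lambda>x. f x - g x) h = sip f h - sip g h"
  unfolding sip_def inner_diff_left
  by (intro Bochner_Integration.integral_diff integrable_sphere continuous_on_inner)

lemma sip_scale_left: "sip (\<lambda>x. c *\<^sub>R f x) h = c * sip f h"
  by (simp add: sip_def)

lemma sip_sum_left:
  assumes "finite A" "\<And>a. a \<in> A \<Longrightarrow> sphere_cont (f a)" "sphere_cont h"
  shows "sip (\<lambda>x. \<Sum>a\<in>A. c a *\<^sub>R f a x) h = (\<Sum>a\<in>A. c a * sip (f a) h)"
  unfolding sip_def inner_sum_left inner_scaleR_left
  using assms by (subst Bochner_Integration.integral_sum) (auto intro!: integrable_sphere continuous_intros)

lemma sip_nonneg: "0 \<le> sip f f"
  unfolding sip_def by (rule Bochner_Integration.integral_nonneg) simp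

lemma sip_eq_0_imp:
  assumes "sphere_cont f" "sip f f = 0" "norm \<omega> = 1"
  shows "f \<omega> = 0"
proof -
  have "f \<omega> \<bullet> f \<omega> = 0"
    by (rule sphere_integral_eq_0_imp[where f = "\<lambda>\<omega>. f \<omega> \<bullet> f \<omega>"])
       (use assms in \<open>auto simp: sip_def intro: continuous_on_inner\<close>)
  then show ?thesis by simp
qed

definition sphere_orthonormal :: "(real ^ 'n::finite \<Rightarrow> 'b::euclidean_space) set \<Rightarrow> bool" where
  "sphere_orthonormal B \<longleftrightarrow> finite B \<and> (\<forall>b\<in>B. sphere_cont b) \<and>
     (\<forall>b\<in>B. \<forall>c\<in>B. sip b c = (if b = c then 1 else 0))"

text \<open>The orthogonal projection onto the span of an orthonormal set \<open>B\<close>.\<close>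

definition sproj :: "(real ^ 'n::finite \<Rightarrow> 'b::euclidean_space) set \<Rightarrow> (real ^ 'n \<Rightarrow> 'b) \<Rightarrow> real ^ 'n \<Rightarrow> 'b" where
  "sproj B f x = (\<Sum>b\<in>B. sip f b *\<^sub>R b x)"

lemma sphere_orthonormalD:
  assumes "sphere_orthonormal B"
  shows "finite B" "b \<in> B \<Longrightarrow> sphere_cont b" "b \<in> B \<Longrightarrow> c \<in> B \<Longrightarrow> sip b c = (if b = c then 1 else 0)"
  using assms by (auto simp: sphere_orthonormal_def)

lemma sphere_cont_sproj: "sphere_orthonormal B \<Longrightarrow> sphere_cont (sproj B f)"
  unfolding sproj_def[abs_def] sphere_orthonormal_def by (auto intro!: continuous_intros)

lemma sip_sproj:
  assumes B: "sphere_orthonormal B" and b: "b \<in> B"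
  shows "sip (sproj B f) b = sip f b"
proof -
  note D = sphere_orthonormalD[OF B]
  have "sip (sproj B f) b = (\<Sum>c\<in>B. sip f c * sip c b)"
    unfolding sproj_def[abs_def] by (rule sip_sum_left) (use D b in auto)
  also have "\<dots> = (\<Sum>c\<in>B. if c = b then sip f b else 0)"
    by (rule sum.cong) (use D(3) b in auto)
  also have "\<dots> = sip f b" using D(1) b by simp
  finally show ?thesis .
qed

lemma sip_sproj_left:
  assumes B: "sphere_orthonormal B" and h: "sphere_cont h"
  shows "sip (sproj B f) h = (\<Sum>b\<in>B. sip f b * sip h b)"
  unfolding sproj_def[abs_def]
  by (subst sip_sum_left) (use sphere_orthonormalD[OF B] h in \<open>auto simp: sip_commute\<close>)

lemma sip_residual:
  assumes B: "sphere_orthonormal B" and f: "sphere_cont f"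
  defines "r \<equiv> \<lambda>x. f x - sproj B f x"
  shows "sphere_cont r" and "b \<in> B \<Longrightarrow> sip r b = 0"
    and "sip r r = sip f f - (\<Sum>b\<in>B. (sip f b)\<^sup>2)" and "sip f r = sip r r"
proof -
  note P = sphere_cont_sproj[OF B, of f]
  show r: "sphere_cont r" unfolding r_def by (intro continuous_on_diff f P)
  show z: "sip r b = 0" if "b \<in> B" for b
    unfolding r_def using sphere_orthonormalD[OF B] that
    by (subst sip_diff_left) (simp_all add: f P sip_sproj[OF B])
  have 1: "sip (sproj B f) r = 0"
    by (simp add: sip_sproj_left[OF B r] z)
  have "sip r r = sip f r - sip (sproj B f) r"
    using sip_diff_left[OF f P r] unfolding r_def .
  then show 2: "sip f r = sip r r" using 1 by simp
  have "sip r f = sip f f - sip (sproj B f) f"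
    unfolding r_def by (rule sip_diff_left[OF f P f])
  then show "sip r r = sip f f - (\<Sum>b\<in>B. (sip f b)\<^sup>2)"
    using 2 by (simp add: sip_commute[of r f] sip_sproj_left[OF B f] power2_eq_square)
qed

lemma sphere_bessel:
  assumes "sphere_orthonormal B" "sphere_cont f"
  shows "(\<Sum>b\<in>B. (sip f b)\<^sup>2) \<le> sip f f"
  using sip_residual(3)[OF assms] sip_nonneg[of "\<lambda>x. f x - sproj B f x"] by simp

text \<open>States that \<open>f\<close> lies in the span of \<open>B\<close> on the sphere; the Fourier coefficients provide
the linear combination.\<close>

definition sphere_rep :: "(real ^ 'n::finite \<Rightarrow> 'b::euclidean_space) set \<Rightarrow> (real ^ 'n \<Rightarrow> 'b) \<Rightarrow> bool" where
  "sphere_rep B f \<longleftrightarrow> sphere_cont f \<and> (\<forall>\<omega>. norm \<omega> = 1 \<longrightarrow> f \<omega> = sproj B f \<omega>)"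

lemma sproj_add:
  assumes B: "sphere_orthonormal B" and "sphere_cont f" "sphere_cont g"
  shows "sproj B (\<lambda>x. f x + g x) x = sproj B f x + sproj B g x"
  unfolding sproj_def sum.distrib[symmetric] scaleR_add_left[symmetric]
  using sphere_orthonormalD[OF B] assms by (intro sum.cong) (simp_all add: sip_add_left)

lemma sproj_scale: "sproj B (\<lambda>x. c *\<^sub>R f x) x = c *\<^sub>R sproj B f x"
  by (simp add: sproj_def sip_scale_left scaleR_sum_right)

lemma sphere_rep_add:
  "sphere_orthonormal B \<Longrightarrow> sphere_rep B f \<Longrightarrow> sphere_rep B g \<Longrightarrow> sphere_rep B (\<lambda>x. f x + g x)"
  unfolding sphere_rep_def by (auto simp: sproj_add intro: continuous_on_add)

lemma sphere_rep_scale: "sphere_rep B f \<Longrightarrow> sphere_rep B (\<lambda>x. c *\<^sub>R f x)"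
  unfolding sphere_rep_def by (auto simp: sproj_scale intro: continuous_intros)

lemma sphere_rep_cong:
  assumes "sphere_rep B f" "\<And>\<omega>. norm \<omega> = 1 \<Longrightarrow> f \<omega> = g \<omega>"
  shows "sphere_rep B g"
proof -
  have "sip f b = sip g b" for b by (rule sip_cong) (use assms(2) in auto)
  moreover have "sphere_cont g"
    using assms by (auto simp: sphere_rep_def cong: continuous_on_cong_simp)
  ultimately show ?thesis using assms by (simp add: sphere_rep_def sproj_def)
qed

lemma sphere_rep_mono:
  assumes B: "sphere_orthonormal B" and B': "sphere_orthonormal B'" and sub: "B \<subseteq> B'" and f: "sphere_rep B f"
  shows "sphere_rep B' f"
proof -
  have fc: "sphere_cont f" and feq: "\<And>\<omega>. norm \<omega> = 1 \<Longrightarrow> f \<omega> = sproj B f \<omega>"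
    using f by (auto simp: sphere_rep_def)
  have "sip f b = 0" if b: "b \<in> B' - B" for b
  proof -
    have "sphere_cont b" using sphere_orthonormalD[OF B'] b by auto
    have "sip f b = sip (sproj B f) b" by (rule sip_cong) (use feq in auto)
    also have "\<dots> = (\<Sum>c\<in>B. sip f c * sip b c)" by (rule sip_sproj_left[OF B \<open>sphere_cont b\<close>])
    also have "\<dots> = 0"
    proof (intro sum.neutral ballI)
      fix c assume "c \<in> B"
      then have "sip b c = 0" using sphere_orthonormalD(3)[OF B', of b c] b sub by auto
      then show "sip f c * sip b c = 0" by simp
    qed
    finally show ?thesis .
  qed
  then have "sproj B' f = sproj B f"
    unfolding sproj_def[abs_def]
    by (intro ext sum.mono_neutral_right) (use sphere_orthonormalD(1)[OF B'] sub in auto)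
  then show ?thesis using fc feq by (simp add: sphere_rep_def)
qed

text \<open>The defect in the inequality of Bessel is the squared distance of \<open>f\<close> to the span of
\<open>B\<close>, hence it is at most the squared distance to any element \<open>p\<close> of the span.\<close>

lemma sphere_parseval_defect:
  fixes f :: "real ^ 'n::finite \<Rightarrow> 'b::euclidean_space"
  assumes B: "sphere_orthonormal B" and f: "sphere_cont f" and p: "sphere_rep B p"
    and close: "\<And>\<omega>. norm \<omega> = 1 \<Longrightarrow> norm (f \<omega> - p \<omega>) \<le> \<epsilon>"
  shows "sip f f - (\<Sum>b\<in>B. (sip f b)\<^sup>2) \<le> \<epsilon>\<^sup>2 * measure sphere_measure (sphere (0 :: real ^ 'n) 1)"
    (is "_ \<le> \<epsilon>\<^sup>2 * ?m")
proof -
  interpret finite_measure "sphere_measure :: (real ^ 'n) measure" by (rule finite_measure_sphere_measure)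
  have pc: "sphere_cont p" and peq: "\<And>\<omega>. norm \<omega> = 1 \<Longrightarrow> p \<omega> = sproj B p \<omega>"
    using p by (auto simp: sphere_rep_def)
  define g where "g x = f x - p x" for x
  have gc: "sphere_cont g" unfolding g_def by (intro continuous_on_diff f pc)
  have "sproj B f \<omega> = sproj B g \<omega> + sproj B p \<omega>" for \<omega>
    using sproj_add[OF B gc pc] by (simp add: g_def)
  then have eq: "f \<omega> - sproj B f \<omega> = g \<omega> - sproj B g \<omega>" if "norm \<omega> = 1" for \<omega>
    using peq[OF that] by (simp add: g_def)
  have "sip f f - (\<Sum>b\<in>B. (sip f b)\<^sup>2) = sip (\<lambda>x. f x - sproj B f x) (\<lambda>x. f x - sproj B f x)"
    using sip_residual(3)[OF B f] by simp
  also have "\<dots> = sip (\<lambda>x. g x - sproj B g x) (\<lambda>x. g x - sproj B g x)"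
    by (rule sip_cong) (use eq in auto)
  also have "\<dots> \<le> sip g g"
    using sip_residual(3)[OF B gc] by (simp add: sum_nonneg)
  also have "\<dots> \<le> (\<integral>\<omega>. \<epsilon>\<^sup>2 \<partial>(sphere_measure :: (real ^ 'n) measure))"
    unfolding sip_def
  proof (rule integral_mono)
    show "integrable sphere_measure (\<lambda>\<omega>. g \<omega> \<bullet> g \<omega>)" by (intro integrable_sphere continuous_on_inner gc)
    show "g \<omega> \<bullet> g \<omega> \<le> \<epsilon>\<^sup>2" if "\<omega> \<in> space sphere_measure" for \<omega>
      using close[of \<omega>] that by (simp add: g_def power_mono flip: power2_norm_eq_inner)
  qed simp
  also have "\<dots> = \<epsilon>\<^sup>2 * ?m" by simp
  finally show ?thesis .
qed

text \<open>By the approximation theorem of Stone and Weierstrass the defect is small for each orthonormal set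
whose span contains the homogeneous polynomials up to a sufficiently large degree. The degree does
not depend on the choice of the orthonormal set.\<close>

lemma sphere_parseval_density:
  fixes f :: "real ^ 'n::finite \<Rightarrow> 'b::euclidean_space"
  assumes f: "sphere_cont f" and \<delta>: "\<delta> > 0"
  shows "\<exists>N. \<forall>B. sphere_orthonormal B \<longrightarrow> (\<forall>d\<le>N. \<forall>p. hpoly d p \<longrightarrow> sphere_rep B p) \<longrightarrow>
    sip f f - (\<Sum>b\<in>B. (sip f b)\<^sup>2) \<le> \<delta>"
proof -
  let ?m = "measure sphere_measure (sphere (0 :: real ^ 'n) 1)"
  define \<epsilon> where "\<epsilon> = sqrt (\<delta> / (?m + 1))"
  have m: "?m \<ge> 0" by simp
  then have m1: "?m + 1 > 0" by linarith
  have \<epsilon>: "\<epsilon> > 0" unfolding \<epsilon>_def using \<delta> m1 by (intro real_sqrt_gt_zero divide_pos_pos)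
  have "\<epsilon>\<^sup>2 * ?m \<le> \<epsilon>\<^sup>2 * (?m + 1)" by (intro mult_left_mono) auto
  also have "\<dots> = \<delta>" using \<delta> m1 less_imp_neq[OF m1] by (simp add: \<epsilon>_def less_imp_le)
  finally have \<epsilon>\<delta>: "\<epsilon>\<^sup>2 * ?m \<le> \<delta>" .
  obtain g where g: "polynomial_function g" "\<And>\<omega>. \<omega> \<in> sphere 0 1 \<Longrightarrow> norm (f \<omega> - g \<omega>) < \<epsilon>"
    using Stone_Weierstrass_polynomial_function[OF compact_sphere f \<epsilon>] by blast
  obtain N where N: "poly_sum N g" using polynomial_function_psum[OF g(1)] by blast
  show ?thesis
  proof (intro exI[of _ N] allI impI)
    fix B :: "(real ^ 'n \<Rightarrow> 'b) set"
    assume B: "sphere_orthonormal B" and *: "\<forall>d\<le>N. \<forall>p. hpoly d p \<longrightarrow> sphere_rep B p"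
    have "sphere_rep B g"
      using N *
    proof (induction rule: poly_sum.induct)
      case (poly_sum_hpoly d p N)
      then show ?case by blast
    next
      case (poly_sum_add N p q)
      then show ?case by (intro sphere_rep_add[OF B])
    qed
    then have "sip f f - (\<Sum>b\<in>B. (sip f b)\<^sup>2) \<le> \<epsilon>\<^sup>2 * ?m"
      by (rule sphere_parseval_defect[OF B f]) (use g(2) in \<open>auto simp: less_imp_le\<close>)
    then show "sip f f - (\<Sum>b\<in>B. (sip f b)\<^sup>2) \<le> \<delta>" using \<epsilon>\<delta> by linarith
  qed
qed

section \<open>Decomposition of polynomials into eigenfunctions\<close>

context clifford
begin

lemma L_norm_power:
  assumes f: "hpoly N f"
  shows "L (\<lambda>x. (norm x)\<^sup>2 *\<^sub>R f x) x = (norm x)\<^sup>2 *\<^sub>R L f x"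
proof -
  have q: "((\<lambda>x. x \<bullet> x) has_derivative (\<lambda>v. x \<bullet> v + v \<bullet> x)) (at x)"
    by (intro has_derivative_inner has_derivative_ident)
  have "(f has_derivative frechet_derivative f (at x)) (at x)"
    using hpoly_partial(4)[OF f, of x] by (simp add: frechet_derivative_works)
  from has_derivative_scaleR[OF q this]
  have "((\<lambda>x. (norm x)\<^sup>2 *\<^sub>R f x) has_derivative (\<lambda>v. (norm x)\<^sup>2 *\<^sub>R frechet_derivative f (at x) v + (x \<bullet> v + v \<bullet> x) *\<^sub>R f x)) (at x)"
    by (simp only: power2_norm_eq_inner)
  note fun_cong[OF frechet_derivative_at[OF this, symmetric]]
  then show ?thesis
    by (simp add: L_def inner_commute[of "rot_field _ _ _"] s_simps scaleR_sum_right)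
qed

text \<open>Finite sums of homogeneous polynomials of degree \<open>N\<close> that are eigenfunctions of \<open>L\<close> on
the whole space, with integer eigenvalues. The bounds on the eigenvalues keep them away from the
roots that belong to the next degrees.\<close>

inductive eigsum :: "nat \<Rightarrow> (real ^ 'n::{finite,linorder} \<Rightarrow> 'b) \<Rightarrow> bool" where
  eigsum_eig: "hpoly N f \<Longrightarrow> (\<And>x. L f x = real_of_int k *\<^sub>R f x) \<Longrightarrow> - int N \<le> k \<Longrightarrow>
     k \<le> int N + int CARD('n) - 2 \<Longrightarrow> eigsum N f"
| eigsum_add: "eigsum N f \<Longrightarrow> eigsum N g \<Longrightarrow> eigsum N (\<lambda>x. f x + g x)"

lemma eigsum_hpoly: "eigsum N f \<Longrightarrow> hpoly N f"
  by (induction rule: eigsum.induct) (auto intro: hpoly_add)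

lemma L_hpoly_scale: "hpoly N f \<Longrightarrow> L (\<lambda>x. c *\<^sub>R f x) x = c *\<^sub>R L f x"
  by (rule L_scale) (rule hpoly_partial(4))

lemma L_hpoly_add: "hpoly N f \<Longrightarrow> hpoly N g \<Longrightarrow> L (\<lambda>x. f x + g x) x = L f x + L g x"
  by (rule L_add) (auto intro: hpoly_partial(4))

lemma eigsum_scale: "eigsum N f \<Longrightarrow> eigsum N (\<lambda>x. c *\<^sub>R f x)"
proof (induction rule: eigsum.induct)
  case (eigsum_eig N f k)
  show ?case
    by (rule eigsum.eigsum_eig[OF hpoly_scale[OF eigsum_eig(1)] _ eigsum_eig(3,4)])
       (simp add: L_hpoly_scale[OF eigsum_eig(1)] eigsum_eig(2))
next
  case (eigsum_add N f g)
  then show ?case by (simp add: scaleR_add_right eigsum.eigsum_add)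
qed

text \<open>The operator \<open>(L - (N + n - 2)) (L + N)\<close>.\<close>

definition Q :: "nat \<Rightarrow> (real ^ 'n::{finite,linorder} \<Rightarrow> 'b) \<Rightarrow> real ^ 'n::{finite,linorder} \<Rightarrow> 'b" where
  "Q N f x = L (\<lambda>x. L f x + real N *\<^sub>R f x) x - real (N + CARD('n) - 2) *\<^sub>R (L f x + real N *\<^sub>R f x)"

lemma Q_expand:
  assumes f: "hpoly N f"
  shows "Q N f x = L (L f) x + real N *\<^sub>R L f x - real (N + CARD('n) - 2) *\<^sub>R (L f x + real N *\<^sub>R f x)"
  unfolding Q_def by (simp add: L_hpoly_add[OF hpoly_L[OF f] hpoly_scale[OF f]] L_hpoly_scale[OF f])

lemma Q_add:
  assumes f: "hpoly N f" and g: "hpoly N g"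
  shows "Q N (\<lambda>x. f x + g x) x = Q N f x + Q N g x"
proof -
  have "L (\<lambda>x. f x + g x) = (\<lambda>x. L f x + L g x)" by (rule ext) (rule L_hpoly_add[OF f g])
  then show ?thesis
    using L_hpoly_add[OF hpoly_L[OF f] hpoly_L[OF g], of x]
    by (simp add: Q_expand f g hpoly_add algebra_simps)
qed

lemma Q_eigen:
  assumes f: "hpoly N f" and k: "\<And>x. L f x = k *\<^sub>R f x"
  shows "Q N f x = ((k + real N) * (k - real (N + CARD('n) - 2))) *\<^sub>R f x"
proof -
  have "L f = (\<lambda>x. k *\<^sub>R f x)" by (rule ext) (rule k)
  then have "L (L f) x = k *\<^sub>R k *\<^sub>R f x" using L_hpoly_scale[OF f, of k x] k[of x] by simp
  then show ?thesis by (simp add: Q_expand[OF f] k algebra_simps)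
qed

lemma Q_dir: "hpoly N q \<Longrightarrow> N \<ge> 1 \<Longrightarrow> Q N q x = - ((norm x)\<^sup>2 *\<^sub>R dirac_op (dirac_op q) x)"
  unfolding Q_def by (rule L_quadratic)

text \<open>On an eigenfunction \<open>f\<close> of degree \<open>M\<close>, multiplied by \<open>r^2\<close>, the operator of degree
\<open>M + 2\<close> acts as a number, and the bounds on the eigenvalue show that this number is not zero.\<close>

lemma Q_solvable:
  assumes n: "CARD('n) \<ge> 2"
  shows "eigsum M g \<Longrightarrow> \<exists>h. eigsum (Suc (Suc M)) h \<and> (\<forall>x. Q (Suc (Suc M)) h x = - ((norm x)\<^sup>2 *\<^sub>R g x))"
proof (induction rule: eigsum.induct)
  case (eigsum_eig M f k)
  let ?N = "Suc (Suc M)"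
  define c where "c = (real_of_int k + real ?N) * (real_of_int k - real (?N + CARD('n) - 2))"
  have 1: "real_of_int k + real ?N > 0" using eigsum_eig(3) by linarith
  have "real_of_int k \<le> real M + real CARD('n) - 2" using eigsum_eig(4) by linarith
  then have 2: "real_of_int k - real (?N + CARD('n) - 2) < 0" by simp
  have c: "c \<noteq> 0" using 1 2 by (simp add: c_def)
  define h where "h x = (- 1 / c) *\<^sub>R (norm x)\<^sup>2 *\<^sub>R f x" for x
  have h: "hpoly ?N h" unfolding h_def by (intro hpoly_scale hpoly_norm_power eigsum_eig(1))
  have Lh: "L h x = real_of_int k *\<^sub>R h x" for x
    unfolding h_def using L_hpoly_scale[OF hpoly_norm_power[OF eigsum_eig(1)], of "- 1 / c" x]
    by (simp only: L_norm_power[OF eigsum_eig(1)] eigsum_eig(2) scaleR_left_commute)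
  have "Q ?N h x = - ((norm x)\<^sup>2 *\<^sub>R f x)" for x
  proof -
    have "Q ?N h x = c *\<^sub>R h x" using Q_eigen[OF h Lh] unfolding c_def .
    then show ?thesis using c by (simp add: h_def)
  qed
  moreover have "eigsum ?N h"
    by (rule eigsum.eigsum_eig[OF h Lh]) (use eigsum_eig(3,4) in auto)
  ultimately show ?case by blast
next
  case (eigsum_add M f g)
  then obtain h1 h2 where h: "eigsum (Suc (Suc M)) h1" "\<And>x. Q (Suc (Suc M)) h1 x = - ((norm x)\<^sup>2 *\<^sub>R f x)"
    "eigsum (Suc (Suc M)) h2" "\<And>x. Q (Suc (Suc M)) h2 x = - ((norm x)\<^sup>2 *\<^sub>R g x)" by blast
  show ?case
    by (rule exI[of _ "\<lambda>x. h1 x + h2 x"])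
       (simp add: h eigsum.eigsum_add Q_add[OF eigsum_hpoly[OF h(1)] eigsum_hpoly[OF h(3)]] scaleR_add_right)
qed

text \<open>Every homogeneous polynomial is a sum of eigenpolynomials, which replaces the spectral theorem. By
induction the polynomial of lower degree on the right-hand side of the quadratic identity is such a
sum. Subtracting a solution \<open>h\<close> of the inhomogeneous equation leaves \<open>p\<close> with
\<open>(L - c) (L + N) p = 0\<close>, where \<open>c = N + n - 2\<close>. Since \<open>c + N\<close> is positive,
\<open>p\<close> is a combination of the eigenfunctions \<open>(L + N) p\<close> and \<open>(L - c) p\<close>.\<close>

lemma hpoly_eigsum:
  assumes n: "CARD('n) \<ge> 2"
  shows "hpoly N q \<Longrightarrow> eigsum N q"
proof (induction N arbitrary: q rule: less_induct)
  case (less N)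
  note q = less.prems
  show ?case
  proof (cases "N = 0")
    case True
    then have "hpoly 0 q" using q by simp
    then have "L q x = real_of_int 0 *\<^sub>R q x" for x
      using L_hpoly_eq[of 0 q x] hpoly_dir_0[of q x] by (simp add: linear_0[OF cmul_linear])
    then show ?thesis by (rule eigsum_eig[OF q]) (use n in auto)
  next
    case False
    have "\<exists>h. eigsum N h \<and> (\<forall>x. Q N h x = - ((norm x)\<^sup>2 *\<^sub>R dirac_op (dirac_op q) x))"
    proof (cases "N = 1")
      case True
      then have "hpoly 0 (dirac_op q)" using hpoly_dir[OF q] by simp
      then have "dirac_op (dirac_op q) x = 0" for x by (rule hpoly_dir_0)
      moreover have L0: "L (\<lambda>x. 0) x = real_of_int 0 *\<^sub>R 0" for x
        using L_hpoly_scale[OF hpoly_zero, of 0 x] by simp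
      then have "eigsum N (\<lambda>x. 0)" by (rule eigsum_eig[OF hpoly_zero]) (use n in auto)
      moreover have "Q N (\<lambda>x. 0) x = 0" for x
        using Q_eigen[OF hpoly_zero, of 0 N x] L0 by simp
      ultimately show ?thesis by (intro exI[of _ "\<lambda>x. 0"]) simp
    next
      case N1: False
      have "hpoly (N - 2) (dirac_op (dirac_op q))" using hpoly_dir[OF hpoly_dir[OF q]] by (simp add: numeral_2_eq_2)
      then have "eigsum (N - 2) (dirac_op (dirac_op q))" by (rule less.IH[rotated]) (use False in simp)
      from Q_solvable[OF n this] show ?thesis using False N1 by (simp add: numeral_2_eq_2 Suc_diff_Suc)
    qed
    then obtain h where h: "eigsum N h" "\<And>x. Q N h x = - ((norm x)\<^sup>2 *\<^sub>R dirac_op (dirac_op q) x)" by blast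
    define p where "p x = q x - h x" for x
    have p: "hpoly N p" unfolding p_def by (intro hpoly_diff q eigsum_hpoly h)
    let ?c = "real (N + CARD('n) - 2)"
    have Qp: "Q N p x = 0" for x
    proof -
      have "Q N (\<lambda>x. p x + h x) x = Q N p x + Q N h x" by (rule Q_add[OF p eigsum_hpoly[OF h(1)]])
      then show ?thesis using Q_dir[OF q, of x] False h(2)[of x] by (simp add: p_def)
    qed
    have LL: "L (L p) x = - real N *\<^sub>R L p x + ?c *\<^sub>R (L p x + real N *\<^sub>R p x)" for x
      using Qp[of x] unfolding Q_expand[OF p] by (simp add: algebra_simps)
    define f1 where "f1 x = L p x + real N *\<^sub>R p x" for x
    define f2 where "f2 x = L p x + (- ?c) *\<^sub>R p x" for x
    have f1: "hpoly N f1" and f2: "hpoly N f2"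
      unfolding f1_def f2_def by (intro hpoly_add hpoly_scale hpoly_L p)+
    have "L f1 x = ?c *\<^sub>R f1 x" for x
      unfolding f1_def L_hpoly_add[OF hpoly_L[OF p] hpoly_scale[OF p]] L_hpoly_scale[OF p] LL
      by (simp add: algebra_simps)
    then have Lf1: "L f1 x = real_of_int (int (N + CARD('n) - 2)) *\<^sub>R f1 x" for x by simp
    have e1: "eigsum N f1" by (rule eigsum_eig[OF f1 Lf1]) (use n in auto)
    have "L f2 x = - real N *\<^sub>R f2 x" for x
      unfolding f2_def L_hpoly_add[OF hpoly_L[OF p] hpoly_scale[OF p]] L_hpoly_scale[OF p] LL
      by (simp add: algebra_simps)
    then have Lf2: "L f2 x = real_of_int (- int N) *\<^sub>R f2 x" for x by simp
    have e2: "eigsum N f2" by (rule eigsum_eig[OF f2 Lf2]) (use n in auto)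
    define a where "a = 1 / (?c + real N)"
    have "?c + real N > 0" using False n by simp
    have "a *\<^sub>R f1 x + (- a) *\<^sub>R f2 x = p x" for x
    proof -
      have "a *\<^sub>R f1 x + (- a) *\<^sub>R f2 x = (a * (?c + real N)) *\<^sub>R p x"
        by (simp add: f1_def f2_def algebra_simps)
      then show ?thesis using \<open>?c + real N > 0\<close> by (simp add: a_def)
    qed
    then have "(\<lambda>x. (a *\<^sub>R f1 x + (- a) *\<^sub>R f2 x) + h x) = q" by (simp add: p_def)
    moreover have "eigsum N (\<lambda>x. (a *\<^sub>R f1 x + (- a) *\<^sub>R f2 x) + h x)"
      by (intro eigsum_add eigsum_scale e1 e2 h)
    ultimately show ?thesis by (simp only:)
  qed
qed

text \<open>In degrees larger than \<open>\<bar>k\<bar>\<close> the eigenvalue \<open>k\<close> is not a root of the quadratic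
expression, so that the quadratic identity expresses \<open>f\<close> on the sphere by a polynomial of lower
degree. This is why the eigenspaces are finite-dimensional.\<close>

lemma hpoly_eigen_reduce:
  assumes n: "CARD('n) \<ge> 2" and f: "hpoly N f" and k: "\<And>x. L f x = real_of_int k *\<^sub>R f x" and N: "int N > \<bar>k\<bar>"
  shows "\<exists>g. hpoly (N - 2) g \<and> (\<forall>x. norm x = 1 \<longrightarrow> f x = g x)"
proof -
  define c where "c = (real_of_int k + real N) * (real_of_int k - real (N + CARD('n) - 2))"
  have "real_of_int k + real N > 0" "real_of_int k - real (N + CARD('n) - 2) < 0"
    using N n by linarith+
  then have c: "c \<noteq> 0" by (simp add: c_def)
  have "N \<ge> 1" using N by linarith
  have "c *\<^sub>R f x = - ((norm x)\<^sup>2 *\<^sub>R dirac_op (dirac_op f) x)" for x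
    using Q_eigen[OF f k, of x] Q_dir[OF f \<open>N \<ge> 1\<close>, of x] by (simp add: c_def)
  then have "f x = (- 1 / c) *\<^sub>R dirac_op (dirac_op f) x" if "norm x = 1" for x
  proof -
    assume *: "\<And>x. c *\<^sub>R f x = - ((norm x)\<^sup>2 *\<^sub>R dirac_op (dirac_op f) x)"
    have "f x = (1 / c) *\<^sub>R c *\<^sub>R f x" using c by simp
    also have "\<dots> = (- 1 / c) *\<^sub>R dirac_op (dirac_op f) x" by (simp only: *) (simp add: that)
    finally show ?thesis .
  qed
  moreover have "hpoly (N - 2) (\<lambda>x. (- 1 / c) *\<^sub>R dirac_op (dirac_op f) x)"
    using hpoly_scale[OF hpoly_dir[OF hpoly_dir[OF f]], of "- 1 / c"] by (simp add: numeral_2_eq_2)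
  ultimately show ?thesis by blast
qed

end


section \<open>Eigenspaces on the sphere\<close>

context clifford
begin

text \<open>The eigenspace of \<open>L\<close> on the sphere. Its elements vanish off the sphere, so that an equality
on the sphere is an equality of functions.\<close>

definition E :: "int \<Rightarrow> (real ^ 'n::{finite,linorder} \<Rightarrow> 'b) set" where
  "E k = {\<phi>. (\<forall>x. x \<notin> sphere 0 1 \<longrightarrow> \<phi> x = 0) \<and>
         smooth_on (\<lambda>x. \<phi> (x /\<^sub>R norm x)) (- {0}) \<and>
         (\<forall>\<omega>\<in>sphere 0 1. L (\<lambda>x. \<phi> (x /\<^sub>R norm x)) \<omega> = of_int k *\<^sub>R \<phi> \<omega>)}"

lemma E_props:
  assumes "\<phi> \<in> E k"
  shows "norm x \<noteq> 1 \<Longrightarrow> \<phi> x = 0"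
    and "Ck_on m (\<lambda>x. \<phi> (x /\<^sub>R norm x)) (- {0})"
    and "norm \<omega> = 1 \<Longrightarrow> L (\<lambda>x. \<phi> (x /\<^sub>R norm x)) \<omega> = of_int k *\<^sub>R \<phi> \<omega>"
  using assms unfolding E_def smooth_on_def by simp_all

lemma E_intro:
  assumes "\<And>x. norm x \<noteq> 1 \<Longrightarrow> \<phi> x = 0" "\<And>m. Ck_on m (\<lambda>x. \<phi> (x /\<^sub>R norm x)) (- {0})"
    "\<And>\<omega>. norm \<omega> = 1 \<Longrightarrow> L (\<lambda>x. \<phi> (x /\<^sub>R norm x)) \<omega> = of_int k *\<^sub>R \<phi> \<omega>"
  shows "\<phi> \<in> E k"
  using assms unfolding E_def smooth_on_def by simp

lemma E_differentiable:
  assumes "\<phi> \<in> E k" "norm \<omega> = 1"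
  shows "(\<lambda>x. \<phi> (x /\<^sub>R norm x)) differentiable (at \<omega>)"
proof -
  have "\<omega> \<in> - {0}" using assms(2) by force
  then show ?thesis using E_props(2)[OF assms(1), of "Suc 0"] by simp
qed

lemma E_sphere_cont: assumes "\<phi> \<in> E k" shows "sphere_cont \<phi>"
proof -
  have "continuous_on (- {0}) (\<lambda>x. \<phi> (x /\<^sub>R norm x))" using E_props(2)[OF assms, of 0] by simp
  then have "continuous_on (sphere 0 1) (\<lambda>x. \<phi> (x /\<^sub>R norm x))" by (rule continuous_on_subset) auto
  moreover have "\<phi> (x /\<^sub>R norm x) = \<phi> x" if "x \<in> sphere 0 1" for x using that by simp
  ultimately show ?thesis using continuous_on_cong[of "sphere 0 1" "sphere 0 1" "\<lambda>x. \<phi> (x /\<^sub>R norm x)" \<phi>] by blast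
qed

lemma E_add: assumes "\<phi> \<in> E k" "\<psi> \<in> E k" shows "(\<lambda>x. \<phi> x + \<psi> x) \<in> E k"
proof (rule E_intro)
  show "\<phi> x + \<psi> x = 0" if "norm x \<noteq> 1" for x using E_props(1)[OF assms(1) that] E_props(1)[OF assms(2) that] by simp
  show "Ck_on m (\<lambda>x. \<phi> (x /\<^sub>R norm x) + \<psi> (x /\<^sub>R norm x)) (- {0})" for m
    by (intro Ck_on_add E_props(2)[OF assms(1)] E_props(2)[OF assms(2)]) auto
  show "L (\<lambda>x. \<phi> (x /\<^sub>R norm x) + \<psi> (x /\<^sub>R norm x)) \<omega> = of_int k *\<^sub>R (\<phi> \<omega> + \<psi> \<omega>)" if "norm \<omega> = 1" for \<omega>
    using L_add[OF E_differentiable[OF assms(1) that] E_differentiable[OF assms(2) that]]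
    by (simp only: E_props(3)[OF assms(1) that] E_props(3)[OF assms(2) that] scaleR_add_right)
qed

lemma E_scale: assumes "\<phi> \<in> E k" shows "(\<lambda>x. c *\<^sub>R \<phi> x) \<in> E k"
proof (rule E_intro)
  show "c *\<^sub>R \<phi> x = 0" if "norm x \<noteq> 1" for x using E_props(1)[OF assms that] by simp
  show "Ck_on m (\<lambda>x. c *\<^sub>R \<phi> (x /\<^sub>R norm x)) (- {0})" for m
    by (rule Ck_on_bounded_linear[OF bounded_linear_scaleR_right _ E_props(2)[OF assms]]) auto
  show "L (\<lambda>x. c *\<^sub>R \<phi> (x /\<^sub>R norm x)) \<omega> = of_int k *\<^sub>R c *\<^sub>R \<phi> \<omega>" if "norm \<omega> = 1" for \<omega>
    using L_scale[OF E_differentiable[OF assms that], of c]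
    by (simp only: E_props(3)[OF assms that] scaleR_left_commute)
qed

lemma E_zero: "(\<lambda>x. 0) \<in> E k"
proof (rule E_intro)
  show "L (\<lambda>x. 0) \<omega> = of_int k *\<^sub>R 0" for \<omega>
    using L_hpoly_scale[OF hpoly_zero, of 0 \<omega>] by simp
  show "Ck_on m (\<lambda>x::real ^ 'n::{finite,linorder}. 0) (- {0})" for m by (rule Ck_on_const) auto
qed simp

lemma E_sum: "finite A \<Longrightarrow> A \<subseteq> E k \<Longrightarrow> (\<lambda>x. \<Sum>b\<in>A. c b *\<^sub>R b x) \<in> E k"
proof (induction A rule: finite_induct)
  case (insert a A)
  have "(\<lambda>x. c a *\<^sub>R a x + (\<Sum>b\<in>A. c b *\<^sub>R b x)) \<in> E k"
    by (intro E_add E_scale) (use insert in auto)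
  then show ?case using insert.hyps by simp
qed (simp add: E_zero)

lemma E_diff: assumes "\<phi> \<in> E k" "\<psi> \<in> E k" shows "(\<lambda>x. \<phi> x - \<psi> x) \<in> E k"
  using E_add[OF assms(1) E_scale[OF assms(2), of "-1"]] by simp

lemma E_sip_L:
  assumes f: "Ck_on (Suc 0) f (- {0})" and \<phi>: "\<phi> \<in> E k"
  shows "(\<integral>\<omega>. L f \<omega> \<bullet> \<phi> \<omega> \<partial>sphere_measure) = of_int k * sip f \<phi>"
proof -
  have "(\<integral>\<omega>. L f \<omega> \<bullet> \<phi> \<omega> \<partial>sphere_measure) = (\<integral>\<omega>. L f \<omega> \<bullet> \<phi> (\<omega> /\<^sub>R norm \<omega>) \<partial>sphere_measure)"
    by (rule Bochner_Integration.integral_cong) simp_all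
  also have "\<dots> = (\<integral>\<omega>. f \<omega> \<bullet> L (\<lambda>x. \<phi> (x /\<^sub>R norm x)) \<omega> \<partial>sphere_measure)"
    by (rule L_symmetric[OF f E_props(2)[OF \<phi>]])
  also have "\<dots> = (\<integral>\<omega>. of_int k * (f \<omega> \<bullet> \<phi> \<omega>) \<partial>sphere_measure)"
    by (rule Bochner_Integration.integral_cong) (simp_all add: E_props(3)[OF \<phi>])
  finally show ?thesis by (simp add: sip_def)
qed

lemma E_orthogonal:
  assumes \<phi>: "\<phi> \<in> E k" and \<psi>: "\<psi> \<in> E l" and "k \<noteq> l"
  shows "sip \<phi> \<psi> = 0"
proof -
  let ?f = "\<lambda>x. \<phi> (x /\<^sub>R norm x)"
  have "(\<integral>\<omega>. L ?f \<omega> \<bullet> \<psi> \<omega> \<partial>sphere_measure) = (\<integral>\<omega>. of_int k * (\<phi> \<omega> \<bullet> \<psi> \<omega>) \<partial>sphere_measure)"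
    by (rule Bochner_Integration.integral_cong) (simp_all add: E_props(3)[OF \<phi>])
  moreover have "sip ?f \<psi> = sip \<phi> \<psi>" by (rule sip_cong) simp_all
  ultimately have "real_of_int k * sip \<phi> \<psi> = real_of_int l * sip \<phi> \<psi>"
    using E_sip_L[OF E_props(2)[OF \<phi>] \<psi>] by (auto simp: sip_def)
  then show ?thesis using \<open>k \<noteq> l\<close> by auto
qed

lemma E_restrict:
  assumes f: "hpoly N f" and k: "\<And>x. L f x = of_int k *\<^sub>R f x"
  shows "(\<lambda>x. if norm x = 1 then f x else 0) \<in> E k"
proof (rule E_intro)
  let ?\<phi> = "\<lambda>x. if norm x = 1 then f x else 0"
  have eq: "?\<phi> (x /\<^sub>R norm x) = f (x /\<^sub>R norm x)" if "x \<in> - {0}" for x using that by simp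
  have op: "open (- {0 :: real ^ 'n::{finite,linorder}})" by auto
  show "Ck_on m (\<lambda>x. ?\<phi> (x /\<^sub>R norm x)) (- {0})" for m
    by (rule iffD2[OF Ck_on_cong[OF op eq] Ck_on_hpoly_direction[OF f]])
  show "L (\<lambda>x. ?\<phi> (x /\<^sub>R norm x)) \<omega> = of_int k *\<^sub>R ?\<phi> \<omega>" if "norm \<omega> = 1" for \<omega>
  proof -
    have "\<omega> \<in> - {0}" using that by force
    have "frechet_derivative (\<lambda>x. ?\<phi> (x /\<^sub>R norm x)) (at \<omega>) = frechet_derivative (\<lambda>x. f (x /\<^sub>R norm x)) (at \<omega>)"
      by (rule frechet_derivative_cong_open[OF op \<open>\<omega> \<in> - {0}\<close>]) (rule eq)
    then have "L (\<lambda>x. ?\<phi> (x /\<^sub>R norm x)) \<omega> = L (\<lambda>x. f (x /\<^sub>R norm x)) \<omega>"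
      by (simp only: L_def)
    also have "\<dots> = L f \<omega>" by (rule L_cong_direction[OF Ck_on_hpoly[OF f op] that])
    finally show ?thesis using that k by simp
  qed
qed simp

definition eigen_orthonormal :: "(real ^ 'n::{finite,linorder} \<Rightarrow> 'b) set \<Rightarrow> bool" where
  "eigen_orthonormal B \<longleftrightarrow> sphere_orthonormal B \<and> (\<forall>b\<in>B. \<exists>k. b \<in> E k)"

text \<open>One step of the Gram-Schmidt process. Elements of \<open>B\<close> with another eigenvalue are already
orthogonal to \<open>f\<close>, so the residual stays in the eigenspace of \<open>f\<close>.\<close>

lemma eigen_orthonormal_extend:
  assumes B: "eigen_orthonormal B" and f: "f \<in> E k"
  shows "\<exists>B'. B \<subseteq> B' \<and> eigen_orthonormal B' \<and> sphere_rep B' f"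
proof -
  have on: "sphere_orthonormal B" using B by (simp add: eigen_orthonormal_def)
  note D = sphere_orthonormalD[OF on]
  note fc = E_sphere_cont[OF f]
  define r where "r x = f x - sproj B f x" for x
  have "sproj B f x = (\<Sum>b\<in>B \<inter> E k. sip f b *\<^sub>R b x)" for x
    unfolding sproj_def
  proof (rule sum.mono_neutral_right)
    show "\<forall>b\<in>B - B \<inter> E k. sip f b *\<^sub>R b x = 0"
    proof
      fix b assume b: "b \<in> B - B \<inter> E k"
      then obtain l where l: "b \<in> E l" using B by (auto simp: eigen_orthonormal_def)
      with b have "k \<noteq> l" by auto
      then show "sip f b *\<^sub>R b x = 0" using E_orthogonal[OF f l] by simp
    qed
  qed (use D(1) in auto)
  then have "r = (\<lambda>x. f x - (\<Sum>b\<in>B \<inter> E k. sip f b *\<^sub>R b x))" by (simp add: r_def fun_eq_iff)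
  moreover have "(\<lambda>x. \<Sum>b\<in>B \<inter> E k. sip f b *\<^sub>R b x) \<in> E k"
    by (rule E_sum) (use D(1) in auto)
  ultimately have r: "r \<in> E k" using E_diff[OF f] by simp
  have r0: "sip r b = 0" if "b \<in> B" for b
    using sip_residual(2)[OF on fc that] unfolding r_def .
  have fr: "sip f r = sip r r" using sip_residual(4)[OF on fc] unfolding r_def .
  show ?thesis
  proof (cases "sip r r = 0")
    case True
    have "f \<omega> = sproj B f \<omega>" if "norm \<omega> = 1" for \<omega>
      using sip_eq_0_imp[OF E_sphere_cont[OF r] True that] by (simp add: r_def)
    then show ?thesis using B fc by (auto simp: sphere_rep_def)
  next
    case False
    then have pos: "sip r r > 0" using sip_nonneg[of r] by simp
    define c where "c = sqrt (sip r r)"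
    have c: "c > 0" "c * c = sip r r" using pos by (auto simp: c_def)
    define e where "e x = (1 / c) *\<^sub>R r x" for x
    have e: "e \<in> E k" unfolding e_def by (rule E_scale[OF r])
    have eb: "sip e b = 0" if "b \<in> B" for b
      unfolding e_def sip_scale_left using r0[OF that] by simp
    have fe: "sip f e = c"
      unfolding sip_commute[of f e] e_def sip_scale_left sip_commute[of r f] fr using c by (simp add: field_simps)
    have ee: "sip e e = 1"
    proof -
      have "sip e e = (1 / c) * ((1 / c) * sip r r)"
        unfolding e_def[abs_def] by (simp only: sip_scale_left sip_commute[of r "\<lambda>x. (1 / c) *\<^sub>R r x"])
      then show ?thesis using c pos by (simp add: field_simps)
    qed
    have "e \<notin> B" using eb ee by force
    have on': "sphere_orthonormal (insert e B)"
      unfolding sphere_orthonormal_def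
    proof (intro conjI ballI)
      show "sphere_cont b" if "b \<in> insert e B" for b using that D(2) E_sphere_cont[OF e] by auto
      fix b b' assume b: "b \<in> insert e B" "b' \<in> insert e B"
      show "sip b b' = (if b = b' then 1 else 0)"
      proof (cases "b = e"; cases "b' = e")
        assume "b = e" "b' \<noteq> e"
        then show ?thesis using eb[of b'] b by auto
      next
        assume "b \<noteq> e" "b' = e"
        then show ?thesis using eb[of b] b sip_commute[of b e] by auto
      next
        assume "b \<noteq> e" "b' \<noteq> e"
        then show ?thesis using D(3)[of b b'] b by auto
      qed (use ee in simp)
    qed (use D(1) in simp)
    have "sproj (insert e B) f \<omega> = sip f e *\<^sub>R e \<omega> + sproj B f \<omega>" for \<omega>
      unfolding sproj_def using D(1) \<open>e \<notin> B\<close> by simp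
    moreover have "sip f e *\<^sub>R e \<omega> = r \<omega>" for \<omega> unfolding fe using c by (simp add: e_def)
    ultimately have "sphere_rep (insert e B) f"
      using fc by (simp add: sphere_rep_def r_def)
    moreover have "eigen_orthonormal (insert e B)"
      using B on' e by (auto simp: eigen_orthonormal_def)
    ultimately show ?thesis by blast
  qed
qed

lemma eigsum_extend:
  "eigsum d f \<Longrightarrow> eigen_orthonormal B \<Longrightarrow> \<exists>B'. B \<subseteq> B' \<and> eigen_orthonormal B' \<and> sphere_rep B' f"
proof (induction arbitrary: B rule: eigsum.induct)
  case (eigsum_eig N f k)
  obtain B' where "B \<subseteq> B'" "eigen_orthonormal B'" "sphere_rep B' (\<lambda>x. if norm x = 1 then f x else 0)"
    using eigen_orthonormal_extend[OF eigsum_eig.prems E_restrict[OF eigsum_eig.hyps(1,2)]] by blast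
  moreover from this(3) have "sphere_rep B' f" by (rule sphere_rep_cong) simp
  ultimately show ?case by blast
next
  case (eigsum_add N f g)
  obtain B1 where B1: "B \<subseteq> B1" "eigen_orthonormal B1" "sphere_rep B1 f"
    using eigsum_add.IH(1)[OF eigsum_add.prems] by blast
  obtain B2 where B2: "B1 \<subseteq> B2" "eigen_orthonormal B2" "sphere_rep B2 g"
    using eigsum_add.IH(2)[OF B1(2)] by blast
  have on: "sphere_orthonormal B1" "sphere_orthonormal B2"
    using B1 B2 by (auto simp: eigen_orthonormal_def)
  have "sphere_rep B2 (\<lambda>x. f x + g x)"
    by (rule sphere_rep_add[OF on(2) sphere_rep_mono[OF on B2(1) B1(3)] B2(3)])
  then show ?case using B1(1) B2(1,2) by blast
qed

lemma eigen_orthonormal_finite: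
  assumes n: "CARD('n) \<ge> 2"
  shows "finite F \<Longrightarrow> \<forall>f\<in>F. \<exists>d. hpoly d f \<Longrightarrow> \<exists>B. eigen_orthonormal B \<and> (\<forall>f\<in>F. sphere_rep B f)"
proof (induction F rule: finite_induct)
  case empty
  have "eigen_orthonormal {}" by (simp add: eigen_orthonormal_def sphere_orthonormal_def)
  then show ?case by blast
next
  case (insert f F)
  then obtain B where B: "eigen_orthonormal B" "\<And>f. f \<in> F \<Longrightarrow> sphere_rep B f" by blast
  obtain d where "hpoly d f" using insert.prems by blast
  from eigsum_extend[OF hpoly_eigsum[OF n this] B(1)] obtain B' where
    B': "B \<subseteq> B'" "eigen_orthonormal B'" "sphere_rep B' f" by blast
  have on: "sphere_orthonormal B" "sphere_orthonormal B'"
    using B(1) B'(2) by (auto simp: eigen_orthonormal_def)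
  have "sphere_rep B' g" if "g \<in> F" for g by (rule sphere_rep_mono[OF on B'(1) B(2)[OF that]])
  then show ?case using B' by blast
qed

lemma eigenbasis_exists:
  assumes n: "CARD('n) \<ge> 2"
  shows "\<exists>B. eigen_orthonormal B \<and> (\<forall>d\<le>N. \<forall>p. hpoly d p \<longrightarrow> sphere_rep B p)"
proof -
  have "\<forall>d. \<exists>F :: (real ^ 'n::{finite,linorder} \<Rightarrow> 'b) set. finite F \<and> (\<forall>f\<in>F. hpoly d f) \<and>
     (\<forall>p P. hpoly d p \<longrightarrow> (\<forall>f\<in>F. P f) \<longrightarrow> (\<forall>f g. P f \<longrightarrow> P g \<longrightarrow> P (\<lambda>x. f x + g x)) \<longrightarrow>
        (\<forall>c f. P f \<longrightarrow> P (\<lambda>x. c *\<^sub>R f x)) \<longrightarrow> P p)"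
    using hpoly_finitely_generated by blast
  from choice[OF this] obtain F :: "nat \<Rightarrow> (real ^ 'n::{finite,linorder} \<Rightarrow> 'b) set"
    where F: "\<forall>d. finite (F d) \<and> (\<forall>f\<in>F d. hpoly d f) \<and>
     (\<forall>p P. hpoly d p \<longrightarrow> (\<forall>f\<in>F d. P f) \<longrightarrow> (\<forall>f g. P f \<longrightarrow> P g \<longrightarrow> P (\<lambda>x. f x + g x)) \<longrightarrow>
        (\<forall>c f. P f \<longrightarrow> P (\<lambda>x. c *\<^sub>R f x)) \<longrightarrow> P p)" ..
  note F1 = F[THEN spec, THEN conjunct1] and F2 = F[THEN spec, THEN conjunct2, THEN conjunct1, THEN bspec]
  have "finite (\<Union>d\<le>N. F d)" using F1 by simp
  moreover have "\<forall>f\<in>(\<Union>d\<le>N. F d). \<exists>d. hpoly d f"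
  proof
    fix f assume "f \<in> (\<Union>d\<le>N. F d)"
    then obtain d where "f \<in> F d" by auto
    then show "\<exists>d. hpoly d f" using F2 by (intro exI)
  qed
  ultimately have "\<exists>B. eigen_orthonormal B \<and> (\<forall>f\<in>(\<Union>d\<le>N. F d). sphere_rep B f)"
    by (rule eigen_orthonormal_finite[OF n])
  then obtain B where B: "eigen_orthonormal B"
    and BF: "\<forall>f\<in>(\<Union>d\<le>N. F d). sphere_rep B f" by blast
  have on: "sphere_orthonormal B" using B by (simp add: eigen_orthonormal_def)
  have "sphere_rep B p" if "d \<le> N" "hpoly d p" for d and p :: "real ^ 'n::{finite,linorder} \<Rightarrow> 'b"
  proof (rule F[THEN spec[of _ d], THEN conjunct2, THEN conjunct2, THEN spec[of _ p], THEN spec[of _ "sphere_rep B"],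
        THEN mp, THEN mp, THEN mp, THEN mp])
    show "hpoly d p" by (rule that(2))
    show "\<forall>f\<in>F d. sphere_rep B f" using BF that(1) by auto
    show "\<forall>f g. sphere_rep B f \<longrightarrow> sphere_rep B g \<longrightarrow> sphere_rep B (\<lambda>x. f x + g x)"
      by (intro allI impI sphere_rep_add[OF on])
    show "\<forall>c f. sphere_rep B f \<longrightarrow> sphere_rep B (\<lambda>x. c *\<^sub>R f x)"
      by (intro allI impI sphere_rep_scale)
  qed
  then show ?thesis using B by (intro exI[of _ B] conjI allI impI)
qed

text \<open>An eigenfunction that is orthogonal to the polynomials of degree at most \<open>\<bar>j\<bar>\<close> is
orthogonal to all polynomials: of an eigenpolynomial of higher degree only the eigenvalue \<open>j\<close>
matters, and then it agrees on the sphere with a polynomial of lower degree. Density of the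
polynomials finishes the argument.\<close>

lemma E_determined_by_low_degrees:
  assumes n: "CARD('n) \<ge> 2" and \<phi>: "\<phi> \<in> E j"
    and low: "\<And>d p. int d \<le> \<bar>j\<bar> \<Longrightarrow> hpoly d p \<Longrightarrow> sip \<phi> p = 0"
  shows "\<phi> x = 0"
proof -
  note \<phi>c = E_sphere_cont[OF \<phi>]
  have pc: "sphere_cont p" if "hpoly d p" for d p
  proof -
    have "continuous_on UNIV p" using Ck_on_hpoly[OF that, of UNIV 0] by simp
    then show ?thesis by (rule continuous_on_subset) auto
  qed
  have all: "hpoly N p \<Longrightarrow> sip \<phi> p = 0" for N p
  proof (induction N arbitrary: p rule: less_induct)
    case (less N)
    show ?case
    proof (cases "int N \<le> \<bar>j\<bar>")
      case True
      then show ?thesis using low less.prems by blast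
    next
      case False
      have "eigsum M f \<Longrightarrow> M = N \<Longrightarrow> sip \<phi> f = 0" for M f
      proof (induction rule: eigsum.induct)
        case (eigsum_eig M f k)
        show ?case
        proof (cases "k = j")
          case True
          have Lf: "L f x = real_of_int j *\<^sub>R f x" for x using eigsum_eig.hyps(2) True by simp
          obtain g where g: "hpoly (M - 2) g" "\<And>x. norm x = 1 \<Longrightarrow> f x = g x"
            using hpoly_eigen_reduce[OF n eigsum_eig.hyps(1) Lf] False eigsum_eig.prems by auto
          have "M - 2 < N" using False eigsum_eig.prems by auto
          then have "sip \<phi> g = 0" using less.IH g(1) by blast
          moreover have "sip \<phi> f = sip \<phi> g" by (rule sip_cong) (simp_all add: g(2))
          ultimately show ?thesis by simp
        next
          case kj: False
          have op: "open (- {0 :: real ^ 'n::{finite,linorder}})" by auto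
          have "(\<integral>\<omega>. L f \<omega> \<bullet> \<phi> \<omega> \<partial>sphere_measure) = of_int j * sip f \<phi>"
            by (rule E_sip_L[OF Ck_on_hpoly[OF eigsum_eig.hyps(1) op] \<phi>])
          then have "real_of_int k * sip f \<phi> = real_of_int j * sip f \<phi>"
            by (simp add: eigsum_eig.hyps(2) sip_def)
          then show ?thesis using kj sip_commute[of f \<phi>] by simp
        qed
      next
        case (eigsum_add M f g)
        have "sip (\<lambda>x. f x + g x) \<phi> = sip f \<phi> + sip g \<phi>"
          by (rule sip_add_left[OF pc[OF eigsum_hpoly] pc[OF eigsum_hpoly] \<phi>c]) (rule eigsum_add.hyps)+
        then show ?case using eigsum_add by (simp add: sip_commute[of \<phi>])
      qed
      from this[OF hpoly_eigsum[OF n less.prems]] show ?thesis by simp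
    qed
  qed
  have allp: "sphere_cont p \<and> sip p \<phi> = 0" if "poly_sum N p" for N p
    using that
  proof (induction rule: poly_sum.induct)
    case (poly_sum_hpoly d p N)
    then show ?case using pc all sip_commute[of p \<phi>] by auto
  next
    case (poly_sum_add N p q)
    then show ?case using sip_add_left[of p q \<phi>] \<phi>c by (auto intro: continuous_on_add)
  qed
  let ?m = "measure sphere_measure (sphere (0 :: real ^ 'n::{finite,linorder}) 1)"
  have small: "sip \<phi> \<phi> \<le> \<epsilon>\<^sup>2 * ?m" if \<epsilon>: "\<epsilon> > 0" for \<epsilon>
  proof -
    obtain g where g: "polynomial_function g" "\<And>\<omega>. \<omega> \<in> sphere 0 1 \<Longrightarrow> norm (\<phi> \<omega> - g \<omega>) < \<epsilon>"
      using Stone_Weierstrass_polynomial_function[OF compact_sphere \<phi>c \<epsilon>] by blast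
    obtain N where "poly_sum N g" using polynomial_function_psum[OF g(1)] by blast
    with allp have gc: "sphere_cont g" and g\<phi>: "sip g \<phi> = 0" by auto
    let ?h = "\<lambda>x. \<phi> x - g x"
    have hc: "sphere_cont ?h" by (intro continuous_on_diff \<phi>c gc)
    have "sip ?h ?h = sip \<phi> ?h - sip g ?h" by (rule sip_diff_left[OF \<phi>c gc hc])
    also have "sip \<phi> ?h = sip \<phi> \<phi> - sip g \<phi>" by (subst sip_commute) (rule sip_diff_left[OF \<phi>c gc \<phi>c])
    also have "sip g ?h = sip \<phi> g - sip g g" by (subst sip_commute) (rule sip_diff_left[OF \<phi>c gc gc])
    finally have "sip \<phi> \<phi> \<le> sip ?h ?h" using g\<phi> sip_nonneg[of g] sip_commute[of g \<phi>] by simp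
    also have "sip ?h ?h - (\<Sum>b\<in>{}. (sip ?h b)\<^sup>2) \<le> \<epsilon>\<^sup>2 * ?m"
    proof (rule sphere_parseval_defect[OF _ hc, where p = "\<lambda>_. 0"])
      show "sphere_orthonormal {}" by (simp add: sphere_orthonormal_def)
      show "sphere_rep {} (\<lambda>_. 0)" by (simp add: sphere_rep_def sproj_def)
      show "norm (?h \<omega> - 0) \<le> \<epsilon>" if "norm \<omega> = 1" for \<omega> using g(2)[of \<omega>] that by simp
    qed
    then have "sip ?h ?h \<le> \<epsilon>\<^sup>2 * ?m" by simp
    finally show ?thesis .
  qed
  have "sip \<phi> \<phi> \<le> 0"
  proof (rule ccontr)
    assume "\<not> sip \<phi> \<phi> \<le> 0"
    then have pos: "sip \<phi> \<phi> > 0" by simp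
    have False if "0 < x" "0 \<le> m" "\<And>\<epsilon>. \<epsilon> > 0 \<Longrightarrow> x \<le> \<epsilon>\<^sup>2 * m" for x m :: real
    proof -
      have m1: "m + 1 > 0" using that(2) by linarith
      have "sqrt (x / (m + 1)) > 0" using that(1) m1 by (intro real_sqrt_gt_zero divide_pos_pos)
      from that(3)[OF this] have "x \<le> x / (m + 1) * m" using that(1) m1 by simp
      then have "x * (m + 1) \<le> x * m" using m1 by (simp add: field_simps)
      then show False using that(1) by (simp add: distrib_left)
    qed
    from this[OF pos _ small] show False by simp
  qed
  then have "sip \<phi> \<phi> = 0" using sip_nonneg[of \<phi>] by simp
  then show ?thesis using sip_eq_0_imp[OF \<phi>c] E_props(1)[OF \<phi>] by (cases "norm x = 1") auto
qed

text \<open>Finite dimension of the eigenspace is what makes the pointwise projection in the definition of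
\<open>P_j\<close> exist.\<close>

lemma E_finite_orthonormal_basis:
  assumes n: "CARD('n) \<ge> 2"
  shows "\<exists>B. sphere_orthonormal B \<and> B \<subseteq> E j \<and> (\<forall>\<phi>\<in>E j. \<phi> = sproj B \<phi>)"
proof -
  obtain B where B: "eigen_orthonormal B" and rep: "\<And>d p. d \<le> nat \<bar>j\<bar> \<Longrightarrow> hpoly d p \<Longrightarrow> sphere_rep B p"
    using eigenbasis_exists[OF n, of "nat \<bar>j\<bar>"] by blast
  have on: "sphere_orthonormal B" using B by (simp add: eigen_orthonormal_def)
  let ?B = "B \<inter> E j"
  have on': "sphere_orthonormal ?B" using on by (auto simp: sphere_orthonormal_def)
  have "\<phi> = sproj ?B \<phi>" if \<phi>: "\<phi> \<in> E j" for \<phi>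
  proof -
    note \<phi>c = E_sphere_cont[OF \<phi>]
    define r where "r x = \<phi> x - sproj ?B \<phi> x" for x
    have "sproj ?B \<phi> \<in> E j" unfolding sproj_def[abs_def]
      by (rule E_sum) (use sphere_orthonormalD(1)[OF on'] in auto)
    then have r: "r \<in> E j" unfolding r_def by (rule E_diff[OF \<phi>])
    have rb: "sip r b = 0" if b: "b \<in> B" for b
    proof (cases "b \<in> E j")
      case True
      then show ?thesis using sip_residual(2)[OF on' \<phi>c, of b] b unfolding r_def by simp
    next
      case False
      obtain l where "b \<in> E l" using B b by (auto simp: eigen_orthonormal_def)
      then show ?thesis using E_orthogonal[OF r] False by metis
    qed
    have "r x = 0" for x
    proof (rule E_determined_by_low_degrees[OF n r])
      fix d and p :: "real ^ 'n::{finite,linorder} \<Rightarrow> 'b" assume "int d \<le> \<bar>j\<bar>" "hpoly d p"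
      then have p: "sphere_rep B p" by (intro rep) auto
      have "sip r p = sip (sproj B p) r"
        unfolding sip_commute[of r p] by (rule sip_cong) (use p in \<open>auto simp: sphere_rep_def\<close>)
      also have "\<dots> = (\<Sum>b\<in>B. sip p b * sip r b)" by (rule sip_sproj_left[OF on E_sphere_cont[OF r]])
      also have "\<dots> = 0" by (rule sum.neutral) (simp add: rb)
      finally show "sip r p = 0" .
    qed
    then show ?thesis by (simp add: r_def fun_eq_iff)
  qed
  then show ?thesis using on' by blast
qed

end

section \<open>Weighted inequalities on the half-line\<close>

text \<open>The form in which integration by parts is used: a pointwise inequality that holds up to the
derivative of a function with equal boundary values.\<close>

lemma integral_ge_of_derivative:
  fixes F P G G' :: "real \<Rightarrow> real"
  assumes pq: "p \<le> q" and F: "continuous_on {p..q} F" and P: "continuous_on {p..q} P"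
    and G: "\<And>r. r \<in> {p..q} \<Longrightarrow> (G has_real_derivative G' r) (at r)" and eq: "G p = G q"
    and le: "\<And>r. r \<in> {p..q} \<Longrightarrow> P r + G' r \<le> F r"
  shows "integral {p..q} P \<le> integral {p..q} F"
proof -
  have "(G' has_integral (G q - G p)) {p..q}"
    by (rule fundamental_theorem_of_calculus[OF pq])
       (use G in \<open>auto simp: has_real_derivative_iff_has_vector_derivative[symmetric] intro: has_field_derivative_at_within\<close>)
  then have "(G' has_integral 0) {p..q}" using eq by simp
  moreover have "(P has_integral integral {p..q} P) {p..q}" "(F has_integral integral {p..q} F) {p..q}"
    using F P by (auto intro!: integrable_integral integrable_continuous_real)
  ultimately have "((\<lambda>r. P r + G' r) has_integral (integral {p..q} P + 0)) {p..q}"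
    by (intro has_integral_add)
  from has_integral_le[OF this \<open>(F has_integral _) _\<close>] le show ?thesis by simp
qed

text \<open>The difference of the two sides is the square \<open>r (V - W / (2 m r))^2\<close>.\<close>

lemma hardy_pointwise:
  fixes W V r m :: real
  assumes "r > 0" "m > 0"
  shows "W\<^sup>2 / (4 * m\<^sup>2 * r) + (W * V / m - W\<^sup>2 / (2 * m\<^sup>2 * r)) \<le> r * V\<^sup>2"
proof -
  have "r * V\<^sup>2 - (W\<^sup>2 / (4 * m\<^sup>2 * r) + (W * V / m - W\<^sup>2 / (2 * m\<^sup>2 * r))) = r * (V - W / (2 * m * r))\<^sup>2"
    using assms by (simp add: field_simps power2_eq_square)
  also have "\<dots> \<ge> 0" using assms by simp
  finally show ?thesis by simp
qed

lemma weight_nonzero: "0 < r \<Longrightarrow> 0 < k \<Longrightarrow> k * (1 + \<bar>x\<bar>)\<^sup>2 * r \<noteq> (0::real)"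
  using abs_ge_zero[of x] by simp

text \<open>The inequality of Hardy in the variable \<open>ln r\<close>, starting from a zero of \<open>W\<close> at the
left end. The bracket in the pointwise inequality is the derivative of
\<open>W^2 / (2 (1 + ln r - ln p))\<close>.\<close>

lemma hardy_right:
  fixes W V :: "real \<Rightarrow> real"
  assumes p: "0 < p" "p \<le> q" and W: "\<And>r. r \<in> {p..q} \<Longrightarrow> (W has_real_derivative V r) (at r)"
    and V: "continuous_on {p..q} V" and 0: "W p = 0" "W q = 0"
  shows "integral {p..q} (\<lambda>r. (W r)\<^sup>2 / (4 * (1 + \<bar>ln r - ln p\<bar>)\<^sup>2 * r)) \<le> integral {p..q} (\<lambda>r. r * (V r)\<^sup>2)"
proof (rule integral_ge_of_derivative[where G = "\<lambda>r. (W r)\<^sup>2 / (2 * (1 + (ln r - ln p)))" and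
      G' = "\<lambda>r. W r * V r / (1 + (ln r - ln p)) - (W r)\<^sup>2 / (2 * (1 + (ln r - ln p))\<^sup>2 * r)"])
  have Wc: "continuous_on {p..q} W"
    by (intro continuous_at_imp_continuous_on ballI DERIV_isCont[OF W])
  show "continuous_on {p..q} (\<lambda>r. (W r)\<^sup>2 / (4 * (1 + \<bar>ln r - ln p\<bar>)\<^sup>2 * r))"
    by (intro continuous_intros Wc ballI weight_nonzero) (use p in auto)
  show "continuous_on {p..q} (\<lambda>r. r * (V r)\<^sup>2)" by (intro continuous_intros V)
  fix r assume r: "r \<in> {p..q}"
  then have rp: "r > 0" and s: "ln r - ln p \<ge> 0" using p by auto
  define m where "m = 1 + (ln r - ln p)"
  have m: "m > 0" using s by (simp add: m_def)
  have "((\<lambda>r. 2 * (1 + (ln r - ln p))) has_real_derivative 2 * (1 / r)) (at r)"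
    using rp by (auto intro!: derivative_eq_intros)
  from DERIV_divide[OF DERIV_power[OF W[OF r], of 2] this]
  have "((\<lambda>r. (W r)\<^sup>2 / (2 * (1 + (ln r - ln p)))) has_real_derivative
     ((of_nat 2 * (V r * W r ^ (2 - Suc 0))) * (2 * m) - (W r)\<^sup>2 * (2 * (1 / r))) / (2 * m * (2 * m))) (at r)"
    using m unfolding m_def by simp
  moreover have "((of_nat 2 * (V r * W r ^ (2 - Suc 0))) * (2 * m) - (W r)\<^sup>2 * (2 * (1 / r))) / (2 * m * (2 * m))
     = W r * V r / m - (W r)\<^sup>2 / (2 * m\<^sup>2 * r)"
    using m rp by (simp add: field_simps power2_eq_square)
  ultimately show "((\<lambda>r. (W r)\<^sup>2 / (2 * (1 + (ln r - ln p)))) has_real_derivative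
     W r * V r / (1 + (ln r - ln p)) - (W r)\<^sup>2 / (2 * (1 + (ln r - ln p))\<^sup>2 * r)) (at r)"
    by (simp only: m_def)
  show "(W r)\<^sup>2 / (4 * (1 + \<bar>ln r - ln p\<bar>)\<^sup>2 * r) +
      (W r * V r / (1 + (ln r - ln p)) - (W r)\<^sup>2 / (2 * (1 + (ln r - ln p))\<^sup>2 * r)) \<le> r * (V r)\<^sup>2"
    using hardy_pointwise[OF rp m, of "W r" "V r"] s by (simp only: m_def abs_of_nonneg)
qed (use p 0 in auto)

lemma hardy_left:
  fixes W V :: "real \<Rightarrow> real"
  assumes p: "0 < p" "p \<le> q" and W: "\<And>r. r \<in> {p..q} \<Longrightarrow> (W has_real_derivative V r) (at r)"
    and V: "continuous_on {p..q} V" and 0: "W p = 0" "W q = 0"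
  shows "integral {p..q} (\<lambda>r. (W r)\<^sup>2 / (4 * (1 + \<bar>ln r - ln q\<bar>)\<^sup>2 * r)) \<le> integral {p..q} (\<lambda>r. r * (V r)\<^sup>2)"
proof (rule integral_ge_of_derivative[where G = "\<lambda>r. - ((W r)\<^sup>2 / (2 * (1 + (ln q - ln r))))" and
      G' = "\<lambda>r. - (W r * V r / (1 + (ln q - ln r)) + (W r)\<^sup>2 / (2 * (1 + (ln q - ln r))\<^sup>2 * r))"])
  have Wc: "continuous_on {p..q} W"
    by (intro continuous_at_imp_continuous_on ballI DERIV_isCont[OF W])
  show "continuous_on {p..q} (\<lambda>r. (W r)\<^sup>2 / (4 * (1 + \<bar>ln r - ln q\<bar>)\<^sup>2 * r))"
    by (intro continuous_intros Wc ballI weight_nonzero) (use p in auto)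
  show "continuous_on {p..q} (\<lambda>r. r * (V r)\<^sup>2)" by (intro continuous_intros V)
  fix r assume r: "r \<in> {p..q}"
  then have rp: "r > 0" and s: "ln q - ln r \<ge> 0" using p by auto
  define m where "m = 1 + (ln q - ln r)"
  have m: "m > 0" using s by (simp add: m_def)
  have "((\<lambda>r. 2 * (1 + (ln q - ln r))) has_real_derivative 2 * (- (1 / r))) (at r)"
    using rp by (auto intro!: derivative_eq_intros)
  from DERIV_minus[OF DERIV_divide[OF DERIV_power[OF W[OF r], of 2] this]]
  have "((\<lambda>r. - ((W r)\<^sup>2 / (2 * (1 + (ln q - ln r))))) has_real_derivative
     - (((of_nat 2 * (V r * W r ^ (2 - Suc 0))) * (2 * m) - (W r)\<^sup>2 * (2 * (- (1 / r)))) / (2 * m * (2 * m)))) (at r)"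
    using m unfolding m_def by simp
  moreover have "- (((of_nat 2 * (V r * W r ^ (2 - Suc 0))) * (2 * m) - (W r)\<^sup>2 * (2 * (- (1 / r)))) / (2 * m * (2 * m)))
     = - (W r * V r / m + (W r)\<^sup>2 / (2 * m\<^sup>2 * r))"
    using m rp by (simp add: field_simps power2_eq_square)
  ultimately show "((\<lambda>r. - ((W r)\<^sup>2 / (2 * (1 + (ln q - ln r))))) has_real_derivative
     - (W r * V r / (1 + (ln q - ln r)) + (W r)\<^sup>2 / (2 * (1 + (ln q - ln r))\<^sup>2 * r))) (at r)"
    by (simp only: m_def)
  have "\<bar>ln r - ln q\<bar> = ln q - ln r" using s by simp
  then show "(W r)\<^sup>2 / (4 * (1 + \<bar>ln r - ln q\<bar>)\<^sup>2 * r) +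
      - (W r * V r / (1 + (ln q - ln r)) + (W r)\<^sup>2 / (2 * (1 + (ln q - ln r))\<^sup>2 * r)) \<le> r * (V r)\<^sup>2"
    using hardy_pointwise[OF rp m, of "W r" "- V r"] by (simp add: m_def)
qed (use p 0 in auto)

text \<open>For \<open>\<bar>\<alpha>\<bar> \<ge> 1\<close> no logarithm is needed: the mixed term of the square is the derivative of
\<open>\<alpha> W^2\<close> and the remaining term \<open>\<alpha>^2 W^2 / r\<close> is already large enough.\<close>

lemma radial_nonresonant:
  fixes W V :: "real \<Rightarrow> real"
  assumes ab: "0 < a" "a \<le> b" and W: "\<And>r. r \<in> {a..b} \<Longrightarrow> (W has_real_derivative V r) (at r)"
    and V: "continuous_on {a..b} V" and W0: "W a = 0" "W b = 0" and \<alpha>: "1 \<le> \<bar>\<alpha>\<bar>"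
  shows "integral {a..b} (\<lambda>r. (W r)\<^sup>2 / (16 * (1 + \<bar>ln r\<bar>)\<^sup>2 * r)) \<le>
    integral {a..b} (\<lambda>r. (r * V r + \<alpha> * W r)\<^sup>2 / r)"
proof (rule integral_ge_of_derivative[where G = "\<lambda>r. \<alpha> * (W r)\<^sup>2" and G' = "\<lambda>r. \<alpha> * (2 * V r * W r)"])
  have Wc: "continuous_on {a..b} W"
    by (intro continuous_at_imp_continuous_on ballI DERIV_isCont[OF W])
  show "continuous_on {a..b} (\<lambda>r. (r * V r + \<alpha> * W r)\<^sup>2 / r)"
    by (intro continuous_intros V Wc) (use ab in auto)
  show "continuous_on {a..b} (\<lambda>r. (W r)\<^sup>2 / (16 * (1 + \<bar>ln r\<bar>)\<^sup>2 * r))"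
    by (intro continuous_intros Wc ballI weight_nonzero) (use ab in auto)
  fix r assume r: "r \<in> {a..b}"
  then have rp: "r > 0" using ab by auto
  show "((\<lambda>r. \<alpha> * (W r)\<^sup>2) has_real_derivative \<alpha> * (2 * V r * W r)) (at r)"
    using DERIV_cmult[OF DERIV_power[OF W[OF r], of 2], of \<alpha>] by (simp add: mult.assoc)
  have "1 \<le> \<alpha>\<^sup>2" using \<alpha> power_mono[of 1 "\<bar>\<alpha>\<bar>" 2] by simp
  have "1 \<le> (1 + \<bar>ln r\<bar>)\<^sup>2" by (rule one_le_power) simp
  then have "1 \<le> 16 * (1 + \<bar>ln r\<bar>)\<^sup>2" by linarith
  then have "1 * r \<le> 16 * (1 + \<bar>ln r\<bar>)\<^sup>2 * r" using rp by (intro mult_right_mono) auto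
  then have "(W r)\<^sup>2 / (16 * (1 + \<bar>ln r\<bar>)\<^sup>2 * r) \<le> (W r)\<^sup>2 / r"
    by (intro frac_le) (use rp in auto)
  also have "\<dots> \<le> \<alpha>\<^sup>2 * (W r)\<^sup>2 / r"
    using rp \<open>1 \<le> \<alpha>\<^sup>2\<close> mult_right_mono[of 1 "\<alpha>\<^sup>2" "(W r)\<^sup>2"] by (intro divide_right_mono) auto
  finally have 1: "(W r)\<^sup>2 / (16 * (1 + \<bar>ln r\<bar>)\<^sup>2 * r) \<le> \<alpha>\<^sup>2 * (W r)\<^sup>2 / r" .
  have 2: "(r * v + \<alpha> * w)\<^sup>2 / r = r * v\<^sup>2 + \<alpha> * (2 * v * w) + \<alpha>\<^sup>2 * w\<^sup>2 / r" for v w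
    using rp by (simp add: field_simps power2_eq_square)
  have "r * (V r)\<^sup>2 \<ge> 0" using rp by simp
  then show "(W r)\<^sup>2 / (16 * (1 + \<bar>ln r\<bar>)\<^sup>2 * r) + \<alpha> * (2 * V r * W r) \<le> (r * V r + \<alpha> * W r)\<^sup>2 / r"
    unfolding 2 using 1 by linarith
qed (use ab W0 in auto)

text \<open>At the zero \<open>r0\<close> the interval is split, and the inequality of Hardy is used on both sides. The
zero lies between 1 and 2 and \<open>ln 2 \<le> 1\<close>, so replacing \<open>ln r - ln r0\<close> by \<open>ln r\<close>
costs a factor of at most 2 in the weight, which gives the constant 1/16.\<close>

lemma radial_resonant:
  fixes W V :: "real \<Rightarrow> real"
  assumes ab: "0 < a" "a \<le> 1" "2 \<le> b" and W: "\<And>r. r \<in> {a..b} \<Longrightarrow> (W has_real_derivative V r) (at r)"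
    and V: "continuous_on {a..b} V" and W0: "W a = 0" "W b = 0" and r0: "r0 \<in> {1..2}" "W r0 = 0"
  shows "integral {a..b} (\<lambda>r. (W r)\<^sup>2 / (16 * (1 + \<bar>ln r\<bar>)\<^sup>2 * r)) \<le> integral {a..b} (\<lambda>r. r * (V r)\<^sup>2)"
proof -
  have Wc: "continuous_on {a..b} W"
    by (intro continuous_at_imp_continuous_on ballI DERIV_isCont[OF W])
  have r0ab: "a \<le> r0" "r0 \<le> b" "0 < r0" using r0 ab by auto
  have "continuous_on {a..b} (\<lambda>r. (W r)\<^sup>2 / (16 * (1 + \<bar>ln r\<bar>)\<^sup>2 * r))"
    by (intro continuous_intros Wc ballI weight_nonzero) (use ab in auto)
  note int1 = integrable_continuous_real[OF this]
  have "continuous_on {a..b} (\<lambda>r. (W r)\<^sup>2 / (4 * (1 + \<bar>ln r - ln r0\<bar>)\<^sup>2 * r))"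
    by (intro continuous_intros Wc ballI weight_nonzero) (use ab in auto)
  note int2 = integrable_continuous_real[OF this]
  have "continuous_on {a..b} (\<lambda>r. r * (V r)\<^sup>2)" by (intro continuous_intros V)
  note int3 = integrable_continuous_real[OF this]
  have "integral {a..b} (\<lambda>r. (W r)\<^sup>2 / (16 * (1 + \<bar>ln r\<bar>)\<^sup>2 * r)) \<le>
      integral {a..b} (\<lambda>r. (W r)\<^sup>2 / (4 * (1 + \<bar>ln r - ln r0\<bar>)\<^sup>2 * r))"
  proof (rule integral_le[OF int1 int2])
    fix r assume "r \<in> {a..b}"
    then have rp: "r > 0" using ab by auto
    have "0 \<le> ln r0" "ln r0 \<le> ln 2" using r0 by auto
    moreover have "ln 2 \<le> (1::real)" using ln_le_minus_one[of 2] by simp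
    ultimately have "\<bar>ln r0\<bar> \<le> 1" by simp
    then have "1 + \<bar>ln r - ln r0\<bar> \<le> 2 * (1 + \<bar>ln r\<bar>)"
      using abs_triangle_ineq4[of "ln r" "ln r0"] abs_ge_zero[of "ln r"] unfolding distrib_left by linarith
    then have "(1 + \<bar>ln r - ln r0\<bar>)\<^sup>2 \<le> (2 * (1 + \<bar>ln r\<bar>))\<^sup>2" by (rule power_mono) simp
    also have "\<dots> = 4 * (1 + \<bar>ln r\<bar>)\<^sup>2" by (simp only: power_mult_distrib) simp
    finally have "4 * (1 + \<bar>ln r - ln r0\<bar>)\<^sup>2 \<le> 16 * (1 + \<bar>ln r\<bar>)\<^sup>2" by linarith
    then have le: "4 * (1 + \<bar>ln r - ln r0\<bar>)\<^sup>2 * r \<le> 16 * (1 + \<bar>ln r\<bar>)\<^sup>2 * r"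
      by (rule mult_right_mono) (use rp in simp)
    have "0 \<le> 4 * (1 + \<bar>ln r - ln r0\<bar>)\<^sup>2 * r" using rp by simp
    then have "0 < 4 * (1 + \<bar>ln r - ln r0\<bar>)\<^sup>2 * r"
      using weight_nonzero[OF rp, of 4 "ln r - ln r0"] by linarith
    then show "(W r)\<^sup>2 / (16 * (1 + \<bar>ln r\<bar>)\<^sup>2 * r) \<le> (W r)\<^sup>2 / (4 * (1 + \<bar>ln r - ln r0\<bar>)\<^sup>2 * r)"
      by (intro frac_le le) auto
  qed
  also have "\<dots> = integral {a..r0} (\<lambda>r. (W r)\<^sup>2 / (4 * (1 + \<bar>ln r - ln r0\<bar>)\<^sup>2 * r)) +
      integral {r0..b} (\<lambda>r. (W r)\<^sup>2 / (4 * (1 + \<bar>ln r - ln r0\<bar>)\<^sup>2 * r))"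
    by (rule Henstock_Kurzweil_Integration.integral_combine[OF r0ab(1,2) int2, symmetric])
  also have "\<dots> \<le> integral {a..r0} (\<lambda>r. r * (V r)\<^sup>2) + integral {r0..b} (\<lambda>r. r * (V r)\<^sup>2)"
  proof (rule add_mono)
    show "integral {a..r0} (\<lambda>r. (W r)\<^sup>2 / (4 * (1 + \<bar>ln r - ln r0\<bar>)\<^sup>2 * r)) \<le> integral {a..r0} (\<lambda>r. r * (V r)\<^sup>2)"
    proof (rule hardy_left[OF ab(1) r0ab(1) W])
      show "continuous_on {a..r0} V" by (rule continuous_on_subset[OF V]) (use r0ab in auto)
    qed (use r0ab r0 W0 in auto)
    show "integral {r0..b} (\<lambda>r. (W r)\<^sup>2 / (4 * (1 + \<bar>ln r - ln r0\<bar>)\<^sup>2 * r)) \<le> integral {r0..b} (\<lambda>r. r * (V r)\<^sup>2)"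
    proof (rule hardy_right[OF r0ab(3,2) W])
      show "continuous_on {r0..b} V" by (rule continuous_on_subset[OF V]) (use r0ab in auto)
    qed (use r0ab r0 W0 in auto)
  qed
  also have "\<dots> = integral {a..b} (\<lambda>r. r * (V r)\<^sup>2)"
    by (rule Henstock_Kurzweil_Integration.integral_combine[OF r0ab(1,2) int3])
  finally show ?thesis .
qed

text \<open>The substitution \<open>W = r^\<tau> c\<close> removes the power weight and shifts \<open>\<kappa>\<close> to \<open>\<kappa> - \<tau>\<close>,
which separates the two cases above.\<close>

lemma radial_inequality:
  fixes c c' :: "real \<Rightarrow> real" and \<tau> \<kappa> :: real
  assumes ab: "0 < a" "a \<le> 1" "2 \<le> b"
    and c: "\<And>r. r \<in> {a..b} \<Longrightarrow> (c has_real_derivative c' r) (at r)" and c': "continuous_on {a..b} c'"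
    and c0: "c a = 0" "c b = 0"
    and \<kappa>: "\<bar>\<kappa> - \<tau>\<bar> \<ge> 1 \<or> (\<kappa> = \<tau> \<and> (\<exists>r\<in>{1..2}. c r = 0))"
  shows "integral {a..b} (\<lambda>r. r powr (2 * \<tau> - 1) * (1 + \<bar>ln r\<bar>) powr (-2) * (c r)\<^sup>2) / 16 \<le>
    integral {a..b} (\<lambda>r. r powr (2 * \<tau> - 1) * (r * c' r + \<kappa> * c r)\<^sup>2)"
proof -
  define W where "W r = r powr \<tau> * c r" for r
  define V where "V r = r powr \<tau> * c' r + (\<tau> * r powr (\<tau> - 1)) * c r" for r
  have pos: "0 < r" if "r \<in> {a..b}" for r using that ab by auto
  have cc: "continuous_on {a..b} c"
    by (intro continuous_at_imp_continuous_on ballI DERIV_isCont[OF c])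
  have pc: "continuous_on {a..b} (\<lambda>r. r powr p)" for p
    by (intro continuous_at_imp_continuous_on ballI DERIV_isCont[OF has_real_derivative_powr[OF pos]])
  have W: "(W has_real_derivative V r) (at r)" if "r \<in> {a..b}" for r
    unfolding W_def V_def by (rule DERIV_mult'[OF has_real_derivative_powr[OF pos[OF that]] c[OF that]])
  have V: "continuous_on {a..b} V"
    unfolding V_def by (intro continuous_on_add continuous_on_mult continuous_on_const pc cc c')
  have W0: "W a = 0" "W b = 0" using c0 by (auto simp: W_def)
  have sq: "r powr (2 * \<tau> - 1) = (r powr \<tau>)\<^sup>2 / r" if "r > 0" for r
  proof -
    have "2 * \<tau> - 1 = (\<tau> + \<tau>) - 1" by simp
    then have "r powr (2 * \<tau> - 1) = r powr \<tau> * r powr \<tau> / r powr 1"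
      by (simp only: powr_diff powr_add)
    then show ?thesis using that by (simp add: power2_eq_square)
  qed
  have L1: "r powr (2 * \<tau> - 1) * (r * c' r + \<kappa> * c r)\<^sup>2 = (r * V r + (\<kappa> - \<tau>) * W r)\<^sup>2 / r" if "r > 0" for r
  proof -
    have gen: "r * (A * x + \<tau> * (A / r) * y) + (\<kappa> - \<tau>) * (A * y) = A * (r * x + \<kappa> * y)" for A x y
      using that by (simp add: field_simps)
    have "r powr (\<tau> - 1) = r powr \<tau> / r" using that by (simp add: powr_diff)
    then have "r * V r + (\<kappa> - \<tau>) * W r = r powr \<tau> * (r * c' r + \<kappa> * c r)"
      unfolding V_def W_def by (simp only: gen)
    then show ?thesis by (simp add: sq[OF that] power_mult_distrib)
  qed
  have R1: "r powr (2 * \<tau> - 1) * (1 + \<bar>ln r\<bar>) powr (-2) * (c r)\<^sup>2 / 16 = (W r)\<^sup>2 / (16 * (1 + \<bar>ln r\<bar>)\<^sup>2 * r)"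
    if "r > 0" for r
  proof -
    have gen: "A\<^sup>2 / r * (1 / m\<^sup>2) * y\<^sup>2 / 16 = (A * y)\<^sup>2 / (16 * m\<^sup>2 * r)" for A m y :: real
      by (simp add: power_mult_distrib)
    have "(1 + \<bar>ln r\<bar>) powr (-2) = 1 / (1 + \<bar>ln r\<bar>)\<^sup>2"
      using powr_numeral[of "1 + \<bar>ln r\<bar>" "num.Bit0 num.One"] by (simp add: powr_minus_divide)
    then show ?thesis unfolding sq[OF that] W_def by (simp only: gen)
  qed
  have "integral {a..b} (\<lambda>r. r powr (2 * \<tau> - 1) * (1 + \<bar>ln r\<bar>) powr (-2) * (c r)\<^sup>2) / 16 =
      integral {a..b} (\<lambda>r. r powr (2 * \<tau> - 1) * (1 + \<bar>ln r\<bar>) powr (-2) * (c r)\<^sup>2 / 16)" by simp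
  also have "\<dots> = integral {a..b} (\<lambda>r. (W r)\<^sup>2 / (16 * (1 + \<bar>ln r\<bar>)\<^sup>2 * r))"
    by (rule Henstock_Kurzweil_Integration.integral_cong) (rule R1[OF pos])
  also have "\<dots> \<le> integral {a..b} (\<lambda>r. (r * V r + (\<kappa> - \<tau>) * W r)\<^sup>2 / r)"
  proof (cases "\<bar>\<kappa> - \<tau>\<bar> \<ge> 1")
    case True
    show ?thesis by (rule radial_nonresonant[OF ab(1) _ W V W0 True]) (use ab in auto)
  next
    case False
    then obtain r0 where r0: "r0 \<in> {1..2}" "c r0 = 0" and eq: "\<kappa> = \<tau>" using \<kappa> by auto
    have "W r0 = 0" using r0 by (simp add: W_def)
    from radial_resonant[OF ab W V W0 r0(1) this]
    have "integral {a..b} (\<lambda>r. (W r)\<^sup>2 / (16 * (1 + \<bar>ln r\<bar>)\<^sup>2 * r)) \<le> integral {a..b} (\<lambda>r. r * (V r)\<^sup>2)" .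
    also have "\<dots> = integral {a..b} (\<lambda>r. (r * V r + (\<kappa> - \<tau>) * W r)\<^sup>2 / r)"
    proof (rule Henstock_Kurzweil_Integration.integral_cong)
      fix r assume "r \<in> {a..b}"
      then show "r * (V r)\<^sup>2 = (r * V r + (\<kappa> - \<tau>) * W r)\<^sup>2 / r" using pos[of r] eq by (simp add: power2_eq_square)
    qed
    finally show ?thesis .
  qed
  also have "\<dots> = integral {a..b} (\<lambda>r. r powr (2 * \<tau> - 1) * (r * c' r + \<kappa> * c r)\<^sup>2)"
    by (rule Henstock_Kurzweil_Integration.integral_cong) (rule L1[OF pos, symmetric])
  finally show ?thesis .
qed


section \<open>The weighted inequality in a Clifford module\<close>

context clifford
begin

lemma continuous_on_derivative_along:
  fixes u :: "real ^ 'n::{finite,linorder} \<Rightarrow> 'b"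
  assumes u: "Ck_on (Suc 0) u UNIV" and h: "continuous_on X h" and g: "continuous_on X g"
  shows "continuous_on X (\<lambda>p. frechet_derivative u (at (g p)) (h p))"
  by (rule continuous_on_frechet_derivative[OF u g _ h]) simp

lemma continuous_on_dir: "Ck_on (Suc 0) u UNIV \<Longrightarrow> continuous_on UNIV (dirac_op u)"
  unfolding dirac_op_def[abs_def]
  using lin by (intro continuous_on_sum bounded_linear.continuous_on[of "s _"] continuous_on_derivative_along continuous_intros)
     (simp_all add: linear_conv_bounded_linear)

lemma s_s_bounded_linear: "bounded_linear (\<lambda>v. s i (s l v))"
  using lin by (intro bounded_linear_compose[of "s i" "s l"]) (simp_all add: linear_conv_bounded_linear)

lemma coefficient_derivative:
  fixes u :: "real ^ 'n::{finite,linorder} \<Rightarrow> 'b"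
  assumes u: "Ck_on (Suc 0) u UNIV" and \<phi>: "sphere_cont \<phi>" and r: "r > 0"
  shows "((\<lambda>r. sip (\<lambda>\<omega>. u (r *\<^sub>R \<omega>)) \<phi>) has_real_derivative
    sip (\<lambda>\<omega>. frechet_derivative u (at (r *\<^sub>R \<omega>)) \<omega>) \<phi>) (at r)"
proof -
  interpret finite_measure "sphere_measure :: (real ^ 'n::{finite,linorder}) measure"
    by (rule finite_measure_sphere_measure)
  have uc: "continuous_on UNIV u" using Ck_on_SucD[OF u] by simp
  let ?F = "\<lambda>t \<omega>. u (t *\<^sub>R \<omega>) \<bullet> \<phi> \<omega>"
  let ?F' = "\<lambda>t \<omega>. frechet_derivative u (at (t *\<^sub>R \<omega>)) \<omega> \<bullet> \<phi> \<omega>"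
  have "continuous_on ({0..r + 1} \<times> sphere 0 1) (\<lambda>p. ?F' (fst p) (snd p))"
  proof (intro continuous_on_inner continuous_on_derivative_along[OF u] continuous_on_scaleR continuous_on_fst continuous_on_snd continuous_on_id)
    show "continuous_on ({0..r + 1} \<times> sphere 0 1) (\<lambda>p. \<phi> (snd p))"
      by (rule continuous_on_compose2[OF \<phi>]) (auto intro: continuous_on_snd continuous_on_id)
  qed
  then have "compact ((\<lambda>p. ?F' (fst p) (snd p)) ` ({0..r + 1} \<times> sphere 0 1))"
    by (rule compact_continuous_image) (intro compact_Times compact_Icc compact_sphere)
  then have "bounded ((\<lambda>p. ?F' (fst p) (snd p)) ` ({0..r + 1} \<times> sphere 0 1))" by (rule compact_imp_bounded)
  then obtain K where K: "\<forall>x\<in>(\<lambda>p. ?F' (fst p) (snd p)) ` ({0..r + 1} \<times> sphere 0 1). norm x \<le> K"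
    unfolding bounded_iff by blast
  have "((\<lambda>t. \<integral>\<omega>. ?F t \<omega> \<partial>sphere_measure) has_real_derivative (\<integral>\<omega>. ?F' r \<omega> \<partial>sphere_measure)) (at r)"
  proof (rule leibniz_integral[where a = 0 and b = "r + 1" and w = "\<lambda>_. K"])
    show "integrable sphere_measure (?F t)" for t
    proof (intro integrable_sphere continuous_on_inner \<phi>)
      show "continuous_on (sphere 0 1) (\<lambda>\<omega>. u (t *\<^sub>R \<omega>))"
        by (rule continuous_on_compose2[OF uc]) (auto intro!: continuous_intros)
    qed
    show "?F' r \<in> borel_measurable sphere_measure"
      by (intro borel_measurable_sphere continuous_on_inner \<phi> continuous_on_derivative_along[OF u] continuous_on_scaleR
          continuous_on_const continuous_on_id)
    fix t and \<omega> :: "real ^ 'n::{finite,linorder}"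
    assume t: "t \<in> {0<..<r + 1}" and \<omega>: "\<omega> \<in> space sphere_measure"
    have "(u has_derivative frechet_derivative u (at (t *\<^sub>R \<omega>))) (at (t *\<^sub>R \<omega>))"
      by (rule Ck_on_Suc_derivative[OF u]) simp
    then have "((\<lambda>t. u (t *\<^sub>R \<omega>)) has_derivative (\<lambda>h. frechet_derivative u (at (t *\<^sub>R \<omega>)) (h *\<^sub>R \<omega>))) (at t)"
      by (rule has_derivative_compose[where f = "\<lambda>t. t *\<^sub>R \<omega>" and f' = "\<lambda>h. h *\<^sub>R \<omega>" and g = u, rotated])
         (simp add: bounded_linear_imp_has_derivative bounded_linear_scaleR_left)
    then have "((\<lambda>t. ?F t \<omega>) has_derivative (\<lambda>h. frechet_derivative u (at (t *\<^sub>R \<omega>)) (h *\<^sub>R \<omega>) \<bullet> \<phi> \<omega>)) (at t)"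
      by (rule bounded_linear.has_derivative[OF bounded_linear_inner_left])
    moreover have "linear (frechet_derivative u (at (t *\<^sub>R \<omega>)))"
      using Ck_on_Suc_derivative[OF u, of "t *\<^sub>R \<omega>"] by (auto intro: has_derivative_linear)
    ultimately show "((\<lambda>t. ?F t \<omega>) has_real_derivative ?F' t \<omega>) (at t)"
      by (simp add: has_field_derivative_def linear_scale mult_commute_abs)
    have "norm (?F' (fst (t, \<omega>)) (snd (t, \<omega>))) \<le> K"
      by (rule K[rule_format, OF imageI]) (use t \<omega> in simp)
    then show "\<bar>?F' t \<omega>\<bar> \<le> K" by simp
  qed (use r in auto)
  then show ?thesis by (simp add: sip_def)
qed

text \<open>Taking Fourier coefficients turns \<open>r \<partial>_r + L\<close> into the ordinary differential operator
\<open>r d/dr + k\<close>, because \<open>L\<close> is symmetric.\<close>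

lemma cmul_dir_coefficient:
  fixes u :: "real ^ 'n::{finite,linorder} \<Rightarrow> 'b"
  assumes u: "Ck_on (Suc 0) u UNIV" and \<phi>: "\<phi> \<in> E k"
  shows "sip (\<lambda>\<omega>. cmul (r *\<^sub>R \<omega>) (dirac_op u (r *\<^sub>R \<omega>))) \<phi> =
    r * sip (\<lambda>\<omega>. frechet_derivative u (at (r *\<^sub>R \<omega>)) \<omega>) \<phi> + of_int k * sip (\<lambda>\<omega>. u (r *\<^sub>R \<omega>)) \<phi>"
proof -
  note \<phi>c = E_sphere_cont[OF \<phi>]
  let ?v = "\<lambda>x. u (r *\<^sub>R x)"
  have diff: "u differentiable (at x)" for x using u by simp
  have vd: "(?v has_derivative (\<lambda>h. frechet_derivative u (at (r *\<^sub>R x)) (r *\<^sub>R h))) (at x)" for x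
  proof -
    have "(u has_derivative frechet_derivative u (at (r *\<^sub>R x))) (at (r *\<^sub>R x))"
      by (rule Ck_on_Suc_derivative[OF u]) simp
    then show ?thesis
      by (rule has_derivative_compose[where f = "\<lambda>x. r *\<^sub>R x" and f' = "\<lambda>x. r *\<^sub>R x" and g = u, rotated])
         (simp add: bounded_linear_imp_has_derivative bounded_linear_scaleR_right)
  qed
  have v: "Ck_on (Suc 0) ?v (- {0})"
    by (rule Ck_on_SucI[OF _ vd])
       (auto intro!: continuous_on_derivative_along[OF u] continuous_intros)
  have Lv: "L ?v \<omega> = L u (r *\<^sub>R \<omega>)" for \<omega>
    unfolding L_def frechet_derivative_at[OF vd, symmetric] by (simp add: rot_field_def scaleR_diff_right)
  have lin: "linear (frechet_derivative u (at x))" for x by (rule linear_frechet_derivative[OF diff])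
  have eq: "cmul (r *\<^sub>R \<omega>) (dirac_op u (r *\<^sub>R \<omega>)) = r *\<^sub>R frechet_derivative u (at (r *\<^sub>R \<omega>)) \<omega> + L ?v \<omega>" for \<omega>
    unfolding cmul_dir[OF diff] Lv by (simp add: linear_scale[OF lin])
  have c1: "sphere_cont (\<lambda>\<omega>. frechet_derivative u (at (r *\<^sub>R \<omega>)) \<omega>)"
    by (intro continuous_on_derivative_along[OF u] continuous_intros)
  have c2: "sphere_cont (\<lambda>\<omega>. L ?v \<omega>)"
    unfolding Lv L_def rot_field_def
    by (intro continuous_on_sum bounded_linear.continuous_on[OF s_s_bounded_linear] continuous_on_derivative_along[OF u] continuous_intros)
  have "sip (\<lambda>\<omega>. cmul (r *\<^sub>R \<omega>) (dirac_op u (r *\<^sub>R \<omega>))) \<phi> =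
      sip (\<lambda>\<omega>. r *\<^sub>R frechet_derivative u (at (r *\<^sub>R \<omega>)) \<omega>) \<phi> + sip (L ?v) \<phi>"
    unfolding eq by (rule sip_add_left[OF continuous_on_scaleR[OF continuous_on_const c1] c2 \<phi>c])
  also have "sip (L ?v) \<phi> = of_int k * sip ?v \<phi>"
    using E_sip_L[OF v \<phi>] by (simp add: sip_def)
  finally show ?thesis by (simp only: sip_scale_left)
qed

lemma continuous_on_coefficient:
  fixes F :: "real \<Rightarrow> real ^ 'n::{finite,linorder} \<Rightarrow> 'b"
  assumes F: "continuous_on UNIV (\<lambda>p. F (fst p) (snd p))" and \<phi>: "sphere_cont \<phi>"
  shows "continuous_on {a..b} (\<lambda>r. sip (F r) \<phi>)"
  unfolding sip_def
proof (rule continuous_on_sphere_integral)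
  show "continuous_on ({a..b} \<times> sphere 0 1) (\<lambda>p. F (fst p) (snd p) \<bullet> \<phi> (snd p))"
  proof (rule continuous_on_inner)
    show "continuous_on ({a..b} \<times> sphere 0 1) (\<lambda>p. F (fst p) (snd p))" by (rule continuous_on_subset[OF F]) simp
    show "continuous_on ({a..b} \<times> sphere 0 1) (\<lambda>p. \<phi> (snd p))"
      by (rule continuous_on_compose2[OF \<phi>]) (auto intro: continuous_on_snd continuous_on_id)
  qed
qed

lemma mode_inequality:
  fixes u :: "real ^ 'n::{finite,linorder} \<Rightarrow> 'b"
  assumes u: "Ck_on (Suc 0) u UNIV" and ab: "0 < a" "a \<le> 1" "2 \<le> b"
    and vanish: "\<And>x. norm x = a \<or> norm x = b \<Longrightarrow> u x = 0"
    and \<phi>: "\<phi> \<in> E k" and res: "k = j \<Longrightarrow> \<exists>r\<in>{1..2}. sip (\<lambda>\<omega>. u (r *\<^sub>R \<omega>)) \<phi> = 0"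
  shows "integral {a..b} (\<lambda>r. r powr (2 * real_of_int j - 1) * (1 + \<bar>ln r\<bar>) powr (-2) * (sip (\<lambda>\<omega>. u (r *\<^sub>R \<omega>)) \<phi>)\<^sup>2) / 16 \<le>
    integral {a..b} (\<lambda>r. r powr (2 * real_of_int j - 1) * (sip (\<lambda>\<omega>. cmul (r *\<^sub>R \<omega>) (dirac_op u (r *\<^sub>R \<omega>))) \<phi>)\<^sup>2)"
  unfolding cmul_dir_coefficient[OF u \<phi>]
proof (rule radial_inequality[OF ab])
  note \<phi>c = E_sphere_cont[OF \<phi>]
  show "((\<lambda>r. sip (\<lambda>\<omega>. u (r *\<^sub>R \<omega>)) \<phi>) has_real_derivative
      sip (\<lambda>\<omega>. frechet_derivative u (at (r *\<^sub>R \<omega>)) \<omega>) \<phi>) (at r)" if "r \<in> {a..b}" for r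
    by (rule coefficient_derivative[OF u \<phi>c]) (use that ab in auto)
  show "continuous_on {a..b} (\<lambda>r. sip (\<lambda>\<omega>. frechet_derivative u (at (r *\<^sub>R \<omega>)) \<omega>) \<phi>)"
    by (rule continuous_on_coefficient[OF continuous_on_derivative_along[OF u] \<phi>c]) (intro continuous_intros)+
  have "sip (\<lambda>\<omega>. u (r *\<^sub>R \<omega>)) \<phi> = sip (\<lambda>\<omega>. 0) \<phi>" if "r = a \<or> r = b" for r
    by (rule sip_cong) (use vanish that ab in auto)
  then show "sip (\<lambda>\<omega>. u (a *\<^sub>R \<omega>)) \<phi> = 0" "sip (\<lambda>\<omega>. u (b *\<^sub>R \<omega>)) \<phi> = 0"
    by (simp_all add: sip_def)
  show "1 \<le> \<bar>real_of_int k - real_of_int j\<bar> \<or>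
      real_of_int k = real_of_int j \<and> (\<exists>r\<in>{1..2}. sip (\<lambda>\<omega>. u (r *\<^sub>R \<omega>)) \<phi> = 0)"
  proof (cases "k = j")
    case False
    then have "1 \<le> \<bar>k - j\<bar>" by linarith
    then have "1 \<le> real_of_int \<bar>k - j\<bar>" by linarith
    then show ?thesis by simp
  qed (use res in blast)
qed

text \<open>The radial inequalities are added up over a finite set of modes; by the inequality of Bessel the
coefficients of \<open>(r \<partial>_r + L) u\<close> add up to at most its squared norm.\<close>

lemma truncated_inequality:
  fixes u :: "real ^ 'n::{finite,linorder} \<Rightarrow> 'b"
  assumes u: "Ck_on (Suc 0) u UNIV" and ab: "0 < a" "a \<le> 1" "2 \<le> b"
    and vanish: "\<And>x. norm x = a \<or> norm x = b \<Longrightarrow> u x = 0"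
    and res: "\<And>\<phi>. \<phi> \<in> E j \<Longrightarrow> \<exists>r\<in>{1..2}. sip (\<lambda>\<omega>. u (r *\<^sub>R \<omega>)) \<phi> = 0"
    and B: "eigen_orthonormal B"
    and int: "(\<lambda>r. r powr (2 * real_of_int j - 1) *
      sip (\<lambda>\<omega>. cmul (r *\<^sub>R \<omega>) (dirac_op u (r *\<^sub>R \<omega>))) (\<lambda>\<omega>. cmul (r *\<^sub>R \<omega>) (dirac_op u (r *\<^sub>R \<omega>)))) integrable_on {a..b}"
  shows "(\<lambda>r. r powr (2 * real_of_int j - 1) * (1 + \<bar>ln r\<bar>) powr (-2) * (\<Sum>\<phi>\<in>B. (sip (\<lambda>\<omega>. u (r *\<^sub>R \<omega>)) \<phi>)\<^sup>2)) integrable_on {a..b}" (is ?int)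
   and "integral {a..b} (\<lambda>r. r powr (2 * real_of_int j - 1) * (1 + \<bar>ln r\<bar>) powr (-2) * (\<Sum>\<phi>\<in>B. (sip (\<lambda>\<omega>. u (r *\<^sub>R \<omega>)) \<phi>)\<^sup>2)) / 16
    \<le> integral {a..b} (\<lambda>r. r powr (2 * real_of_int j - 1) *
      sip (\<lambda>\<omega>. cmul (r *\<^sub>R \<omega>) (dirac_op u (r *\<^sub>R \<omega>))) (\<lambda>\<omega>. cmul (r *\<^sub>R \<omega>) (dirac_op u (r *\<^sub>R \<omega>))))" (is ?le)
proof -
  define \<rho> where "\<rho> r = r powr (2 * real_of_int j - 1)" for r
  define w where "w r = (1 + \<bar>ln r\<bar>) powr (-2)" for r :: real
  define U where "U r = (\<lambda>\<omega>. u (r *\<^sub>R \<omega>))" for r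
  define G where "G r = (\<lambda>\<omega>. cmul (r *\<^sub>R \<omega>) (dirac_op u (r *\<^sub>R \<omega>)))" for r
  have on: "sphere_orthonormal B" using B by (simp add: eigen_orthonormal_def)
  have fin: "finite B" by (rule sphere_orthonormalD(1)[OF on])
  have uc: "continuous_on UNIV u" using Ck_on_SucD[OF u] by simp
  note dirc = continuous_on_dir[OF u]
  have cmulc: "continuous_on X (\<lambda>p. cmul (g p) (dirac_op u (g p)))" if "continuous_on X g" for X :: "'z::topological_space set" and g
  proof -
    have d: "continuous_on X (\<lambda>p. dirac_op u (g p))" by (rule continuous_on_compose2[OF dirc that]) simp
    show ?thesis unfolding cmul_def
      using lin by (intro continuous_on_sum continuous_on_scaleR bounded_linear.continuous_on[of "s _"] d bounded_linear.continuous_on[OF bounded_linear_vec_nth that])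
         (simp add: linear_conv_bounded_linear)
  qed
  have Gc: "sphere_cont (G r)" for r unfolding G_def by (intro cmulc continuous_intros)
  have \<rho>c: "continuous_on {a..b} \<rho>"
    unfolding \<rho>_def by (intro continuous_at_imp_continuous_on ballI DERIV_isCont[OF has_real_derivative_powr]) (use ab in auto)
  have wc: "continuous_on {a..b} w"
  proof -
    have "continuous_on {a..b} (\<lambda>r. 1 + \<bar>ln r\<bar>)" by (intro continuous_intros) (use ab in auto)
    then show ?thesis unfolding w_def
    proof (rule continuous_on_powr[OF _ continuous_on_const], intro ballI)
      fix r show "1 + \<bar>ln r\<bar> \<noteq> (0::real)" using abs_ge_zero[of "ln r"] by linarith
    qed
  qed
  have Uphi: "continuous_on {a..b} (\<lambda>r. sip (U r) \<phi>)" if "\<phi> \<in> B" for \<phi>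
    unfolding U_def
    by (rule continuous_on_coefficient[OF continuous_on_compose2[OF uc] sphere_orthonormalD(2)[OF on that]])
       (auto intro!: continuous_intros)
  have Gphi: "continuous_on {a..b} (\<lambda>r. sip (G r) \<phi>)" if "\<phi> \<in> B" for \<phi>
    unfolding G_def
    by (rule continuous_on_coefficient[OF cmulc sphere_orthonormalD(2)[OF on that]]) (intro continuous_intros)
  have "continuous_on {a..b} (\<lambda>r. \<rho> r * w r * (\<Sum>\<phi>\<in>B. (sip (U r) \<phi>)\<^sup>2))"
    by (intro continuous_on_mult continuous_on_sum continuous_on_power \<rho>c wc Uphi)
  then show ?int using integrable_continuous_real by (simp add: \<rho>_def w_def U_def)
  have int\<phi>: "(\<lambda>r. \<rho> r * w r * (sip (U r) \<phi>)\<^sup>2) integrable_on {a..b}" if "\<phi> \<in> B" for \<phi>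
    by (intro integrable_continuous_real continuous_on_mult continuous_on_power \<rho>c wc Uphi that)
  have intG: "(\<lambda>r. \<rho> r * (sip (G r) \<phi>)\<^sup>2) integrable_on {a..b}" if "\<phi> \<in> B" for \<phi>
    by (intro integrable_continuous_real continuous_on_mult continuous_on_power \<rho>c Gphi that)
  have mode: "integral {a..b} (\<lambda>r. \<rho> r * w r * (sip (U r) \<phi>)\<^sup>2) / 16 \<le> integral {a..b} (\<lambda>r. \<rho> r * (sip (G r) \<phi>)\<^sup>2)"
    if \<phi>: "\<phi> \<in> B" for \<phi>
  proof -
    obtain k where k: "\<phi> \<in> E k" using B \<phi> by (auto simp: eigen_orthonormal_def)
    show ?thesis unfolding \<rho>_def w_def U_def G_def
      by (rule mode_inequality[OF u ab vanish k]) (use res k in auto)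
  qed
  have "integral {a..b} (\<lambda>r. \<rho> r * w r * (\<Sum>\<phi>\<in>B. (sip (U r) \<phi>)\<^sup>2)) =
      (\<Sum>\<phi>\<in>B. integral {a..b} (\<lambda>r. \<rho> r * w r * (sip (U r) \<phi>)\<^sup>2))"
    unfolding sum_distrib_left by (rule Henstock_Kurzweil_Integration.integral_sum[OF fin int\<phi>])
  then have "integral {a..b} (\<lambda>r. \<rho> r * w r * (\<Sum>\<phi>\<in>B. (sip (U r) \<phi>)\<^sup>2)) / 16 =
      (\<Sum>\<phi>\<in>B. integral {a..b} (\<lambda>r. \<rho> r * w r * (sip (U r) \<phi>)\<^sup>2) / 16)"
    by (simp only: sum_divide_distrib)
  also have "\<dots> \<le> (\<Sum>\<phi>\<in>B. integral {a..b} (\<lambda>r. \<rho> r * (sip (G r) \<phi>)\<^sup>2))"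
    by (rule sum_mono[OF mode])
  also have "\<dots> = integral {a..b} (\<lambda>r. \<Sum>\<phi>\<in>B. \<rho> r * (sip (G r) \<phi>)\<^sup>2)"
    by (rule Henstock_Kurzweil_Integration.integral_sum[OF fin intG, symmetric])
  also have "\<dots> \<le> integral {a..b} (\<lambda>r. \<rho> r * sip (G r) (G r))"
  proof (rule integral_le)
    show "(\<lambda>r. \<Sum>\<phi>\<in>B. \<rho> r * (sip (G r) \<phi>)\<^sup>2) integrable_on {a..b}"
      by (rule integrable_sum[OF fin intG])
    show "(\<lambda>r. \<rho> r * sip (G r) (G r)) integrable_on {a..b}" using int by (simp only: \<rho>_def G_def)
    fix r
    have "\<rho> r * (\<Sum>\<phi>\<in>B. (sip (G r) \<phi>)\<^sup>2) \<le> \<rho> r * sip (G r) (G r)"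
      by (rule mult_left_mono[OF sphere_bessel[OF on Gc]]) (simp add: \<rho>_def)
    then show "(\<Sum>\<phi>\<in>B. \<rho> r * (sip (G r) \<phi>)\<^sup>2) \<le> \<rho> r * sip (G r) (G r)" by (simp only: sum_distrib_left)
  qed
  finally show ?le by (simp only: \<rho>_def w_def U_def G_def)
qed

text \<open>The truncated inequalities pass to the limit by Parseval and dominated convergence. The radial
interval is enlarged so that it contains \<open>{1..2}\<close> and the function vanishes at both ends.\<close>

lemma weighted_energy_inequality:
  fixes u :: "real ^ 'n::{finite,linorder} \<Rightarrow> 'b"
  assumes n: "CARD('n) \<ge> 2" and u: "Ck_on (Suc 0) u UNIV" and p: "0 < p"
    and supp: "\<And>x. u x \<noteq> 0 \<Longrightarrow> norm x \<in> {p..q}"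
    and j: "real_of_int j = (real CARD('n) - 2 - \<beta>) / 2"
    and res: "\<And>\<phi>. \<phi> \<in> E j \<Longrightarrow> \<exists>r\<in>{1..2}. sip (\<lambda>\<omega>. u (r *\<^sub>R \<omega>)) \<phi> = 0"
  shows "1 / 16 * (\<integral>x. norm x powr (- \<beta> - 2) * (1 + \<bar>ln (norm x)\<bar>) powr (-2) * (norm (u x))\<^sup>2 \<partial>lborel)
    \<le> (\<integral>x. norm x powr (- \<beta>) * (norm (dirac_op u x))\<^sup>2 \<partial>lborel)"
proof -
  define a where "a = min p 1 / 2"
  define b where "b = max q 2 + 1"
  have ab: "0 < a" "a \<le> 1" "2 \<le> b" and apq: "a < p" "q < b" using p by (auto simp: a_def b_def)
  have vanish: "u x = 0" if "norm x = a \<or> norm x = b" for x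
  proof (rule ccontr)
    assume "u x \<noteq> 0"
    then have "norm x \<in> {p..q}" by (rule supp)
    then show False using that apq by auto
  qed
  have uc: "continuous_on UNIV u" using Ck_on_SucD[OF u] by simp
  have dir0: "dirac_op u x = 0" if "norm x \<notin> {a..b}" for x
  proof -
    have op: "open {y :: real ^ 'n::{finite,linorder}. norm y < p \<or> q < norm y}"
      by (intro open_Collect_disj open_Collect_less continuous_intros)
    have "frechet_derivative u (at x) = frechet_derivative (\<lambda>_. 0) (at x)"
      by (rule frechet_derivative_cong_open[OF op]) (use that apq supp in force)+
    then show ?thesis by (simp add: dirac_op_def linear_0[OF lin])
  qed
  note dirc = continuous_on_dir[OF u]
  define U where "U r = (\<lambda>\<omega>. u (r *\<^sub>R \<omega>))" for r
  define G where "G r = (\<lambda>\<omega>. cmul (r *\<^sub>R \<omega>) (dirac_op u (r *\<^sub>R \<omega>)))" for r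
  define \<rho> where "\<rho> r = r powr (2 * real_of_int j - 1)" for r
  define w where "w r = (1 + \<bar>ln r\<bar>) powr (-2)" for r :: real
  have Uc: "sphere_cont (U r)" for r
    unfolding U_def by (rule continuous_on_compose2[OF uc]) (auto intro!: continuous_intros)
  have powr_c: "continuous_on (- {0}) (\<lambda>x :: real ^ 'n::{finite,linorder}. norm x powr t)" for t
    by (rule continuous_on_powr[OF _ continuous_on_const]) (auto intro: continuous_on_norm continuous_on_id)
  have w_c: "continuous_on (- {0}) (\<lambda>x :: real ^ 'n::{finite,linorder}. (1 + \<bar>ln (norm x)\<bar>) powr (-2))"
  proof (rule continuous_on_powr[OF _ continuous_on_const])
    show "continuous_on (- {0}) (\<lambda>x :: real ^ 'n::{finite,linorder}. 1 + \<bar>ln (norm x)\<bar>)"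
      by (intro continuous_intros) auto
    show "\<forall>x\<in>- {0}. 1 + \<bar>ln (norm (x :: real ^ 'n::{finite,linorder}))\<bar> \<noteq> 0"
    proof
      fix x :: "real ^ 'n::{finite,linorder}" show "1 + \<bar>ln (norm x)\<bar> \<noteq> 0"
        using abs_ge_zero[of "ln (norm x)"] by linarith
    qed
  qed
  have jac: "r ^ (DIM(real ^ 'n::{finite,linorder}) - 1) * r powr (- \<beta> - 2) = \<rho> r" if "r > 0" for r
  proof -
    have "r ^ (DIM(real ^ 'n::{finite,linorder}) - 1) = r powr (real CARD('n) - 1)"
      using that n by (simp add: powr_realpow[symmetric] of_nat_diff)
    then have "r ^ (DIM(real ^ 'n::{finite,linorder}) - 1) * r powr (- \<beta> - 2) = r powr ((real CARD('n) - 1) + (- \<beta> - 2))"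
      by (simp only: powr_add)
    also have "(real CARD('n) - 1) + (- \<beta> - 2) = 2 * real_of_int j - 1" using j by (simp add: field_simps)
    finally show ?thesis by (simp only: \<rho>_def)
  qed
  let ?f1 = "\<lambda>x. norm x powr (- \<beta>) * (norm (dirac_op u x))\<^sup>2"
  let ?f2 = "\<lambda>x. norm x powr (- \<beta> - 2) * (1 + \<bar>ln (norm x)\<bar>) powr (-2) * (norm (u x))\<^sup>2"
  have P1: "((\<lambda>r. r ^ (DIM(real ^ 'n::{finite,linorder}) - 1) * (\<integral>\<omega>. ?f1 (r *\<^sub>R \<omega>) \<partial>sphere_measure))
      has_integral (\<integral>x. ?f1 x \<partial>lborel)) {a..b}"
  proof (rule polar_coordinates[OF _ ab(1)])
    show "continuous_on (- {0}) ?f1"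
      by (intro continuous_on_mult continuous_on_power continuous_on_norm powr_c continuous_on_subset[OF dirc]) simp
    show "norm x \<in> {a..b}" if "?f1 x \<noteq> 0" for x using dir0[of x] that by (cases "norm x \<in> {a..b}") auto
  qed
  have P2: "((\<lambda>r. r ^ (DIM(real ^ 'n::{finite,linorder}) - 1) * (\<integral>\<omega>. ?f2 (r *\<^sub>R \<omega>) \<partial>sphere_measure))
      has_integral (\<integral>x. ?f2 x \<partial>lborel)) {a..b}"
  proof (rule polar_coordinates[OF _ ab(1)])
    show "continuous_on (- {0}) ?f2"
      by (intro continuous_on_mult continuous_on_power continuous_on_norm powr_c w_c continuous_on_subset[OF uc]) simp
    show "norm x \<in> {a..b}" if "?f2 x \<noteq> 0" for x
    proof -
      have "u x \<noteq> 0" using that by auto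
      then have "norm x \<in> {p..q}" by (rule supp)
      then show ?thesis using apq by auto
    qed
  qed
  have Q1: "((\<lambda>r. \<rho> r * sip (G r) (G r)) has_integral (\<integral>x. ?f1 x \<partial>lborel)) {a..b}"
  proof (rule has_integral_eq[OF _ P1])
    fix r assume "r \<in> {a..b}"
    then have r: "r > 0" using ab by auto
    have "(\<integral>\<omega>. ?f1 (r *\<^sub>R \<omega>) \<partial>sphere_measure) = (\<integral>\<omega>. r powr (- \<beta> - 2) * (G r \<omega> \<bullet> G r \<omega>) \<partial>sphere_measure)"
    proof (rule Bochner_Integration.integral_cong[OF refl])
      fix \<omega> :: "real ^ 'n::{finite,linorder}" assume "\<omega> \<in> space sphere_measure"
      then have \<omega>: "norm \<omega> = 1" by simp
      have "norm (G r \<omega>) = r * norm (dirac_op u (r *\<^sub>R \<omega>))" unfolding G_def norm_cmul using \<omega> r by simp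
      then have "G r \<omega> \<bullet> G r \<omega> = r\<^sup>2 * (norm (dirac_op u (r *\<^sub>R \<omega>)))\<^sup>2"
        by (simp only: power2_norm_eq_inner[symmetric, of "G r \<omega>"] power_mult_distrib)
      moreover have "r powr (- \<beta> - 2) * r\<^sup>2 = r powr (- \<beta>)"
      proof -
        have "r powr (- \<beta> - 2) * r\<^sup>2 = r powr (- \<beta> - 2) * r powr 2" using r by simp
        also have "\<dots> = r powr ((- \<beta> - 2) + 2)" by (simp only: powr_add)
        finally show ?thesis by simp
      qed
      ultimately show "?f1 (r *\<^sub>R \<omega>) = r powr (- \<beta> - 2) * (G r \<omega> \<bullet> G r \<omega>)"
        using \<omega> r by (simp add: mult.assoc[symmetric])
    qed
    then show "r ^ (DIM(real ^ 'n::{finite,linorder}) - 1) * (\<integral>\<omega>. ?f1 (r *\<^sub>R \<omega>) \<partial>sphere_measure) = \<rho> r * sip (G r) (G r)"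
      using jac[OF r] by (simp add: sip_def mult.assoc[symmetric])
  qed
  have Q2: "((\<lambda>r. \<rho> r * w r * sip (U r) (U r)) has_integral (\<integral>x. ?f2 x \<partial>lborel)) {a..b}"
  proof (rule has_integral_eq[OF _ P2])
    fix r assume "r \<in> {a..b}"
    then have r: "r > 0" using ab by auto
    have "(\<integral>\<omega>. ?f2 (r *\<^sub>R \<omega>) \<partial>sphere_measure) = (\<integral>\<omega>. (r powr (- \<beta> - 2) * w r) * (U r \<omega> \<bullet> U r \<omega>) \<partial>sphere_measure)"
      by (rule Bochner_Integration.integral_cong[OF refl])
         (use r in \<open>simp add: w_def U_def power2_norm_eq_inner\<close>)
    then show "r ^ (DIM(real ^ 'n::{finite,linorder}) - 1) * (\<integral>\<omega>. ?f2 (r *\<^sub>R \<omega>) \<partial>sphere_measure) = \<rho> r * w r * sip (U r) (U r)"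
      using jac[OF r] by (simp add: sip_def mult.assoc[symmetric])
  qed
  have "\<forall>N. \<exists>B. eigen_orthonormal B \<and> (\<forall>d\<le>N. \<forall>p. hpoly d p \<longrightarrow> sphere_rep B p)"
    using eigenbasis_exists[OF n] by (rule allI)
  from choice[OF this] obtain B where B: "\<forall>N. eigen_orthonormal (B N) \<and> (\<forall>d\<le>N. \<forall>p. hpoly d p \<longrightarrow> sphere_rep (B N) p)" ..
  have Beig: "eigen_orthonormal (B N)" for N using B by blast
  have Bon: "sphere_orthonormal (B N)" for N using Beig[of N] by (simp add: eigen_orthonormal_def)
  have intQ1: "(\<lambda>r. \<rho> r * sip (G r) (G r)) integrable_on {a..b}" using Q1 by blast
  note tr = truncated_inequality[OF u ab vanish res Beig intQ1[unfolded \<rho>_def G_def]]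
  have trI: "(\<lambda>r. \<rho> r * w r * (\<Sum>\<phi>\<in>B N. (sip (U r) \<phi>)\<^sup>2)) integrable_on {a..b}" for N
    using tr(1)[of N] by (simp only: \<rho>_def w_def U_def)
  have trL: "integral {a..b} (\<lambda>r. \<rho> r * w r * (\<Sum>\<phi>\<in>B N. (sip (U r) \<phi>)\<^sup>2)) / 16 \<le> (\<integral>x. ?f1 x \<partial>lborel)" for N
    using tr(2)[of N] unfolding integral_unique[OF Q1, symmetric] by (simp only: \<rho>_def w_def U_def G_def)
  have conv: "(\<lambda>N. \<Sum>\<phi>\<in>B N. (sip (U r) \<phi>)\<^sup>2) \<longlonglongrightarrow> sip (U r) (U r)" for r
  proof (rule LIMSEQ_I)
    fix e :: real assume e: "0 < e"
    obtain N0 where N0: "\<forall>B. sphere_orthonormal B \<longrightarrow> (\<forall>d\<le>N0. \<forall>p. hpoly d p \<longrightarrow> sphere_rep B p) \<longrightarrow>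
        sip (U r) (U r) - (\<Sum>b\<in>B. (sip (U r) b)\<^sup>2) \<le> e / 2"
      using sphere_parseval_density[OF Uc half_gt_zero[OF e]] by blast
    show "\<exists>no. \<forall>N\<ge>no. norm ((\<Sum>\<phi>\<in>B N. (sip (U r) \<phi>)\<^sup>2) - sip (U r) (U r)) < e"
    proof (intro exI[of _ N0] allI impI)
      fix N assume N: "N0 \<le> N"
      have "\<forall>d\<le>N0. \<forall>p. hpoly d p \<longrightarrow> sphere_rep (B N) p"
        using B[THEN spec, of N, THEN conjunct2] N by (meson order_trans)
      then have "sip (U r) (U r) - (\<Sum>b\<in>B N. (sip (U r) b)\<^sup>2) \<le> e / 2"
        using N0[THEN spec, of "B N"] Bon[of N] by blast
      then show "norm ((\<Sum>\<phi>\<in>B N. (sip (U r) \<phi>)\<^sup>2) - sip (U r) (U r)) < e"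
        using sphere_bessel[OF Bon[of N] Uc, of r] e unfolding real_norm_def by linarith
    qed
  qed
  have "(\<lambda>N. integral {a..b} (\<lambda>r. \<rho> r * w r * (\<Sum>\<phi>\<in>B N. (sip (U r) \<phi>)\<^sup>2))) \<longlonglongrightarrow>
      integral {a..b} (\<lambda>r. \<rho> r * w r * sip (U r) (U r))"
  proof (rule dominated_convergence(2)[OF trI])
    show "(\<lambda>r. \<rho> r * w r * sip (U r) (U r)) integrable_on {a..b}" using Q2 by blast
    fix r assume "r \<in> {a..b}"
    show "(\<lambda>N. \<rho> r * w r * (\<Sum>\<phi>\<in>B N. (sip (U r) \<phi>)\<^sup>2)) \<longlonglongrightarrow> \<rho> r * w r * sip (U r) (U r)"
      by (rule tendsto_mult_left[OF conv])
    fix N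
    have nn: "0 \<le> \<rho> r * w r" by (simp add: \<rho>_def w_def)
    have "0 \<le> (\<Sum>\<phi>\<in>B N. (sip (U r) \<phi>)\<^sup>2)" by (simp add: sum_nonneg)
    then show "norm (\<rho> r * w r * (\<Sum>\<phi>\<in>B N. (sip (U r) \<phi>)\<^sup>2)) \<le> \<rho> r * w r * sip (U r) (U r)"
      using nn mult_left_mono[OF sphere_bessel[OF Bon[of N] Uc] nn, of r] by simp
  qed
  then have "(\<lambda>N. integral {a..b} (\<lambda>r. \<rho> r * w r * (\<Sum>\<phi>\<in>B N. (sip (U r) \<phi>)\<^sup>2)) / 16) \<longlonglongrightarrow> (\<integral>x. ?f2 x \<partial>lborel) / 16"
    unfolding integral_unique[OF Q2] by (rule tendsto_divide[OF _ tendsto_const]) simp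
  then have "(\<integral>x. ?f2 x \<partial>lborel) / 16 \<le> (\<integral>x. ?f1 x \<partial>lborel)"
    by (rule LIMSEQ_le_const2) (use trL in blast)
  then show ?thesis by simp
qed

end


section \<open>Complex matrices\<close>

text \<open>Mean value theorem for the primitive of \<open>r c(r)\<close>. It needs a real-valued \<open>c\<close>, one of
the reasons for working with real scalar products.\<close>

lemma weighted_mean_zero_imp_root:
  fixes c :: "real \<Rightarrow> real"
  assumes c: "continuous_on {1..2} c" and mean: "(LINT r:{1..2}|lborel. r * c r) = 0"
  shows "\<exists>r\<in>{1..2}. c r = 0"
proof -
  have g: "continuous_on {1..2} (\<lambda>r. r * c r)" by (intro continuous_intros c)
  have "set_integrable lborel {1..2} (\<lambda>r. r * c r)" by (rule borel_integrable_atLeastAtMost'[OF g])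
  from set_borel_integral_eq_integral(2)[OF this] have zero: "integral {1..2} (\<lambda>r. r * c r) = 0"
    using mean by simp
  define G where "G t = integral {1..t} (\<lambda>r. r * c r)" for t
  have "\<exists>x\<in>{1<..<2}. G 2 - G 1 = x * c x * (2 - 1)"
  proof (rule mvt_simple)
    fix x :: real assume x: "1 \<le> x" "x \<le> 2"
    have "(G has_real_derivative x * c x) (at x within {1..2})"
      unfolding G_def by (rule integral_has_real_derivative[OF g]) (use x in auto)
    then show "(G has_derivative (\<lambda>h. x * c x * h)) (at x within {1..2})"
      by (simp add: has_field_derivative_def)
  qed simp
  then obtain x where x: "x \<in> {1<..<2}" "G 2 - G 1 = x * c x" by auto
  have "G 2 - G 1 = 0" using zero by (simp add: G_def)
  then have "c x = 0" using x by auto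
  then show ?thesis using x(1) by (intro bexI[of _ x]) auto
qed

lemma linear_matrix_vector_mult_complex:
  "linear ((*v) (A :: complex ^ 'm::finite ^ 'm))"
  by (rule linearI)
     (simp_all add: vec_eq_iff matrix_vector_mult_def distrib_left sum.distrib scaleR_sum_right)

lemma hermitian_adjoint:
  fixes A :: "complex ^ 'm::finite ^ 'm"
  assumes "hermitian A"
  shows "(A *v v) \<bullet> w = v \<bullet> (A *v w)"
proof -
  have c: "(x * y) \<bullet> z = y \<bullet> (cnj x * z)" for x y z :: complex
    by (simp add: inner_complex_def algebra_simps)
  have "(A *v v) \<bullet> w = (\<Sum>a\<in>UNIV. \<Sum>b\<in>UNIV. (A $ a $ b * v $ b) \<bullet> w $ a)"
    by (simp add: inner_vec_def matrix_vector_mult_def inner_sum_left)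
  also have "\<dots> = (\<Sum>b\<in>UNIV. \<Sum>a\<in>UNIV. (A $ a $ b * v $ b) \<bullet> w $ a)" by (rule sum.swap)
  also have "\<dots> = (\<Sum>b\<in>UNIV. \<Sum>a\<in>UNIV. v $ b \<bullet> (A $ b $ a * w $ a))"
  proof (intro sum.cong refl)
    fix a b
    have "cnj (A $ a $ b) = A $ b $ a" using assms unfolding hermitian_def by (metis complex_cnj_cnj)
    then show "(A $ a $ b * v $ b) \<bullet> w $ a = v $ b \<bullet> (A $ b $ a * w $ a)" by (simp add: c)
  qed
  also have "\<dots> = v \<bullet> (A *v w)"
    by (simp add: inner_vec_def matrix_vector_mult_def inner_sum_right)
  finally show ?thesis .
qed

lemma mat_vector_mult_complex:
  "(mat (of_real c) :: complex ^ 'm::finite ^ 'm) *v v = c *\<^sub>R v"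
proof (rule vec_eq_iff[THEN iffD2], rule allI)
  fix a
  have "(if a = b then of_real c else 0) * v $ b = (if b = a then of_real c * v $ a else 0)" for b by simp
  then have "((mat (of_real c) :: complex ^ 'm ^ 'm) *v v) $ a = of_real c * v $ a"
    by (simp add: matrix_vector_mult_def mat_def)
  also have "\<dots> = c *\<^sub>R (v $ a)" by (rule scaleR_conv_of_real[symmetric])
  finally show "((mat (of_real c) :: complex ^ 'm ^ 'm) *v v) $ a = (c *\<^sub>R v) $ a" by simp
qed

lemma clifford_matrices:
  fixes \<sigma> :: "'n::{finite,linorder} \<Rightarrow> complex ^ 'm::finite ^ 'm"
  assumes "\<And>i. hermitian (\<sigma> i)"
    and cl: "\<And>i l. \<sigma> i ** \<sigma> l + \<sigma> l ** \<sigma> i = mat (if i = l then 2 else 0)"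
  shows "clifford (\<lambda>i. (*v) (\<sigma> i))"
proof (rule clifford.intro)
  fix i l and v w :: "complex ^ 'm"
  show "linear ((*v) (\<sigma> i))" by (rule linear_matrix_vector_mult_complex)
  show "(\<sigma> i *v v) \<bullet> w = v \<bullet> (\<sigma> i *v w)" by (rule hermitian_adjoint[OF assms(1)])
  have "\<sigma> i *v (\<sigma> l *v v) + \<sigma> l *v (\<sigma> i *v v) = (\<sigma> i ** \<sigma> l + \<sigma> l ** \<sigma> i) *v v"
    by (simp add: matrix_vector_mul_assoc matrix_vector_mult_add_rdistrib)
  also have "\<dots> = mat (of_real (if i = l then 2 else 0)) *v v" unfolding cl by simp
  also have "\<dots> = (if i = l then 2 else 0) *\<^sub>R v" by (rule mat_vector_mult_complex)
  finally show "\<sigma> i *v (\<sigma> l *v v) + \<sigma> l *v (\<sigma> i *v v) = (if i = l then 2 else 0) *\<^sub>R v" .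
qed

text \<open>Multiplication by the imaginary unit, a real linear map that commutes with complex matrices.\<close>

definition cplx_rot :: "complex ^ 'm \<Rightarrow> complex ^ 'm::finite" where
  "cplx_rot v = (\<chi> a. \<i> * v $ a)"

lemma linear_cplx_rot: "linear cplx_rot"
  by (rule linearI) (simp_all add: cplx_rot_def vec_eq_iff algebra_simps)

lemma matrix_cplx_rot: "A *v cplx_rot v = cplx_rot (A *v v)"
  by (simp add: cplx_rot_def vec_eq_iff matrix_vector_mult_def sum_distrib_left algebra_simps)

text \<open>The imaginary part of the complex scalar product is the real one after multiplying the second
argument by \<open>\<i>\<close>. For a complex subspace, real and complex orthogonality therefore agree.\<close>

lemma sphere_inner_eq:
  fixes f g :: "real ^ 'n::finite \<Rightarrow> complex ^ 'm::finite"
  assumes f: "sphere_cont f" and g: "sphere_cont g"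
  shows "sphere_inner f g = Complex (sip f g) (sip f (\<lambda>x. cplx_rot (g x)))"
proof -
  let ?h = "\<lambda>\<omega>. \<Sum>a\<in>UNIV. f \<omega> $ a * cnj (g \<omega> $ a)"
  have "sphere_cont ?h"
    by (intro continuous_on_sum continuous_on_mult continuous_on_cnj
        bounded_linear.continuous_on[OF bounded_linear_vec_nth] f g)
  then have int: "integrable sphere_measure ?h" by (rule integrable_sphere)
  have "Re (sphere_inner f g) = (\<integral>\<omega>. Re (?h \<omega>) \<partial>sphere_measure)"
    unfolding sphere_inner_def by (rule integral_bounded_linear[OF bounded_linear_Re int, symmetric])
  also have "\<dots> = sip f g"
    unfolding sip_def by (rule Bochner_Integration.integral_cong) (simp_all add: inner_vec_def inner_complex_def)
  finally have 1: "Re (sphere_inner f g) = sip f g" .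
  have "Im (sphere_inner f g) = (\<integral>\<omega>. Im (?h \<omega>) \<partial>sphere_measure)"
    unfolding sphere_inner_def by (rule integral_bounded_linear[OF bounded_linear_Im int, symmetric])
  also have "\<dots> = sip f (\<lambda>x. cplx_rot (g x))"
    unfolding sip_def
    by (rule Bochner_Integration.integral_cong)
       (simp_all add: inner_vec_def inner_complex_def cplx_rot_def algebra_simps)
  finally show ?thesis using 1 by (simp add: complex_eq_iff)
qed

context
  fixes \<sigma> :: "'n::{finite,linorder} \<Rightarrow> complex ^ 'm::finite ^ 'm"
  assumes herm: "\<And>i. hermitian (\<sigma> i)"
    and cl: "\<And>i l. \<sigma> i ** \<sigma> l + \<sigma> l ** \<sigma> i = mat (if i = l then 2 else 0)"
begin

interpretation C: clifford "\<lambda>i. (*v) (\<sigma> i)" by (rule clifford_matrices[OF herm cl])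

lemma dirac_eq_dir: "dirac \<sigma> u x = C.dirac_op u x"
  by (simp add: dirac_def C.dirac_op_def partial_def)

lemma L_op_eq_L:
  assumes "f differentiable (at x)"
  shows "L_op \<sigma> f x = C.L f x"
proof -
  have T: "linear (frechet_derivative f (at x))" by (rule linear_frechet_derivative[OF assms])
  show ?thesis
    by (simp add: L_op_def C.L_def partial_def rot_field_def linear_diff[OF T] linear_scale[OF T] matrix_vector_mul_assoc)
qed

lemma eigenspace_L_eq_E: "eigenspace_L \<sigma> k = C.E k"
proof -
  have "L_op \<sigma> (\<lambda>x. \<phi> (x /\<^sub>R norm x)) \<omega> = C.L (\<lambda>x. \<phi> (x /\<^sub>R norm x)) \<omega>"
    if "smooth_on (\<lambda>x. \<phi> (x /\<^sub>R norm x)) (- {0})" "\<omega> \<in> sphere 0 1" for \<phi> \<omega>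
  proof (rule L_op_eq_L)
    have "Ck_on (Suc 0) (\<lambda>x. \<phi> (x /\<^sub>R norm x)) (- {0})" using that(1) unfolding smooth_on_def by blast
    moreover have "\<omega> \<in> - {0}" using that(2) by force
    ultimately show "(\<lambda>x. \<phi> (x /\<^sub>R norm x)) differentiable (at \<omega>)" by simp
  qed
  then show ?thesis unfolding eigenspace_L_def C.E_def by (intro Collect_cong conj_cong refl ball_cong) simp_all
qed

lemma E_cplx_rot:
  assumes \<phi>: "\<phi> \<in> C.E k"
  shows "(\<lambda>x. cplx_rot (\<phi> x)) \<in> C.E k"
proof (rule C.E_intro)
  have bl: "bounded_linear (cplx_rot :: complex ^ 'm \<Rightarrow> complex ^ 'm)"
    using linear_cplx_rot by (simp add: linear_conv_bounded_linear)
  show "cplx_rot (\<phi> x) = 0" if "norm x \<noteq> 1" for x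
    using C.E_props(1)[OF \<phi> that] linear_0[OF linear_cplx_rot] by simp
  show "Ck_on m (\<lambda>x. cplx_rot (\<phi> (x /\<^sub>R norm x))) (- {0})" for m
    by (rule Ck_on_bounded_linear[OF bl _ C.E_props(2)[OF \<phi>]]) auto
  fix \<omega> :: "real ^ 'n::{finite,linorder}" assume \<omega>: "norm \<omega> = 1"
  let ?f = "\<lambda>x. \<phi> (x /\<^sub>R norm x)"
  have "(?f has_derivative frechet_derivative ?f (at \<omega>)) (at \<omega>)"
    using C.E_differentiable[OF \<phi> \<omega>] by (simp add: frechet_derivative_works)
  from bounded_linear.has_derivative[OF bl this]
  have "frechet_derivative (\<lambda>x. cplx_rot (?f x)) (at \<omega>) = (\<lambda>v. cplx_rot (frechet_derivative ?f (at \<omega>) v))"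
    by (rule frechet_derivative_at[symmetric])
  then have "C.L (\<lambda>x. cplx_rot (?f x)) \<omega> = cplx_rot (C.L ?f \<omega>)"
    by (simp add: C.L_def matrix_cplx_rot linear_sum[OF linear_cplx_rot])
  also have "\<dots> = of_int k *\<^sub>R cplx_rot (\<phi> \<omega>)"
    unfolding C.E_props(3)[OF \<phi> \<omega>] by (rule linear_scale[OF linear_cplx_rot])
  finally show "C.L (\<lambda>x. cplx_rot (?f x)) \<omega> = of_int k *\<^sub>R cplx_rot (\<phi> \<omega>)" .
qed

lemma sphere_projection_eq_sproj:
  assumes B: "sphere_orthonormal B" "B \<subseteq> C.E k" "\<forall>\<phi>\<in>C.E k. \<phi> = sproj B \<phi>" and f: "sphere_cont f"
  shows "sphere_projection (eigenspace_L \<sigma> k) f = sproj B f"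
proof -
  have pE: "sproj B f \<in> C.E k"
    unfolding sproj_def[abs_def] by (rule C.E_sum[OF sphere_orthonormalD(1)[OF B(1)] B(2)])
  have res: "sip (\<lambda>\<omega>. f \<omega> - sproj B f \<omega>) \<psi> = 0" if \<psi>: "\<psi> \<in> C.E k" for \<psi>
  proof -
    let ?r = "\<lambda>\<omega>. f \<omega> - sproj B f \<omega>"
    have "sip ?r \<psi> = sip (sproj B \<psi>) ?r" using B(3) \<psi> sip_commute[of ?r \<psi>] by simp
    also have "\<dots> = (\<Sum>b\<in>B. sip \<psi> b * sip ?r b)"
      by (rule sip_sproj_left[OF B(1) sip_residual(1)[OF B(1) f]])
    also have "\<dots> = 0" by (rule sum.neutral) (simp add: sip_residual(2)[OF B(1) f])
    finally show ?thesis .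
  qed
  show ?thesis
    unfolding sphere_projection_def eigenspace_L_eq_E
  proof (rule the_equality, intro conjI ballI)
    show "sproj B f \<in> C.E k" by (rule pE)
    fix \<psi> assume \<psi>: "\<psi> \<in> C.E k"
    show "sphere_inner (\<lambda>\<omega>. f \<omega> - sproj B f \<omega>) \<psi> = 0"
      unfolding sphere_inner_eq[OF sip_residual(1)[OF B(1) f] C.E_sphere_cont[OF \<psi>]]
      using res[OF \<psi>] res[OF E_cplx_rot[OF \<psi>]] by (simp add: complex_eq_iff)
  next
    fix \<phi> assume "\<phi> \<in> C.E k \<and> (\<forall>\<psi>\<in>C.E k. sphere_inner (\<lambda>\<omega>. f \<omega> - \<phi> \<omega>) \<psi> = 0)"
    then have \<phi>: "\<phi> \<in> C.E k" and in0: "\<And>\<psi>. \<psi> \<in> C.E k \<Longrightarrow> sphere_inner (\<lambda>\<omega>. f \<omega> - \<phi> \<omega>) \<psi> = 0" by auto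
    note \<phi>c = C.E_sphere_cont[OF \<phi>]
    define \<psi> where "\<psi> x = \<phi> x - sproj B f x" for x
    have \<psi>: "\<psi> \<in> C.E k" unfolding \<psi>_def by (rule C.E_diff[OF \<phi> pE])
    note \<psi>c = C.E_sphere_cont[OF \<psi>]
    have c1: "sphere_cont (\<lambda>\<omega>. f \<omega> - \<phi> \<omega>)" by (intro continuous_on_diff f \<phi>c)
    have 1: "sip (\<lambda>\<omega>. f \<omega> - \<phi> \<omega>) \<psi> = 0"
      using in0[OF \<psi>] unfolding sphere_inner_eq[OF c1 \<psi>c] by (simp add: complex_eq_iff)
    have "sip \<psi> \<psi> = sip (\<lambda>\<omega>. (f \<omega> - sproj B f \<omega>) - (f \<omega> - \<phi> \<omega>)) \<psi>"
      by (rule sip_cong) (simp_all add: \<psi>_def)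
    also have "\<dots> = 0"
      unfolding sip_diff_left[OF sip_residual(1)[OF B(1) f] c1 \<psi>c] 1 res[OF \<psi>] by simp
    finally have z: "sip \<psi> \<psi> = 0" .
    show "\<phi> = sproj B f"
    proof
      fix x
      have "\<psi> x = 0"
        by (cases "norm x = 1") (use sip_eq_0_imp[OF \<psi>c z, of x] C.E_props(1)[OF \<psi>, of x] in auto)
      then show "\<phi> x = sproj B f x" by (simp add: \<psi>_def)
    qed
  qed
qed

text \<open>The mean condition says that the projection of \<open>u\<close> has vanishing weighted mean at every point of
the sphere; by linear independence so does each Fourier coefficient in the eigenspace.\<close>

lemma zero_annulus_mean_imp_root:
  fixes u :: "real ^ 'n::{finite,linorder} \<Rightarrow> complex ^ 'm"
  assumes n: "CARD('n) \<ge> 2" and uc: "continuous_on UNIV u"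
    and mean: "zero_annulus_mean \<sigma> j u" and \<phi>: "\<phi> \<in> C.E j"
  shows "\<exists>r\<in>{1..2}. sip (\<lambda>\<omega>. u (r *\<^sub>R \<omega>)) \<phi> = 0"
proof -
  define U where "U r = (\<lambda>\<omega>. u (r *\<^sub>R \<omega>))" for r
  have Uc: "sphere_cont (U r)" for r
    unfolding U_def by (rule continuous_on_compose2[OF uc]) (auto intro!: continuous_intros)
  obtain B where B: "sphere_orthonormal B" "B \<subseteq> C.E j" "\<forall>\<phi>\<in>C.E j. \<phi> = sproj B \<phi>"
    using C.E_finite_orthonormal_basis[OF n, of j] by blast
  have fin: "finite B" by (rule sphere_orthonormalD(1)[OF B(1)])
  have coef: "continuous_on {1..2} (\<lambda>r. sip (U r) \<psi>)" if "\<psi> \<in> C.E j" for \<psi>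
    unfolding U_def
    by (rule C.continuous_on_coefficient[OF continuous_on_compose2[OF uc] C.E_sphere_cont[OF that]])
       (auto intro!: continuous_intros)
  have int: "set_integrable lborel {1..2} (\<lambda>r. r * sip (U r) \<psi>)" if "\<psi> \<in> C.E j" for \<psi>
    by (rule borel_integrable_atLeastAtMost') (intro continuous_on_mult continuous_on_id coef that)
  define A where "A b = (LINT r:{1..2}|lborel. r * sip (U r) b)" for b
  have sum0: "(\<Sum>b\<in>B. A b *\<^sub>R b \<omega>) = 0" if \<omega>: "norm \<omega> = 1" for \<omega>
  proof -
    have "(LINT r:{1..2}|lborel. r *\<^sub>R P_op \<sigma> j u (r *\<^sub>R \<omega>)) = 0"
      using mean \<omega> unfolding zero_annulus_mean_def by simp
    also have "(LINT r:{1..2}|lborel. r *\<^sub>R P_op \<sigma> j u (r *\<^sub>R \<omega>)) =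
        (LINT r:{1..2}|lborel. (\<Sum>b\<in>B. (r * sip (U r) b) *\<^sub>R b \<omega>))"
    proof (rule set_lebesgue_integral_cong)
      show "\<forall>r. r \<in> {1..2} \<longrightarrow> r *\<^sub>R P_op \<sigma> j u (r *\<^sub>R \<omega>) = (\<Sum>b\<in>B. (r * sip (U r) b) *\<^sub>R b \<omega>)"
      proof (intro allI impI)
        fix r :: real assume "r \<in> {1..2}"
        then have r: "r > 0" by simp
        have "P_op \<sigma> j u (r *\<^sub>R \<omega>) = sphere_projection (eigenspace_L \<sigma> j) (U r) \<omega>"
          unfolding P_op_def U_def using r \<omega> by simp
        also have "\<dots> = sproj B (U r) \<omega>" unfolding sphere_projection_eq_sproj[OF B Uc] ..
        finally show "r *\<^sub>R P_op \<sigma> j u (r *\<^sub>R \<omega>) = (\<Sum>b\<in>B. (r * sip (U r) b) *\<^sub>R b \<omega>)"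
          by (simp add: sproj_def scaleR_sum_right)
      qed
    qed simp
    also have "\<dots> = (\<integral>r. (\<Sum>b\<in>B. (indicator {1..2} r *\<^sub>R (r * sip (U r) b)) *\<^sub>R b \<omega>) \<partial>lborel)"
      by (simp add: set_lebesgue_integral_def scaleR_sum_right)
    also have "\<dots> = (\<Sum>b\<in>B. A b *\<^sub>R b \<omega>)"
    proof -
      have "integrable lborel (\<lambda>r. indicator {1..2} r *\<^sub>R (r * sip (U r) b))" if "b \<in> B" for b
        using int[of b] that B(2) unfolding set_integrable_def by blast
      note * = this
      have "(\<integral>r. (\<Sum>b\<in>B. (indicator {1..2} r *\<^sub>R (r * sip (U r) b)) *\<^sub>R b \<omega>) \<partial>lborel) =
        (\<Sum>b\<in>B. \<integral>r. (indicator {1..2} r *\<^sub>R (r * sip (U r) b)) *\<^sub>R b \<omega> \<partial>lborel)"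
        by (rule Bochner_Integration.integral_sum) (intro integrable_scaleR_left *)
      also have "\<dots> = (\<Sum>b\<in>B. A b *\<^sub>R b \<omega>)"
        unfolding A_def set_lebesgue_integral_def
        by (intro sum.cong refl integral_scaleR_left *)
      finally show ?thesis .
    qed
    finally show ?thesis by simp
  qed
  have A0: "A b = 0" if b: "b \<in> B" for b
  proof -
    have "sip (\<lambda>x. \<Sum>c\<in>B. A c *\<^sub>R c x) b = (\<Sum>c\<in>B. A c * sip c b)"
      by (rule sip_sum_left[OF fin]) (use sphere_orthonormalD[OF B(1)] b in auto)
    also have "\<dots> = (\<Sum>c\<in>B. if c = b then A b else 0)"
      by (rule sum.cong) (use sphere_orthonormalD(3)[OF B(1)] b in auto)
    also have "\<dots> = A b" using fin b by simp
    finally have "A b = sip (\<lambda>x. \<Sum>c\<in>B. A c *\<^sub>R c x) b" ..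
    also have "\<dots> = sip (\<lambda>x. 0) b" by (rule sip_cong) (use sum0 in auto)
    also have "\<dots> = 0" by (simp add: sip_def)
    finally show ?thesis .
  qed
  have "sip (U r) \<phi> = (\<Sum>b\<in>B. sip \<phi> b * sip (U r) b)" for r
  proof -
    have "sip (U r) \<phi> = sip (sproj B \<phi>) (U r)" using B(3) \<phi> sip_commute[of "U r" \<phi>] by simp
    then show ?thesis using sip_sproj_left[OF B(1) Uc] by simp
  qed
  then have "(LINT r:{1..2}|lborel. r * sip (U r) \<phi>) = (LINT r:{1..2}|lborel. \<Sum>b\<in>B. sip \<phi> b * (r * sip (U r) b))"
    by (simp add: sum_distrib_left mult_ac)
  also have "\<dots> = (\<Sum>b\<in>B. sip \<phi> b * A b)"
  proof -
    have *: "set_integrable lborel {1..2} (\<lambda>r. sip \<phi> b * (r * sip (U r) b))" if "b \<in> B" for b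
      using int[of b] that B(2) by (intro set_integrable_mult_right) auto
    have "(LINT r:{1..2}|lborel. \<Sum>b\<in>B. sip \<phi> b * (r * sip (U r) b)) =
        (\<Sum>b\<in>B. LINT r:{1..2}|lborel. sip \<phi> b * (r * sip (U r) b))"
      unfolding set_lebesgue_integral_def scaleR_sum_right
      by (rule Bochner_Integration.integral_sum) (use * in \<open>simp add: set_integrable_def\<close>)
    then show ?thesis by (simp add: A_def)
  qed
  also have "\<dots> = 0" by (simp add: A0)
  finally have "(LINT r:{1..2}|lborel. r * sip (U r) \<phi>) = 0" .
  from weighted_mean_zero_imp_root[OF coef[OF \<phi>] this] show ?thesis by (simp add: U_def)
qed

lemma dirac_weighted_inequality:
  assumes n: "CARD('n) \<ge> 2" and j: "real_of_int j = (real CARD('n) - 2 - b) / 2"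
    and u: "u \<in> test_functions_punctured" and mean: "zero_annulus_mean \<sigma> j u"
  shows "1 / 16 * (\<integral>x. norm x powr (-b - 2) * (1 + \<bar>ln (norm x)\<bar>) powr (-2) * (norm (u x))\<^sup>2 \<partial>lborel)
    \<le> (\<integral>x. norm x powr (-b) * (norm (dirac \<sigma> u x))\<^sup>2 \<partial>lborel)"
proof -
  define K where "K = closure {x. u x \<noteq> 0}"
  have "smooth_on u UNIV" and cK: "compact K" "0 \<notin> K"
    using u unfolding test_functions_punctured_def K_def by simp_all
  have u1: "Ck_on (Suc 0) u UNIV" using \<open>smooth_on u UNIV\<close> unfolding smooth_on_def by (rule spec)
  have uc: "continuous_on UNIV u" using Ck_on_SucD[OF u1] by simp
  have "open (- K)" unfolding K_def by (rule open_Compl[OF closed_closure])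
  then obtain p where p: "p > 0" "ball 0 p \<subseteq> - K"
    by (rule openE[of _ 0]) (use cK(2) in simp)
  obtain q where q: "\<forall>x\<in>K. norm x \<le> q"
    using compact_imp_bounded[OF cK(1)] unfolding bounded_iff by blast
  have supp: "norm x \<in> {p..q}" if "u x \<noteq> 0" for x
  proof -
    have "x \<in> K" unfolding K_def by (rule subsetD[OF closure_subset]) (use that in simp)
    then have "x \<notin> ball 0 p" "norm x \<le> q" using p(2) q by blast+
    then show ?thesis by simp
  qed
  show ?thesis
    unfolding dirac_eq_dir
  proof (rule C.weighted_energy_inequality[OF n u1 p(1) _ j])
    show "norm x \<in> {p..q}" if "u x \<noteq> 0" for x by (rule supp[OF that])
    show "\<exists>r\<in>{1..2}. sip (\<lambda>\<omega>. u (r *\<^sub>R \<omega>)) \<phi> = 0" if "\<phi> \<in> C.E j" for \<phi>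
      by (rule zero_annulus_mean_imp_root[OF n uc mean that])
  qed
qed

end

theorem theorem4p2:
  fixes \<sigma> :: "'n::{finite,linorder} \<Rightarrow> complex ^ 'm::finite ^ 'm"
    and b :: real and j :: int
  assumes "CARD('n) \<ge> 2"
    and "\<And>i. hermitian (\<sigma> i)"
    and "\<And>i l. \<sigma> i ** \<sigma> l + \<sigma> l ** \<sigma> i = mat (if i = l then 2 else 0)"
    and "real_of_int j = (real CARD('n) - 2 - b) / 2"
    and "j \<notin> {1..int CARD('n) - 2}"
  shows "\<exists>C>0. \<forall>u \<in> (test_functions_punctured :: (real ^ 'n::{finite,linorder} \<Rightarrow> complex ^ 'm) set).
    zero_annulus_mean \<sigma> j u \<longrightarrow>
      (\<integral>x. norm x powr (-b) * (norm (dirac \<sigma> u x))\<^sup>2 \<partial>lborel)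
      \<ge> C * (\<integral>x. norm x powr (-b - 2) * (1 + \<bar>ln (norm x)\<bar>) powr (-2) * (norm (u x))\<^sup>2 \<partial>lborel)"
proof (intro exI[of _ "1 / 16"] conjI ballI impI)
  show "(0::real) < 1 / 16" by simp
qed (rule dirac_weighted_inequality[OF assms(2,3,1,4)])

end
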